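(* Let $n=2m$ with $m\in\mathbb N$, and let $\mathcal T=(\tau_\nu)_{\nu=0}^{n-1}\in\mathfrak T_n$ be fixed. For arbitrary functions $\tau_{\nu,i}\in L_1[0,1]$ and constants $c_{\nu,i}\in\mathbb C$, $\nu=0,\dots,n-1$, $i=0,\dots,i_\nu-1$, put $$\tau_{\nu,i_\nu}:=(-1)^{i_\nu}\Bigl(\tau_\nu-\sum_{i=0}^{i_\nu-1}(-1)^i\tau_{\nu,i}^{(i)}\Bigr)^{(-i_\nu)}+\sum_{i=0}^{i_\nu-1}c_{\nu,i}x^i,\qquad \nu=0,\dots,n-1.$$ Then $\tau_{\nu,i_\nu}\in L_2[0,1]$. Denote $$\mathscr F(\mathcal T,(\tau_{\nu,i},c_{\nu,i})):=\mathscr S_n(Q),\qquad Q(x):=\sum_{\nu=0}^{n-1}\sum_{i=0}^{i_\nu}\tau_{\nu,i}(x)\chi_{\nu,i}.$$ Then the set of all matrices of $\mathfrak F_n$ associated with the differential expression $\ell_n$ with coefficients $\mathcal T$ is $$\mathfrak F(\mathcal T)=\bigl\{\mathscr F(\mathcal T,(\tau_{\nu,i},c_{\nu,i})):\ \tau_{\nu,i}\in L_1[0,1],\ c_{\nu,i}\in\mathbb C,\ \nu=0,\dots,n-2,\ i=0,\dots,i_\nu-1\bigr\}.$$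
   Context: All functions are complex-valued. $n=2m$, $m\in\mathbb N$. $\mathfrak D=C_0^\infty(0,1)$, $\mathfrak D'$ is the space of distributions on $(0,1)$. For $i\ge 0$, $W_2^{-i}[0,1]$ is the set of distributions $\sigma^{(i)}$ with $\sigma\in L_2[0,1]$ ($W_2^0=L_2$). Singularity orders: $i_{2k+j}:=m-k-j$ for $k\ge 0$, $j\in\{0,1\}$ (so $i_{n-1}=0$ and there are no parameters $\tau_{n-1,i},c_{n-1,i}$ with $i<i_{n-1}$). Coefficient space: $\mathfrak T_n:=\{\mathcal T=(\tau_\nu)_{\nu=0}^{n-1}:\tau_\nu\in W_2^{-i_\nu}[0,1],\ \nu=0,\dots,n-1\}$. Differential expression with coefficients $\mathcal T$: $$\ell_n(y)=y^{(n)}+\sum_{k=0}^{m-1}(-1)^k(\tau_{2k}y^{(k)})^{(k)}+\sum_{k=0}^{m-1}(-1)^{k+1}\Bigl((\tau_{2k+1}y^{(k)})^{(k+1)}+(\tau_{2k+1}y^{(k+1)})^{(k)}\Bigr),$$ which is well defined in $\mathfrak D'$ for $y\in W_2^m[0,1]$; the product of $\tau=\sigma^{(i)}$, $\sigma\in L_2[0,1]$, and $g\in W_2^i[0,1]$ is $(\tau g,z)=(-1)^i\int_0^1\sigma\,(gz)^{(i)}\,dx$, $z\in\mathfrak D$. $\mathfrak F_n$ is the set of $n\times n$ matrix functions $F=[f_{k,j}]_{k,j=1}^n$ on $[0,1]$ such that for $k=m+1,\dots,n$ and $j=1,\dots,m$: $f_{k,j}\in L_1[0,1]$, $f_{m,j}\in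 L_2[0,1]$, $f_{k,m+1}\in L_2[0,1]$; and $f_{k,j}=0$ whenever $k<m$ or $j>m+1$ or $(k,j)=(m,m+1)$. For $F\in\mathfrak F_n$ the quasi-derivatives are $y^{[0]}:=y$, $y^{[k]}:=(y^{[k-1]})'-\sum_{j=1}^k f_{k,j}y^{[j-1]}$, $k=1,\dots,n$, and $\mathcal D_F:=\{y: y^{[k]}\in W_1^1[0,1],\ k=0,\dots,n-1\}\subset W_2^m[0,1]$. $F\in\mathfrak F_n$ is called associated with $\ell_n(y)$ if $\ell_n(y)=y^{[n]}$ for every $y\in\mathcal D_F$. $\mathfrak F(\mathcal T)\subset\mathfrak F_n$ is the set of all matrices associated with the expression $\ell_n$ having coefficients $\mathcal T$. Constant matrices $\chi_{\nu,i}=[\chi_{\nu,i;r,j}]_{r,j=0}^m$, $\nu=0,\dots,n-1$, $i=0,\dots,i_\nu$: $\chi_{2k,i;\,p+k,\,i-p+k}=\binom{i}{p}$ for $p=0,\dots,i$; $\chi_{2k+1,i;\,p+k,\,i+1-p+k}=\binom{i+1}{p}-2\binom{i}{p-1}$ for $p=0,\dots,i+1$ (with $\binom{i}{-1}:=0$); all other entries are zero. The map $F=\mathscr S_n(Q)$ for $Q=[q_{r,j}]_{r,j=0}^m$ (with $q_{m,m}=0$): $f_{m,j}:=(-1)^{m+1}q_{j-1,m}$ for $j=1,\dots,m$; $f_{k,m+1}:=(-1)^{k+1}q_{m,2m-k}$ for $k=m+1,\dots,2m$; $f_{k,j}:=(-1)^{k+1}q_{j-1,2m-k}+(-1)^{m+k}q_{j-1,m}q_{m,2m-k}$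 for $k=m+1,\dots,2m$, $j=1,\dots,m$; $f_{k,j}:=0$ if $k<m$ or $j>m+1$ or $(k,j)=(m,m+1)$. Notation $y^{(-i)}$: a fixed choice of antiderivative of order $i$ of the distribution $y$; for example, the choice $w=y^{(-i)}$ fixed by $\int_0^1x^kw(x)\,dx=0$, $k=0,\dots,i-1$. *)

theory Defs
  imports "HOL-Analysis.Analysis"
begin

definition nderiv :: "nat \<Rightarrow> (real \<Rightarrow> complex) \<Rightarrow> real \<Rightarrow> complex" where
  "nderiv k z = ((\<lambda>f x. vector_derivative f (at x)) ^^ k) z"

definition test_functions :: "(real \<Rightarrow> complex) set" where
  "test_functions = {z. (\<forall>k x. nderiv k z differentiable (at x)) \<and>
     compact (closure {x. z x \<noteq> 0}) \<and> closure {x. z x \<noteq> 0} \<subseteq> {0<..<1}}"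

text \<open>A distribution is a functional on the test functions.  It is represented by a function on all
  of \<open>real \<Rightarrow> complex\<close> that vanishes off the test functions, so that equality of distributions
  is HOL equality.\<close>

type_synonym functional = "(real \<Rightarrow> complex) \<Rightarrow> complex"

definition distributions :: "functional set" where
  "distributions = {T.
     (\<forall>z. z \<notin> test_functions \<longrightarrow> T z = 0) \<and>
     (\<forall>a b. \<forall>z\<in>test_functions. \<forall>w\<in>test_functions.
        T (\<lambda>x. a * z x + b * w x) = a * T z + b * T w) \<and>
     (\<forall>K. compact K \<and> K \<subseteq> {0<..<1} \<longrightarrow>
        (\<exists>C N. \<forall>z\<in>test_functions. {x. z x \<noteq> 0} \<subseteq> K \<longrightarrow>
           norm (T z) \<le> C * (\<Sum>k\<le>N. SUP x\<in>{0..1}. norm (nderiv k z x))))}"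

definition dist_deriv :: "functional \<Rightarrow> functional" where
  "dist_deriv T = (\<lambda>z. if z \<in> test_functions then - T (nderiv 1 z) else 0)"

abbreviation unit_measure :: "real measure" where
  "unit_measure \<equiv> lebesgue_on {0..1}"

definition Lp :: "nat \<Rightarrow> (real \<Rightarrow> complex) set" where
  "Lp p = {f \<in> borel_measurable unit_measure. integrable unit_measure (\<lambda>x. norm (f x) ^ p)}"

definition regular_dist :: "(real \<Rightarrow> complex) \<Rightarrow> functional" where
  "regular_dist f = (\<lambda>z. if z \<in> test_functions then \<integral>x. f x * z x \<partial>unit_measure else 0)"

text \<open>The function a regular distribution comes from; it is determined up to a null set, and all
  notions below respect equality almost everywhere on \<open>[0,1]\<close>.\<close>

definition dist_fun :: "functional \<Rightarrow> real \<Rightarrow> complex" where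
  "dist_fun T = (SOME f. f \<in> Lp 1 \<and> T = regular_dist f)"

definition weak_deriv :: "nat \<Rightarrow> (real \<Rightarrow> complex) \<Rightarrow> real \<Rightarrow> complex" where
  "weak_deriv i f = dist_fun ((dist_deriv ^^ i) (regular_dist f))"

text \<open>\<open>sobolev p k\<close> is \<open>W\<^sub>p\<^sup>k[0,1]\<close>, and \<open>neg_sobolev i\<close> is
  the space of \<open>i\<close>-th distributional derivatives of \<open>L\<^sub>2\<close> functions.\<close>

definition sobolev :: "nat \<Rightarrow> nat \<Rightarrow> (real \<Rightarrow> complex) set" where
  "sobolev p k = {f \<in> Lp p. \<forall>i\<le>k. \<exists>g\<in>Lp p. (dist_deriv ^^ i) (regular_dist f) = regular_dist g}"

definition neg_sobolev :: "nat \<Rightarrow> functional set" where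
  "neg_sobolev i = {(dist_deriv ^^ i) (regular_dist \<sigma>) |\<sigma>. \<sigma> \<in> Lp 2}"

text \<open>Product of \<open>T \<in> neg_sobolev i\<close> and \<open>g \<in> sobolev 2 i\<close>.  The function \<open>\<sigma>\<close> is determined
  up to a polynomial of degree less than \<open>i\<close>, which does not affect the value.\<close>

definition dist_prod :: "nat \<Rightarrow> functional \<Rightarrow> (real \<Rightarrow> complex) \<Rightarrow> functional" where
  "dist_prod i T g =
     (let \<sigma> = (SOME \<sigma>. \<sigma> \<in> Lp 2 \<and> T = (dist_deriv ^^ i) (regular_dist \<sigma>))
      in (\<lambda>z. if z \<in> test_functions
            then (-1) ^ i * (\<integral>x. \<sigma> x * weak_deriv i (\<lambda>t. g t * z t) x \<partial>unit_measure)
            else 0))"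

text \<open>A fixed but arbitrary choice \<open>A i T\<close> of an antiderivative of order \<open>i\<close> of each
  distribution \<open>T\<close>.\<close>

definition antiderivative_choice :: "(nat \<Rightarrow> functional \<Rightarrow> functional) \<Rightarrow> bool" where
  "antiderivative_choice A \<longleftrightarrow>
     (\<forall>i. \<forall>T\<in>distributions. A i T \<in> distributions \<and> (dist_deriv ^^ i) (A i T) = T)"

text \<open>For \<open>\<nu> = 2 * k + j < 2 * m\<close> with \<open>j \<le> 1\<close> the order is \<open>m - k - j\<close>.\<close>

definition sing_order :: "nat \<Rightarrow> nat \<Rightarrow> nat" where
  "sing_order m \<nu> = m - \<nu> div 2 - \<nu> mod 2"

definition coeff_space :: "nat \<Rightarrow> (nat \<Rightarrow> functional) set" where
  "coeff_space m = {\<T>. \<forall>\<nu><2 * m. \<T> \<nu> \<in> neg_sobolev (sing_order m \<nu>)}"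

definition diff_expr :: "nat \<Rightarrow> (nat \<Rightarrow> functional) \<Rightarrow> (real \<Rightarrow> complex) \<Rightarrow> functional" where
  "diff_expr m \<T> y = (\<lambda>z.
     (dist_deriv ^^ (2 * m)) (regular_dist y) z
     + (\<Sum>k<m. (-1) ^ k *
          (dist_deriv ^^ k)
            (dist_prod (sing_order m (2 * k)) (\<T> (2 * k)) (weak_deriv k y)) z)
     + (\<Sum>k<m. (-1) ^ (k + 1) *
          ((dist_deriv ^^ (k + 1))
             (dist_prod (sing_order m (2 * k + 1)) (\<T> (2 * k + 1)) (weak_deriv k y)) z
           + (dist_deriv ^^ k)
             (dist_prod (sing_order m (2 * k + 1)) (\<T> (2 * k + 1)) (weak_deriv (k + 1) y)) z)))"

text \<open>A matrix function is \<open>F :: nat \<Rightarrow> nat \<Rightarrow> real \<Rightarrow> complex\<close>; the entry \<open>f\<^sub>k\<^sub>,\<^sub>j\<close> is \<open>F k j\<close>, and only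
  the indices \<open>1 \<le> k, j \<le> 2 * m\<close> and the values on \<open>[0,1]\<close> up to null sets are relevant.\<close>

type_synonym matrix_fun = "nat \<Rightarrow> nat \<Rightarrow> real \<Rightarrow> complex"

definition matrix_ae_eq :: "nat \<Rightarrow> matrix_fun \<Rightarrow> matrix_fun \<Rightarrow> bool" where
  "matrix_ae_eq m F G \<longleftrightarrow>
     (\<forall>k\<in>{1..2 * m}. \<forall>j\<in>{1..2 * m}. AE x in unit_measure. F k j x = G k j x)"

definition matrix_class :: "nat \<Rightarrow> matrix_fun set" where
  "matrix_class m = {F.
     (\<forall>k\<in>{m + 1..2 * m}. \<forall>j\<in>{1..m}. F k j \<in> Lp 1 \<and> F m j \<in> Lp 2 \<and> F k (m + 1) \<in> Lp 2) \<and>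
     (\<forall>k\<in>{1..2 * m}. \<forall>j\<in>{1..2 * m}. k < m \<or> j > m + 1 \<or> (k, j) = (m, m + 1) \<longrightarrow>
        (AE x in unit_measure. F k j x = 0))}"

fun quasi_deriv :: "matrix_fun \<Rightarrow> (real \<Rightarrow> complex) \<Rightarrow> nat \<Rightarrow> real \<Rightarrow> complex" where
  "quasi_deriv F y 0 = y"
| "quasi_deriv F y (Suc k) =
     (\<lambda>x. weak_deriv 1 (quasi_deriv F y k) x
        - (\<Sum>j=1..Suc k. F (Suc k) j x * quasi_deriv F y (j - 1) x))"

definition quasi_domain :: "nat \<Rightarrow> matrix_fun \<Rightarrow> (real \<Rightarrow> complex) set" where
  "quasi_domain m F = {y. \<forall>k<2 * m. quasi_deriv F y k \<in> sobolev 1 1}"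

definition associated_matrices :: "nat \<Rightarrow> (nat \<Rightarrow> functional) \<Rightarrow> matrix_fun set" where
  "associated_matrices m \<T> = {F \<in> matrix_class m.
     \<forall>y\<in>quasi_domain m F. diff_expr m \<T> y = regular_dist (quasi_deriv F y (2 * m))}"

definition chi :: "nat \<Rightarrow> nat \<Rightarrow> nat \<Rightarrow> nat \<Rightarrow> complex" where
  "chi \<nu> i r j = (let k = \<nu> div 2; p = r - k in
     if even \<nu>
     then (if k \<le> r \<and> p \<le> i \<and> j = i - p + k then of_nat (i choose p) else 0)
     else (if k \<le> r \<and> p \<le> i + 1 \<and> j = i + 1 - p + k
           then of_nat ((i + 1) choose p) - 2 * (if p = 0 then 0 else of_nat (i choose (p - 1)))
           else 0))"

definition S_map :: "nat \<Rightarrow> (nat \<Rightarrow> nat \<Rightarrow> real \<Rightarrow> complex) \<Rightarrow> matrix_fun" where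
  "S_map m Q k j = (\<lambda>x.
     if k = m \<and> j \<in> {1..m} then (-1) ^ (m + 1) * Q (j - 1) m x
     else if k \<in> {m + 1..2 * m} \<and> j = m + 1 then (-1) ^ (k + 1) * Q m (2 * m - k) x
     else if k \<in> {m + 1..2 * m} \<and> j \<in> {1..m} then
       (-1) ^ (k + 1) * Q (j - 1) (2 * m - k) x + (-1) ^ (m + k) * Q (j - 1) m x * Q m (2 * m - k) x
     else 0)"

text \<open>The distribution \<open>\<tau>\<^sub>\<nu>\<^sub>,\<^sub>i\<close> of top index \<open>i = i\<^sub>\<nu>\<close>, built from \<open>\<tau> = \<tau>\<^sub>\<nu>\<close>, the functions
  \<open>t j = \<tau>\<^sub>\<nu>\<^sub>,\<^sub>j\<close> and the constants \<open>c j = c\<^sub>\<nu>\<^sub>,\<^sub>j\<close>, \<open>j < i\<close>.\<close>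

definition top_coeff ::
  "(nat \<Rightarrow> functional \<Rightarrow> functional) \<Rightarrow> nat \<Rightarrow> functional \<Rightarrow>
   (nat \<Rightarrow> real \<Rightarrow> complex) \<Rightarrow> (nat \<Rightarrow> complex) \<Rightarrow> functional" where
  "top_coeff A i \<tau> t c = (\<lambda>z.
     (-1) ^ i * A i (\<lambda>w. \<tau> w - (\<Sum>j<i. (-1) ^ j * (dist_deriv ^^ j) (regular_dist (t j)) w)) z
     + regular_dist (\<lambda>x. \<Sum>j<i. c j * complex_of_real x ^ j) z)"

definition Q_matrix ::
  "(nat \<Rightarrow> functional \<Rightarrow> functional) \<Rightarrow> nat \<Rightarrow> (nat \<Rightarrow> functional) \<Rightarrow>
   (nat \<Rightarrow> nat \<Rightarrow> real \<Rightarrow> complex) \<Rightarrow> (nat \<Rightarrow> nat \<Rightarrow> complex) \<Rightarrow>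
   nat \<Rightarrow> nat \<Rightarrow> real \<Rightarrow> complex" where
  "Q_matrix A m \<T> t c r j = (\<lambda>x. \<Sum>\<nu><2 * m. \<Sum>i\<le>sing_order m \<nu>.
     (if i < sing_order m \<nu> then t \<nu> i x
      else dist_fun (top_coeff A (sing_order m \<nu>) (\<T> \<nu>) (t \<nu>) (c \<nu>)) x) * chi \<nu> i r j)"

definition F_map ::
  "(nat \<Rightarrow> functional \<Rightarrow> functional) \<Rightarrow> nat \<Rightarrow> (nat \<Rightarrow> functional) \<Rightarrow>
   (nat \<Rightarrow> nat \<Rightarrow> real \<Rightarrow> complex) \<Rightarrow> (nat \<Rightarrow> nat \<Rightarrow> complex) \<Rightarrow> matrix_fun" where
  "F_map A m \<T> t c = S_map m (Q_matrix A m \<T> t c)"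

end

theory Submission
  imports Defs
begin

text \<open>Integration by parts turns \<open>y\<^sup>[\<^sup>n\<^sup>]\<close> for \<open>F = S_map m Q\<close> into the bilinear expression
  \<open>(-1)\<^sup>m \<integral> y\<^sup>(\<^sup>m\<^sup>) z\<^sup>(\<^sup>m\<^sup>) + \<Sum> \<integral> q\<^sub>r\<^sub>j y\<^sup>(\<^sup>r\<^sup>) z\<^sup>(\<^sup>j\<^sup>)\<close>, and \<open>\<ell>\<^sub>n(y)\<close> into the same expression with \<open>Q\<close> replaced by
  \<open>\<Sum>\<^sub>\<nu> (-1)\<^sup>i \<sigma>\<^sub>\<nu> \<chi>\<^sub>\<nu>\<^sub>,\<^sub>i\<close>, where \<open>\<tau>\<^sub>\<nu> = \<sigma>\<^sub>\<nu>\<^sup>(\<^sup>i\<^sup>)\<close> and \<open>i = i\<^sub>\<nu>\<close>.  The \<open>\<chi>\<^sub>\<nu>\<^sub>,\<^sub>i\<close> form a basis of the matrices with last entry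
  zero, and the form of \<open>\<Sum>\<^sub>i \<tau>\<^sub>\<nu>\<^sub>,\<^sub>i \<chi>\<^sub>\<nu>\<^sub>,\<^sub>i\<close> is the distribution \<open>\<Sum>\<^sub>i (-1)\<^sup>i \<tau>\<^sub>\<nu>\<^sub>,\<^sub>i\<^sup>(\<^sup>i\<^sup>)\<close> applied to
  \<open>y\<^sup>(\<^sup>k\<^sup>) z\<^sup>(\<^sup>k\<^sup>)\<close> (for \<open>\<nu> = 2k\<close>) or \<open>y\<^sup>(\<^sup>k\<^sup>) z\<^sup>(\<^sup>k\<^sup>+\<^sup>1\<^sup>) - y\<^sup>(\<^sup>k\<^sup>+\<^sup>1\<^sup>) z\<^sup>(\<^sup>k\<^sup>)\<close> (for \<open>\<nu> = 2k + 1\<close>).  So \<open>F\<close> is associated as soon as these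
  distributions equal \<open>\<tau>\<^sub>\<nu>\<close>.  Conversely, if the difference of the two forms vanishes for all \<open>y\<close> in the
  domain of \<open>F\<close>, then the adjoint of the first order system of \<open>F\<close> shows that it vanishes for all smooth \<open>y\<close>;
  testing with \<open>exp (a x)\<close> and \<open>exp (- a x) f\<close> gives a polynomial in \<open>a\<close> whose coefficients force the
  distributions to agree.\<close>

subsection \<open>Absolutely continuous functions\<close>

text \<open>The obstacle is the domain of F: its entries are merely integrable, so the domain need
  not contain the smooth functions, and association cannot be exploited by inserting smooth y. What
  helps is that a functional annihilating the domain is, through the adjoint system, the integral of
  a total derivative with zero boundary values in which F no longer occurs. In the other direction
  y^(k) z^(k) is not smooth, so an identity known for test functions must first be extended to
  chains of absolutely continuous functions. As \<open>weak_deriv\<close> is a choice up to null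
  sets, all calculus is done on fixed representatives with explicit densities. That every F is
  reached rests on two inversions. The quadratic term of \<open>S_map\<close> involves only the
  border of Q, so Q can be recovered from F; and the corner entries of the matrices
  \<open>chi\<close> allow the coefficients to be read off. The constants c absorb the polynomial
  ambiguity of antiderivatives.\<close>

abbreviation L1 :: "(real \<Rightarrow> complex) \<Rightarrow> bool" where
  "L1 f \<equiv> integrable unit_measure f"

text \<open>Rests on the completeness of Lebesgue measure. It lets almost everywhere identities
  transport measurability, and with it membership in L1 and L2.\<close>

lemma AE_unit_measure_cong_measurable:
  fixes f g :: "real \<Rightarrow> complex"
  assumes "f \<in> borel_measurable unit_measure" "AE x in unit_measure. f x = g x"
  shows "g \<in> borel_measurable unit_measure"
proof -
  let ?r = "\<lambda>f x. if x \<in> {0..1::real} then f x else (0::complex)"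
  have "?r f \<in> borel_measurable lebesgue"
    using assms(1) by (subst borel_measurable_if) auto
  moreover have "AE x in lebesgue. ?r f x = ?r g x"
    using assms(2) by (subst (asm) AE_restrict_space_iff) auto
  ultimately have "?r g \<in> borel_measurable lebesgue"
    by (rule borel_measurable_AE)
  then show ?thesis
    by (subst (asm) borel_measurable_if) auto
qed

lemma L1_AE_cong:
  assumes "L1 f" "AE x in unit_measure. f x = g x"
  shows "L1 g"
  using assms AE_unit_measure_cong_measurable[of f g]
  by (subst integrable_cong_AE[of g _ f]) (auto elim: eventually_mono)

lemma finite_measure_unit_measure: "finite_measure unit_measure"
  by (rule finite_measure_lebesgue_on) auto

lemma sigma_finite_unit_measure: "sigma_finite_measure unit_measure"
  using finite_measure_unit_measure by (simp add: finite_measure_def)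

lemma L1_const [simp, intro]: "L1 (\<lambda>x. c)"
  using finite_measure.integrable_const[OF finite_measure_unit_measure] .

lemma continuous_imp_measurable_unit:
  fixes f :: "real \<Rightarrow> complex"
  shows "continuous_on {0..1} f \<Longrightarrow> f \<in> borel_measurable unit_measure"
  by (rule continuous_imp_measurable_on_sets_lebesgue) auto

lemma bounded_mult_L1:
  assumes "h \<in> borel_measurable unit_measure" "L1 g" "AE x in unit_measure. norm (h x) \<le> B"
  shows "L1 (\<lambda>x. h x * g x)"
proof (rule Bochner_Integration.integrable_bound)
  show "integrable unit_measure (\<lambda>x. B * norm (g x))"
    using assms by auto
  show "(\<lambda>x. h x * g x) \<in> borel_measurable unit_measure"
    using assms by auto
  show "AE x in unit_measure. norm (h x * g x) \<le> norm (B * norm (g x))"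
    using assms(3)
  proof eventually_elim
    case (elim x)
    then have "norm (h x) * norm (g x) \<le> B * norm (g x)"
      by (intro mult_right_mono) auto
    then show ?case
      using abs_ge_self[of "B * norm (g x)"] by (auto simp: norm_mult intro: order_trans)
  qed
qed

lemma continuous_unit_bounded:
  fixes h :: "real \<Rightarrow> complex"
  assumes "continuous_on {0..1} h"
  obtains B where "B > 0" "\<And>x. x \<in> {0..1} \<Longrightarrow> norm (h x) \<le> B"
  using compact_imp_bounded[OF compact_continuous_image[OF assms]] bounded_pos[of "h ` {0..1}"]
  by auto

lemma continuous_mult_L1:
  assumes "continuous_on {0..1} h" "L1 g"
  shows "L1 (\<lambda>x. h x * g x)"
proof -
  obtain B where "\<And>x. x \<in> {0..1} \<Longrightarrow> norm (h x) \<le> B"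
    using continuous_unit_bounded[OF assms(1)] by blast
  then show ?thesis
    using assms by (intro bounded_mult_L1[where B = B]) (auto intro: continuous_imp_measurable_unit)
qed

lemma L1_mult_continuous:
  assumes "L1 g" "continuous_on {0..1} h"
  shows "L1 (\<lambda>x. g x * h x)"
  using continuous_mult_L1[OF assms(2,1)] by (simp add: mult.commute)

lemma continuous_imp_L1: "continuous_on {0..1} f \<Longrightarrow> L1 f"
  using continuous_mult_L1[of f "\<lambda>x. 1"] by simp

text \<open>The upper limit is an indicator inside the integrand, so that the measure stays fixed:
  linearity, dominated convergence and Fubini then apply without changing the measure space.\<close>

definition prim :: "(real \<Rightarrow> complex) \<Rightarrow> real \<Rightarrow> complex" where
  "prim g x = (\<integral>t. indicator {..x} t * g t \<partial>unit_measure)"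

lemma indicator_measurable_unit [measurable]:
  "(indicator {..x} :: real \<Rightarrow> complex) \<in> borel_measurable unit_measure"
  "(indicator {..<x} :: real \<Rightarrow> complex) \<in> borel_measurable unit_measure"
  by (rule measurable_restrict_space1, rule borel_measurable_indicator, simp)+

lemma indicator_mult_L1:
  assumes "L1 g"
  shows "L1 (\<lambda>t. indicator {..x} t * g t)" "L1 (\<lambda>t. indicator {..<x} t * g t)"
  using assms
  by (auto intro!: bounded_mult_L1[where B = 1] indicator_measurable_unit AE_I2 split: split_indicator)

lemma prim_eq_integral:
  assumes "x \<in> {0..1}"
  shows "prim g x = integral\<^sup>L (lebesgue_on {0..x}) g"
proof -
  have "prim g x = (\<integral>t. indicator {0..1} t *\<^sub>R (indicator {..x} t * g t) \<partial>lebesgue)"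
    unfolding prim_def by (subst integral_restrict_space) auto
  also have "\<dots> = (\<integral>t. indicator {0..x} t *\<^sub>R g t \<partial>lebesgue)"
    using assms by (intro Bochner_Integration.integral_cong) (auto simp: indicator_def)
  also have "\<dots> = integral\<^sup>L (lebesgue_on {0..x}) g"
    by (subst integral_restrict_space) auto
  finally show ?thesis .
qed

lemma prim_eq_HK_integral:
  assumes "L1 g" "x \<in> {0..1}"
  shows "prim g x = integral {0..x} g"
proof -
  have "integrable (lebesgue_on {0..x}) g"
    by (rule integrable_subinterval[OF assms(1)]) (use assms(2) in auto)
  then have "integral\<^sup>L (lebesgue_on {0..x}) g = integral {0..x} g"
    by (rule lebesgue_integral_eq_integral) auto
  then show ?thesis
    unfolding prim_eq_integral[OF assms(2)] .
qed

lemma prim_0 [simp]: "prim g 0 = 0"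
  by (subst prim_eq_integral) (auto intro!: integral_eq_zero_null_sets)

lemma prim_1: "prim g 1 = integral\<^sup>L unit_measure g"
  by (subst prim_eq_integral) auto

lemma continuous_prim:
  assumes "L1 g"
  shows "continuous_on {0..1} (prim g)"
  using indefinite_integral_continuous_real[OF assms]
  by (rule continuous_on_eq) (simp add: prim_eq_integral)

lemma prim_add: "L1 f \<Longrightarrow> L1 g \<Longrightarrow> prim (\<lambda>x. f x + g x) x = prim f x + prim g x"
  unfolding prim_def
  by (subst Bochner_Integration.integral_add[symmetric]) (auto simp: indicator_mult_L1 distrib_left)

lemma prim_cmult: "prim (\<lambda>x. c * f x) x = c * prim f x"
  unfolding prim_def by (subst integral_mult_right_zero[symmetric]) (simp add: algebra_simps)

lemma prim_cong_AE:
  assumes "L1 f" "AE x in unit_measure. f x = g x"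
  shows "prim f x = prim g x"
  unfolding prim_def using assms L1_AE_cong[OF assms]
  by (intro integral_cong_AE) (auto elim: eventually_mono)

lemma AE_unit_neq: "AE t in unit_measure. t \<noteq> (s::real)"
proof -
  have "AE t in lebesgue. t \<noteq> s"
    by (rule AE_I'[of "{s}"]) auto
  then show ?thesis by (subst AE_restrict_space_iff) (auto elim: eventually_mono)
qed

text \<open>The two halves of the square cut along its diagonal are s \<ge> t and s < t; the strict
  half produces half-open indicators.\<close>

lemma prim_open:
  assumes "L1 f"
  shows "(\<integral>t. indicator {..<s} t * f t \<partial>unit_measure) = prim f s"
  unfolding prim_def
proof (intro integral_cong_AE)
  show "AE t in unit_measure. indicator {..<s} t * f t = indicator {..s} t * f t"
    using AE_unit_neq[of s] by eventually_elim (auto simp: indicator_def)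
qed (use indicator_mult_L1(1,2)[OF assms] in auto)

text \<open>The product rule for primitives is Fubini's theorem on the square, cut along the diagonal.\<close>

lemma prim_mult_full:
  assumes f: "L1 f" and g: "L1 g"
  shows "(\<integral>s. f s \<partial>unit_measure) * (\<integral>t. g t \<partial>unit_measure) =
     (\<integral>x. f x * prim g x \<partial>unit_measure) + (\<integral>x. prim f x * g x \<partial>unit_measure)"
proof -
  interpret M: sigma_finite_measure unit_measure by (rule sigma_finite_unit_measure)
  interpret pair_sigma_finite unit_measure unit_measure ..
  have [measurable]: "f \<in> borel_measurable unit_measure" "g \<in> borel_measurable unit_measure"
    using f g by auto
  let ?F = "\<lambda>p. f (fst p) * g (snd p)"
  have F: "integrable (unit_measure \<Otimes>\<^sub>M unit_measure) ?F"
  proof (rule Fubini_integrable)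
    have "(\<lambda>x. LINT y|unit_measure. norm (f (fst (x, y)) * g (snd (x, y)))) =
       (\<lambda>x. norm (f x) * (LINT y|unit_measure. norm (g y)))"
      by (simp add: norm_mult)
    then show "integrable unit_measure (\<lambda>x. LINT y|unit_measure. norm (f (fst (x, y)) * g (snd (x, y))))"
      using f by simp
  qed (use f g in auto)
  have id: "(\<lambda>x. x) \<in> borel_measurable unit_measure"
    using id_borel_measurable_lebesgue_on[of "{0..1::real}"] by (simp add: id_def)
  have le: "{p \<in> space (unit_measure \<Otimes>\<^sub>M unit_measure). snd p \<le> fst p} \<in> sets (unit_measure \<Otimes>\<^sub>M unit_measure)"
    by (rule borel_measurable_le)
      (use measurable_compose[OF measurable_fst id] measurable_compose[OF measurable_snd id] in auto)
  have lt: "{p \<in> space (unit_measure \<Otimes>\<^sub>M unit_measure). fst p < snd p} \<in> sets (unit_measure \<Otimes>\<^sub>M unit_measure)"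
    by (rule borel_measurable_less)
      (use measurable_compose[OF measurable_fst id] measurable_compose[OF measurable_snd id] in auto)
  let ?A = "\<lambda>p. indicator {p \<in> space (unit_measure \<Otimes>\<^sub>M unit_measure). snd p \<le> fst p} p *\<^sub>R ?F p"
  let ?B = "\<lambda>p. indicator {p \<in> space (unit_measure \<Otimes>\<^sub>M unit_measure). fst p < snd p} p *\<^sub>R ?F p"
  have A: "integrable (unit_measure \<Otimes>\<^sub>M unit_measure) ?A"
    using integrable_mult_indicator[OF le F] .
  have B: "integrable (unit_measure \<Otimes>\<^sub>M unit_measure) ?B"
    using integrable_mult_indicator[OF lt F] .
  have "(\<integral>s. f s \<partial>unit_measure) * (\<integral>t. g t \<partial>unit_measure) =
     (\<integral>s. \<integral>t. ?F (s, t) \<partial>unit_measure \<partial>unit_measure)"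
    by simp
  also have "\<dots> = (\<integral>p. ?F p \<partial>(unit_measure \<Otimes>\<^sub>M unit_measure))"
    using integral_fst'[OF F] by simp
  also have "\<dots> = (\<integral>p. ?A p + ?B p \<partial>(unit_measure \<Otimes>\<^sub>M unit_measure))"
    by (intro Bochner_Integration.integral_cong) (auto simp: indicator_def)
  also have "\<dots> = (\<integral>p. ?A p \<partial>(unit_measure \<Otimes>\<^sub>M unit_measure)) + (\<integral>p. ?B p \<partial>(unit_measure \<Otimes>\<^sub>M unit_measure))"
    using A B by (rule Bochner_Integration.integral_add)
  also have "(\<integral>p. ?A p \<partial>(unit_measure \<Otimes>\<^sub>M unit_measure)) =
     (\<integral>s. \<integral>t. ?A (s, t) \<partial>unit_measure \<partial>unit_measure)"
    using integral_fst'[OF A] by simp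
  also have "\<dots> = (\<integral>s. f s * prim g s \<partial>unit_measure)"
    unfolding prim_def
    by (intro Bochner_Integration.integral_cong refl)
      (auto simp: space_pair_measure indicator_def algebra_simps
        simp flip: integral_mult_right_zero intro!: Bochner_Integration.integral_cong)
  also have "(\<integral>p. ?B p \<partial>(unit_measure \<Otimes>\<^sub>M unit_measure)) =
     (\<integral>t. \<integral>s. ?B (s, t) \<partial>unit_measure \<partial>unit_measure)"
    using integral_snd[of "\<lambda>s t. ?B (s, t)"] B by (simp only: case_prod_beta' prod.collapse)
  also have "\<dots> = (\<integral>t. (\<integral>s. indicator {..<t} s * f s \<partial>unit_measure) * g t \<partial>unit_measure)"
    by (intro Bochner_Integration.integral_cong refl)
      (auto simp: space_pair_measure simp flip: integral_mult_left_zero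
        intro!: Bochner_Integration.integral_cong split: split_indicator)
  also have "\<dots> = (\<integral>t. prim f t * g t \<partial>unit_measure)"
    by (simp add: prim_open[OF f])
  finally show ?thesis .
qed

text \<open>The identity on the full square, applied to both functions cut off at x. To the left of
  x the cut does not change their primitives.\<close>

lemma prim_mult:
  assumes f: "L1 f" and g: "L1 g"
  shows "prim f x * prim g x = prim (\<lambda>x. f x * prim g x) x + prim (\<lambda>x. prim f x * g x) x"
proof -
  have cut: "prim (\<lambda>s. indicator {..x} s * h s) t = prim h t" if "t \<le> x" for h t
    unfolding prim_def using that by (intro Bochner_Integration.integral_cong) (auto simp: indicator_def)
  have "(\<integral>t. (indicator {..x} t * f t) * prim (\<lambda>t. indicator {..x} t * g t) t \<partial>unit_measure)
     = (\<integral>t. indicator {..x} t * (f t * prim g t) \<partial>unit_measure)"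
    by (intro Bochner_Integration.integral_cong refl) (auto split: split_indicator simp: cut)
  moreover have "(\<integral>t. prim (\<lambda>t. indicator {..x} t * f t) t * (indicator {..x} t * g t) \<partial>unit_measure)
     = (\<integral>t. indicator {..x} t * (prim f t * g t) \<partial>unit_measure)"
    by (intro Bochner_Integration.integral_cong refl) (auto split: split_indicator simp: cut)
  ultimately show ?thesis
    using prim_mult_full[OF indicator_mult_L1(1)[OF f, of x] indicator_mult_L1(1)[OF g, of x]]
    by (simp add: prim_def[of f x] prim_def[of g x] prim_def[of "\<lambda>t. f t * prim g t"] prim_def[of "\<lambda>t. prim f t * g t"])
qed

text \<open>Absolute continuity on [0,1] with the density g carried along. The identity for f is
  pointwise, while g matters only up to null sets, so no derivative of f ever has to be
  taken.\<close>

definition ac_deriv :: "(real \<Rightarrow> complex) \<Rightarrow> (real \<Rightarrow> complex) \<Rightarrow> bool" where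
  "ac_deriv f g \<longleftrightarrow> L1 g \<and> (\<forall>x\<in>{0..1}. f x - f 0 = prim g x)"

lemma ac_deriv_L1: "ac_deriv f g \<Longrightarrow> L1 g"
  by (simp add: ac_deriv_def)

lemma ac_derivD: "ac_deriv f g \<Longrightarrow> x \<in> {0..1} \<Longrightarrow> f x = f 0 + prim g x"
  unfolding ac_deriv_def by (metis add.commute diff_add_cancel)

lemma ac_derivI: "L1 g \<Longrightarrow> (\<And>x. x \<in> {0..1} \<Longrightarrow> f x = f 0 + prim g x) \<Longrightarrow> ac_deriv f g"
  unfolding ac_deriv_def by (metis add_diff_cancel_left')

lemma ac_deriv_continuous:
  assumes "ac_deriv f g"
  shows "continuous_on {0..1} f"
proof -
  have "continuous_on {0..1} (\<lambda>x. f 0 + prim g x)"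
    using assms by (intro continuous_on_add continuous_on_const continuous_prim) (simp add: ac_deriv_def)
  then show ?thesis
    by (rule continuous_on_eq) (metis ac_derivD[OF assms])
qed

lemma ac_deriv_imp_L1: "ac_deriv f g \<Longrightarrow> L1 f"
  by (intro continuous_imp_L1 ac_deriv_continuous)

lemma ac_deriv_prim: "L1 g \<Longrightarrow> ac_deriv (\<lambda>x. c + prim g x) g"
  by (simp add: ac_deriv_def)

lemma ac_deriv_const: "ac_deriv (\<lambda>x. c) (\<lambda>x. 0)"
  by (simp add: ac_deriv_def prim_def)

lemma ac_deriv_add:
  assumes "ac_deriv f f'" "ac_deriv g g'"
  shows "ac_deriv (\<lambda>x. f x + g x) (\<lambda>x. f' x + g' x)"
proof (rule ac_derivI)
  fix x :: real assume "x \<in> {0..1}"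
  then show "f x + g x = f 0 + g 0 + prim (\<lambda>x. f' x + g' x) x"
    by (subst prim_add) (use assms ac_deriv_L1 in \<open>simp_all add: ac_derivD[OF assms(1), of x] ac_derivD[OF assms(2), of x]\<close>)
qed (use assms ac_deriv_L1 in auto)

lemma ac_deriv_cmult:
  assumes "ac_deriv f f'"
  shows "ac_deriv (\<lambda>x. c * f x) (\<lambda>x. c * f' x)"
proof (rule ac_derivI)
  fix x :: real assume "x \<in> {0..1}"
  then show "c * f x = c * f 0 + prim (\<lambda>x. c * f' x) x"
    by (simp add: prim_cmult ac_derivD[OF assms, of x] distrib_left)
qed (use assms ac_deriv_L1 in auto)

lemma ac_deriv_diff:
  "ac_deriv f f' \<Longrightarrow> ac_deriv g g' \<Longrightarrow> ac_deriv (\<lambda>x. f x - g x) (\<lambda>x. f' x - g' x)"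
  using ac_deriv_add[of f f' "\<lambda>x. - 1 * g x" "\<lambda>x. - 1 * g' x"] ac_deriv_cmult[of g g' "- 1"]
  by simp

lemma ac_deriv_sum:
  assumes "\<And>i. i \<in> I \<Longrightarrow> ac_deriv (f i) (f' i)"
  shows "ac_deriv (\<lambda>x. \<Sum>i\<in>I. f i x) (\<lambda>x. \<Sum>i\<in>I. f' i x)"
  using assms
  by (induction I rule: infinite_finite_induct) (auto simp: ac_deriv_const intro!: ac_deriv_add)

lemma ac_deriv_cong_AE:
  assumes "ac_deriv f g" "AE x in unit_measure. g x = h x"
  shows "ac_deriv f h"
  using assms unfolding ac_deriv_def by (metis L1_AE_cong prim_cong_AE)

text \<open>Writing both functions as initial value plus primitive reduces the product rule to
  \<open>prim_mult\<close>.\<close>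

lemma ac_deriv_mult:
  assumes "ac_deriv f f'" "ac_deriv g g'"
  shows "ac_deriv (\<lambda>x. f x * g x) (\<lambda>x. f' x * g x + f x * g' x)"
proof -
  have c: "continuous_on {0..1} f" "continuous_on {0..1} g" and i: "L1 f'" "L1 g'"
    using assms ac_deriv_continuous ac_deriv_L1 by auto
  note [simp] = c i
  note f = ac_derivD[OF assms(1)] and g = ac_derivD[OF assms(2)]
  have L: "L1 (\<lambda>x. f' x * g x)" "L1 (\<lambda>x. f x * g' x)"
    by (auto intro: continuous_mult_L1 L1_mult_continuous)
  have p: "L1 (\<lambda>x. f' x * prim g' x)" "L1 (\<lambda>x. prim f' x * g' x)"
    by (rule L1_mult_continuous continuous_mult_L1 i continuous_prim)+
  have "f x * g x - f 0 * g 0 = prim (\<lambda>x. f' x * g x + f x * g' x) x" if x: "x \<in> {0..1}" for x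
  proof -
    have "prim (\<lambda>x. f' x * g x + f x * g' x) x =
        prim (\<lambda>x. (g 0 * f' x + f' x * prim g' x) + (f 0 * g' x + prim f' x * g' x)) x"
      unfolding prim_def[of "\<lambda>x. f' x * g x + f x * g' x"] prim_def[of "\<lambda>x. (g 0 * f' x + f' x * prim g' x) + (f 0 * g' x + prim f' x * g' x)"]
    proof (intro Bochner_Integration.integral_cong refl)
      fix t assume "t \<in> space unit_measure"
      then have t: "t \<in> {0..1}" by simp
      show "indicator {..x} t * (f' t * g t + f t * g' t) =
         indicator {..x} t * (g 0 * f' t + f' t * prim g' t + (f 0 * g' t + prim f' t * g' t))"
        by (subst f[OF t], subst g[OF t]) (simp add: algebra_simps)
    qed
    also have "\<dots> = g 0 * prim f' x + f 0 * prim g' x + prim f' x * prim g' x"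
      using p by (simp add: prim_add prim_cmult prim_mult)
    finally show ?thesis
      by (subst f[OF x], subst g[OF x]) (simp add: algebra_simps)
  qed
  then show ?thesis
    using L unfolding ac_deriv_def by auto
qed

lemma ac_deriv_integral: "ac_deriv f g \<Longrightarrow> integral\<^sup>L unit_measure g = f 1 - f 0"
  unfolding ac_deriv_def prim_1[symmetric] by simp

lemma ac_deriv_by_parts:
  assumes "ac_deriv f f'" "ac_deriv g g'"
  shows "(\<integral>x. f' x * g x \<partial>unit_measure) + (\<integral>x. f x * g' x \<partial>unit_measure) = f 1 * g 1 - f 0 * g 0"
proof -
  have "L1 (\<lambda>x. f' x * g x)" "L1 (\<lambda>x. f x * g' x)"
    by (rule L1_mult_continuous continuous_mult_L1 ac_deriv_L1[OF assms(1)] ac_deriv_L1[OF assms(2)]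
        ac_deriv_continuous[OF assms(1)] ac_deriv_continuous[OF assms(2)])+
  then show ?thesis
    using ac_deriv_integral[OF ac_deriv_mult[OF assms]] by simp
qed

lemma C1_imp_ac_deriv:
  assumes "\<And>x. x \<in> {0..1} \<Longrightarrow> (f has_vector_derivative g x) (at x within {0..1})"
    and "continuous_on {0..1} g"
  shows "ac_deriv f g"
proof -
  have L: "L1 g"
    using assms(2) by (rule continuous_imp_L1)
  have "f x - f 0 = prim g x" if x: "x \<in> {0..1}" for x
  proof -
    have "(g has_integral (f x - f 0)) {0..x}"
    proof (rule fundamental_theorem_of_calculus)
      fix t assume "t \<in> {0..x}"
      then show "(f has_vector_derivative g t) (at t within {0..x})"
        using x by (intro has_vector_derivative_within_subset[OF assms(1)]) auto
    qed (use x in auto)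
    then show ?thesis
      unfolding prim_eq_HK_integral[OF L x] by (rule integral_unique[symmetric])
  qed
  with L show ?thesis unfolding ac_deriv_def by auto
qed

text \<open>Lebesgue's differentiation theorem: at almost every x < 1 the value g x is the limit of
  right difference quotients of the primitive, and these are all zero.\<close>

lemma prim_eq_0_imp_AE:
  assumes "L1 g" "\<And>x. x \<in> {0<..<1} \<Longrightarrow> prim g x = 0"
  shows "AE x in unit_measure. g x = 0"
proof -
  define G where "G = (\<lambda>x. if x \<in> {0..1} then g x else 0)"
  have int_sub: "integrable (lebesgue_on {a..b}) g" if "0 \<le> a" "b \<le> 1" for a b
    using assms(1) that by (cases "a \<le> b") (auto intro: integrable_subinterval[of 0 1])
  have P0: "prim g x = 0" if "x \<in> {0..<1}" for x
    using assms(2)[of x] that by (cases "x = 0") auto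
  have "g integrable_on {0..1}"
    using integrable_on_lebesgue_on[OF assms(1)] by auto
  then have Gi: "G integrable_on UNIV"
    unfolding G_def integrable_restrict_UNIV .
  have "G integrable_on cbox a b" for a b
    using integrable_on_subcbox[OF Gi, of a b] by auto
  then obtain N where N: "negligible N" "\<And>x e. \<lbrakk>x \<notin> N; 0 < e\<rbrakk> \<Longrightarrow>
       \<exists>d>0. \<forall>h. 0 < h \<and> h < d \<longrightarrow>
             norm(integral (cbox x (x + h *\<^sub>R One)) G /\<^sub>R h ^ DIM(real) - G x) < e"
    using integrable_ccontinuous_explicit[of G] by metis
  have z: "g x = 0" if x: "x \<in> {0..<1}" "x \<notin> N" for x
  proof (rule ccontr)
    assume "g x \<noteq> 0"
    then obtain d where d: "d > 0" "\<And>h. 0 < h \<Longrightarrow> h < d \<Longrightarrow>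
        norm(integral {x..x + h} G /\<^sub>R h - G x) < norm (g x)"
      using N(2)[OF x(2), of "norm (g x)"] by auto
    \<comment> \<open>Halving the second bound keeps x + h strictly below 1, where the primitive is
      known to vanish.\<close>
    define h where "h = min (d / 2) ((1 - x) / 2)"
    have h: "0 < h" "h < d" "x + h < 1"
      using d(1) x by (auto simp: h_def min_def field_simps)
    have "integral {x..x + h} G = integral {x..x + h} g"
      using h x by (intro integral_cong) (auto simp: G_def)
    also have "\<dots> = integral\<^sup>L (lebesgue_on {x..x + h}) g"
      using h x by (subst lebesgue_integral_eq_integral) (auto intro!: int_sub)
    also have "\<dots> = prim g (x + h) - prim g x"
      using h x integral_combine[of 0 "x + h" g x] int_sub[of 0 "x + h"]
      by (simp add: prim_eq_integral)
    also have "\<dots> = 0"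
      using h x by (simp add: P0)
    finally show False
      using d(2)[OF h(1,2)] x by (simp add: G_def)
  qed
  have "AE x in lebesgue. x \<notin> N \<and> x \<noteq> 1"
    using N(1) by (intro AE_I'[of "N \<union> {1}"]) (auto simp: negligible_iff_null_sets intro!: null_sets.Un)
  then have "AE x in lebesgue. x \<in> {0..1} \<longrightarrow> g x = 0"
    by eventually_elim (use z in force)
  then show ?thesis
    by (subst AE_restrict_space_iff) auto
qed

text \<open>Differentiating the vanishing indefinite integral within [0,1] recovers the value at
  every point, endpoints included.\<close>

lemma continuous_AE_0_imp_0:
  fixes f :: "real \<Rightarrow> complex"
  assumes "continuous_on {0..1} f" "AE x in unit_measure. f x = 0" "x \<in> {0..1}"
  shows "f x = 0"
proof -
  have "L1 f" using continuous_imp_L1[OF assms(1)] .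
  have F: "ac_deriv (prim f) f"
    using ac_deriv_prim[OF \<open>L1 f\<close>, of 0] by simp
  have p0: "prim f t = 0" for t
    using prim_cong_AE[OF \<open>L1 f\<close> assms(2), of t] by (simp add: prim_def)
  have i0: "integral {0..u} f = 0" if "u \<in> {0..1}" for u
    using prim_eq_HK_integral[OF \<open>L1 f\<close> that] p0[of u] by metis
  have "((\<lambda>u. integral {0..u} f) has_vector_derivative f x) (at x within {0..1})"
    by (rule integral_has_vector_derivative) (use assms in auto)
  then have "((\<lambda>u. 0) has_vector_derivative f x) (at x within {0..1})"
    by (rule has_vector_derivative_transform[OF assms(3), rotated]) (use i0 in simp)
  moreover have "((\<lambda>u. 0::complex) has_vector_derivative 0) (at x within {0..1})"
    by simp
  ultimately show ?thesis
    using assms(3) vector_derivative_unique_within_closed_interval[of 0 1 x "\<lambda>u. 0::complex" "f x" 0]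
    by simp
qed

subsection \<open>Smooth functions\<close>

definition smooth :: "(real \<Rightarrow> complex) \<Rightarrow> bool" where
  "smooth z \<longleftrightarrow> (\<forall>k x. nderiv k z differentiable (at x))"

lemma nderiv_0 [simp]: "nderiv 0 z = z"
  by (simp add: nderiv_def)

lemma nderiv_Suc: "nderiv (Suc k) z = (\<lambda>x. vector_derivative (nderiv k z) (at x))"
  by (simp add: nderiv_def)

lemma nderiv_nderiv: "nderiv k (nderiv j z) = nderiv (k + j) z"
  by (simp add: nderiv_def funpow_add)

lemma nderiv_eqI: "(\<And>x. (f has_vector_derivative g x) (at x)) \<Longrightarrow> nderiv 1 f = g"
  by (auto simp: nderiv_Suc fun_eq_iff intro: vector_derivative_at)

text \<open>All iterated derivatives stay inside a class closed under differentiation. Smoothness of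
  a concrete function is therefore shown by exhibiting a class of formulas, without a formula for
  its k-th derivative.\<close>

lemma smooth_coinduct:
  assumes "P f" "\<And>f. P f \<Longrightarrow> \<exists>g. P g \<and> (\<forall>x. (f has_vector_derivative g x) (at x))"
  shows "smooth f"
proof -
  have P: "P (nderiv k f)" for k
  proof (induction k)
    case (Suc k)
    then obtain g where "P g" "\<And>x. (nderiv k f has_vector_derivative g x) (at x)"
      using assms(2) by blast
    then have "nderiv (Suc k) f = g"
      by (auto simp: nderiv_Suc vector_derivative_at)
    then show ?case using \<open>P g\<close> by simp
  qed (use assms in simp)
  show ?thesis
    unfolding smooth_def using assms(2)[OF P] differentiableI_vector by blast
qed

lemma smooth_nderiv: "smooth f \<Longrightarrow> smooth (nderiv k f)"
  by (simp add: smooth_def nderiv_nderiv)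

lemma smooth_has_vector_derivative:
  "smooth f \<Longrightarrow> (nderiv k f has_vector_derivative nderiv (Suc k) f x) (at x)"
  by (simp add: smooth_def nderiv_Suc vector_derivative_works)

lemma smooth_has_derivative_1: "smooth f \<Longrightarrow> (f has_vector_derivative nderiv 1 f x) (at x)"
  using smooth_has_vector_derivative[of f 0 x] by simp

lemma smooth_continuous: "smooth f \<Longrightarrow> continuous_on S f"
  by (meson continuous_at_imp_continuous_on has_vector_derivative_continuous smooth_has_derivative_1)

lemma smooth_if_deriv:
  assumes "\<And>x. (f has_vector_derivative g x) (at x)" "smooth g"
  shows "smooth f"
  by (rule smooth_coinduct[where P = "\<lambda>h. h = f \<or> smooth h"])
    (use assms smooth_nderiv smooth_has_derivative_1 in blast)+

lemma smooth_const: "smooth (\<lambda>x. c)"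
  by (rule smooth_coinduct[where P = "\<lambda>h. \<exists>c. h = (\<lambda>x. c)"]) (auto intro!: exI[of _ "\<lambda>x. 0"])

text \<open>Finite sums of products of smooth functions are closed under differentiation.\<close>

lemma smooth_sum_list_mult:
  assumes "\<forall>(f, g)\<in>set fs. smooth f \<and> smooth g"
  shows "smooth (\<lambda>x. \<Sum>(f, g)\<leftarrow>fs. f x * g x)"
proof (rule smooth_coinduct[where P = "\<lambda>h. \<exists>fs. (\<forall>(f, g)\<in>set fs. smooth f \<and> smooth g)
      \<and> h = (\<lambda>x. \<Sum>(f, g)\<leftarrow>fs. f x * g x)"])
  fix h assume "\<exists>fs. (\<forall>(f, g)\<in>set fs. smooth f \<and> smooth g) \<and> h = (\<lambda>x. \<Sum>(f, g)\<leftarrow>fs. f x * g x)"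
  then obtain fs where fs: "\<forall>(f, g)\<in>set fs. smooth f \<and> smooth g" "h = (\<lambda>x. \<Sum>(f, g)\<leftarrow>fs. f x * g x)"
    by blast
  define fs' where "fs' = map (\<lambda>(f, g). (nderiv 1 f, g)) fs @ map (\<lambda>(f, g). (f, nderiv 1 g)) fs"
  have 1: "\<forall>(f, g)\<in>set fs'. smooth f \<and> smooth g"
    using fs(1) by (auto simp: fs'_def intro: smooth_nderiv)
  have 2: "(h has_vector_derivative (\<Sum>(f, g)\<leftarrow>fs'. f x * g x)) (at x)" for x
    unfolding fs(2) fs'_def using fs(1)
  proof (induction fs)
    case (Cons p fs)
    obtain f g where p: "p = (f, g)" by force
    have "((\<lambda>x. f x * g x) has_vector_derivative f x * nderiv 1 g x + nderiv 1 f x * g x) (at x)"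
      using Cons.prems by (intro has_vector_derivative_mult smooth_has_derivative_1) (auto simp: p)
    from has_vector_derivative_add[OF this Cons.IH] Cons.prems
    show ?case by (simp add: p algebra_simps)
  qed simp
  show "\<exists>g. (\<exists>fs. (\<forall>(f, g)\<in>set fs. smooth f \<and> smooth g) \<and> g = (\<lambda>x. \<Sum>(f, g)\<leftarrow>fs. f x * g x)) \<and>
      (\<forall>x. (h has_vector_derivative g x) (at x))"
    using 1 2 by (intro exI[of _ "\<lambda>x. \<Sum>(f, g)\<leftarrow>fs'. f x * g x"]) blast
qed (use assms in blast)

lemma smooth_mult: "smooth f \<Longrightarrow> smooth g \<Longrightarrow> smooth (\<lambda>x. f x * g x)"
  using smooth_sum_list_mult[of "[(f, g)]"] by simp

lemma smooth_add: "smooth f \<Longrightarrow> smooth g \<Longrightarrow> smooth (\<lambda>x. f x + g x)"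
  using smooth_sum_list_mult[of "[(f, \<lambda>x. 1), (g, \<lambda>x. 1)]"] by (simp add: smooth_const)

lemma smooth_diff: "smooth f \<Longrightarrow> smooth g \<Longrightarrow> smooth (\<lambda>x. f x - g x)"
  using smooth_add[of f "\<lambda>x. - 1 * g x"] smooth_mult[OF smooth_const[of "- 1"], of g] by simp

lemma smooth_cmult: "smooth f \<Longrightarrow> smooth (\<lambda>x. c * f x)"
  using smooth_mult[OF smooth_const] .

lemma smooth_power: "smooth f \<Longrightarrow> smooth (\<lambda>x. f x ^ n)"
  by (induction n) (auto simp: smooth_const smooth_mult)

lemma nderiv_add:
  assumes "smooth f" "smooth g"
  shows "nderiv k (\<lambda>x. f x + g x) = (\<lambda>x. nderiv k f x + nderiv k g x)"
proof (induction k)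
  case (Suc k)
  show ?case
    unfolding nderiv_Suc[of k "\<lambda>x. f x + g x"] Suc
    using assms by (auto intro!: vector_derivative_at has_vector_derivative_add smooth_has_vector_derivative)
qed simp

lemma nderiv_cmult:
  assumes "smooth f"
  shows "nderiv k (\<lambda>x. c * f x) = (\<lambda>x. c * nderiv k f x)"
proof (induction k)
  case (Suc k)
  show ?case
    unfolding nderiv_Suc[of k "\<lambda>x. c * f x"] Suc
    using assms by (auto intro!: vector_derivative_at has_vector_derivative_mult_right smooth_has_vector_derivative)
qed simp

text \<open>Formulated for two arbitrary sequences rather than for derivatives, so that it serves
  classical derivatives, chains of weak derivatives and values at a single point alike.\<close>

definition leibniz :: "nat \<Rightarrow> (nat \<Rightarrow> 'a::comm_ring_1) \<Rightarrow> (nat \<Rightarrow> 'a) \<Rightarrow> 'a" where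
  "leibniz l a b = (\<Sum>p\<le>l. of_nat (l choose p) * a p * b (l - p))"

lemma leibniz_0 [simp]: "leibniz 0 a b = a 0 * b 0"
  by (simp add: leibniz_def)

text \<open>Pascal's rule. Shifting one of the two sequences is differentiating one of the two
  factors.\<close>

lemma leibniz_Suc:
  "leibniz (Suc l) a b = leibniz l (\<lambda>p. a (Suc p)) b + leibniz l a (\<lambda>p. b (Suc p))"
proof -
  have "leibniz (Suc l) a b = a 0 * b (Suc l) + (\<Sum>p\<le>l. of_nat (Suc l choose Suc p) * a (Suc p) * b (l - p))"
    unfolding leibniz_def by (subst sum.atMost_Suc_shift) simp
  also have "(\<Sum>p\<le>l. of_nat (Suc l choose Suc p) * a (Suc p) * b (l - p)) =
     leibniz l (\<lambda>p. a (Suc p)) b + (\<Sum>p\<le>l. of_nat (l choose Suc p) * a (Suc p) * b (l - p))"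
    unfolding leibniz_def by (simp add: sum.distrib algebra_simps)
  also have "a 0 * b (Suc l) + (leibniz l (\<lambda>p. a (Suc p)) b + (\<Sum>p\<le>l. of_nat (l choose Suc p) * a (Suc p) * b (l - p)))
     = leibniz l (\<lambda>p. a (Suc p)) b + (\<Sum>p\<le>Suc l. of_nat (l choose p) * a p * b (Suc l - p))"
    using sum.atMost_Suc_shift[of "\<lambda>p. of_nat (l choose p) * a p * b (Suc l - p)" l] by simp
  also have "(\<Sum>p\<le>Suc l. of_nat (l choose p) * a p * b (Suc l - p)) = leibniz l a (\<lambda>p. b (Suc p))"
    unfolding leibniz_def by (simp add: Suc_diff_le binomial_eq_0)
  finally show ?thesis .
qed

lemma nderiv_mult:
  assumes "smooth f" "smooth g"
  shows "nderiv k (\<lambda>x. f x * g x) = (\<lambda>x. leibniz k (\<lambda>p. nderiv p f x) (\<lambda>p. nderiv p g x))"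
proof (induction k)
  case (Suc k)
  have "((\<lambda>x. leibniz k (\<lambda>p. nderiv p f x) (\<lambda>p. nderiv p g x)) has_vector_derivative
      (\<Sum>p\<le>k. of_nat (k choose p) * nderiv p f x * nderiv (Suc (k - p)) g x
        + of_nat (k choose p) * nderiv (Suc p) f x * nderiv (k - p) g x)) (at x)" for x
    unfolding leibniz_def using assms
    by (intro has_vector_derivative_sum has_vector_derivative_mult has_vector_derivative_mult_right
        smooth_has_vector_derivative)
  then have "nderiv (Suc k) (\<lambda>x. f x * g x) = (\<lambda>x. \<Sum>p\<le>k. of_nat (k choose p) * nderiv p f x * nderiv (Suc (k - p)) g x
        + of_nat (k choose p) * nderiv (Suc p) f x * nderiv (k - p) g x)"
    unfolding nderiv_Suc[of k "\<lambda>x. f x * g x"] Suc by (auto intro: vector_derivative_at)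
  then show ?case
    by (simp add: fun_eq_iff leibniz_Suc) (simp add: leibniz_def sum.distrib)
qed simp

subsection \<open>Bump functions\<close>

text \<open>The classical function exp(-1/t), multiplied by a polynomial in 1/t because such
  products are closed under differentiation.\<close>

definition flat :: "real poly \<Rightarrow> real \<Rightarrow> real" where
  "flat p t = (if t \<le> 0 then 0 else poly p (1 / t) * exp (- (1 / t)))"

lemma poly_exp_tendsto_0: "((\<lambda>u. poly p u * exp (- u)) \<longlongrightarrow> (0::real)) at_top"
proof -
  have "((\<lambda>u. \<Sum>i\<le>degree p. coeff p i * (u ^ i / exp u)) \<longlongrightarrow> (\<Sum>i\<le>degree p. coeff p i * 0)) at_top"
    by (intro tendsto_intros tendsto_power_div_exp_0)
  then show ?thesis
    by (simp add: poly_altdef sum_distrib_left exp_minus divide_inverse mult_ac)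
qed

text \<open>With u = 1/t one has d/dt = - u^2 d/du, and d/du turns p(u) exp(-u) into (p' - p)(u)
  exp(-u); this gives the factor \<open>[:0, 0, 1:]\<close>. At t = 0 exponential decay beats every
  polynomial in u.\<close>

lemma flat_deriv:
  "(flat p has_real_derivative flat ([:0, 0, 1:] * (p - pderiv p)) t) (at t)"
proof -
  consider "t < 0" | "t > 0" | "t = 0" by linarith
  then show ?thesis
  proof cases
    case 1
    have "((\<lambda>x. 0) has_real_derivative 0) (at t)" by simp
    then have "(flat p has_real_derivative 0) (at t)"
      by (rule has_field_derivative_transform_within_open[where S = "{..<0}"]) (use 1 in \<open>auto simp: flat_def\<close>)
    then show ?thesis using 1 by (simp add: flat_def)
  next
    case 2
    have "((\<lambda>t. poly p (1 / t) * exp (- (1 / t))) has_real_derivative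
        flat ([:0, 0, 1:] * (p - pderiv p)) t) (at t)"
    proof -
      have "((\<lambda>t. 1 / t) has_real_derivative - (1 / t^2)) (at t)"
        using 2 by (auto intro!: derivative_eq_intros simp: power2_eq_square)
      note d = DERIV_chain2[OF poly_DERIV this, of p] DERIV_fun_exp[OF DERIV_minus[OF this]]
      show ?thesis
        by (rule DERIV_cong[OF DERIV_mult[OF d]]) (use 2 in \<open>simp add: flat_def field_simps power2_eq_square\<close>)
    qed
    then show ?thesis
      by (rule has_field_derivative_transform_within_open[where S = "{0<..}"]) (use 2 in \<open>auto simp: flat_def\<close>)
  next
    case 3
    have "((\<lambda>h. flat p h / h) \<longlongrightarrow> 0) (at_right 0)"
    proof -
      have "((\<lambda>h. poly ([:0, 1:] * p) (inverse h) * exp (- inverse h)) \<longlongrightarrow> 0) (at_right 0)"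
        by (rule filterlim_compose[OF poly_exp_tendsto_0 filterlim_inverse_at_top_right])
      then show ?thesis
        by (rule Lim_transform_eventually)
          (auto simp: eventually_at_filter flat_def field_simps)
    qed
    moreover have "((\<lambda>h. flat p h / h) \<longlongrightarrow> 0) (at_left 0)"
      by (rule Lim_transform_eventually[OF tendsto_const]) (auto simp: eventually_at_filter flat_def)
    ultimately have "((\<lambda>h. flat p h / h) \<longlongrightarrow> 0) (at 0)"
      by (intro filterlim_split_at)
    then show ?thesis
      unfolding 3 by (simp add: has_field_derivative_iff flat_def)
  qed
qed

text \<open>The slope c is kept because c = - 1 yields functions that live to the left of a point;
  products of both kinds are bumps.\<close>

lemma smooth_flat: "smooth (\<lambda>x. complex_of_real (flat p (c * (x - a))))"
proof (rule smooth_coinduct[where P = "\<lambda>h. \<exists>p c a. h = (\<lambda>x. complex_of_real (flat p (c * (x - a))))"])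
  fix h assume "\<exists>p c a. h = (\<lambda>x. complex_of_real (flat p (c * (x - a))))"
  then obtain p c a where h: "h = (\<lambda>x. complex_of_real (flat p (c * (x - a))))" by blast
  let ?q = "smult c ([:0, 0, 1:] * (p - pderiv p))"
  have "((\<lambda>x. flat p (c * (x - a))) has_real_derivative flat ?q (c * (x - a))) (at x)" for x
  proof -
    have "((\<lambda>x. c * (x - a)) has_real_derivative c) (at x)"
      by (auto intro!: derivative_eq_intros)
    from DERIV_chain2[OF flat_deriv this]
    show ?thesis by (rule DERIV_cong) (simp add: flat_def)
  qed
  then have "(h has_vector_derivative complex_of_real (flat ?q (c * (x - a)))) (at x)" for x
    unfolding h by (intro has_vector_derivative_of_real) (simp add: has_real_derivative_iff_has_vector_derivative)
  then show "\<exists>g. (\<exists>p c a. g = (\<lambda>x. complex_of_real (flat p (c * (x - a))))) \<and>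
      (\<forall>x. (h has_vector_derivative g x) (at x))"
    by blast
qed blast

subsection \<open>Test functions\<close>

lemma test_smooth: "z \<in> test_functions \<Longrightarrow> smooth z"
  by (simp add: test_functions_def smooth_def)

lemma test_functions_iff:
  "z \<in> test_functions \<longleftrightarrow> smooth z \<and> (\<exists>a b. 0 < a \<and> a < b \<and> b < 1 \<and> (\<forall>x. x \<notin> {a..b} \<longrightarrow> z x = 0))"
proof
  assume z: "z \<in> test_functions"
  let ?K = "closure {x. z x \<noteq> 0}"
  have K: "compact ?K" "?K \<subseteq> {0<..<1}" and "smooth z"
    using z by (auto simp: test_functions_def smooth_def)
  have sub: "{x. z x \<noteq> 0} \<subseteq> ?K" by (rule closure_subset)
  have "\<exists>a b. 0 < a \<and> a < b \<and> b < 1 \<and> (\<forall>x. x \<notin> {a..b} \<longrightarrow> z x = 0)"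
  proof (cases "?K = {}")
    case True
    then have "z x = 0" for x using sub by auto
    then show ?thesis by (intro exI[of _ "1/3"] exI[of _ "2/3"]) auto
  next
    case False
    obtain s where s: "s \<in> ?K" "\<And>x. x \<in> ?K \<Longrightarrow> x \<le> s"
      using compact_attains_sup[OF K(1) False] by blast
    obtain i where i: "i \<in> ?K" "\<And>x. x \<in> ?K \<Longrightarrow> i \<le> x"
      using compact_attains_inf[OF K(1) False] by blast
    have "0 < i" "s < 1" "i \<le> s" using s i K(2) by auto
    moreover have "z x = 0" if "x \<notin> {i..s}" for x
      using that s(2) i(2) sub by force
    \<comment> \<open>Moving the ends halfway towards 0 and 1 makes the interval nondegenerate even
      when i = s.\<close>
    ultimately show ?thesis
      by (intro exI[of _ "i/2"] exI[of _ "(s+1)/2"]) auto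
  qed
  with \<open>smooth z\<close> show "smooth z \<and> (\<exists>a b. 0 < a \<and> a < b \<and> b < 1 \<and> (\<forall>x. x \<notin> {a..b} \<longrightarrow> z x = 0))" by blast
next
  assume "smooth z \<and> (\<exists>a b. 0 < a \<and> a < b \<and> b < 1 \<and> (\<forall>x. x \<notin> {a..b} \<longrightarrow> z x = 0))"
  then obtain a b where *: "smooth z" "0 < a" "a < b" "b < 1" "\<And>x. x \<notin> {a..b} \<Longrightarrow> z x = 0" by blast
  have sub: "closure {x. z x \<noteq> 0} \<subseteq> {a..b}"
    using *(5) by (intro closure_minimal) blast+
  then have "closure {x. z x \<noteq> 0} \<subseteq> {0<..<1}" using * by auto
  moreover have "compact (closure {x. z x \<noteq> 0})"
    using sub by (metis bounded_closed_interval bounded_subset closed_closure compact_eq_bounded_closed)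
  ultimately show "z \<in> test_functions" using *(1) by (auto simp: test_functions_def smooth_def)
qed

lemma test_vanish: "z \<in> test_functions \<Longrightarrow> x \<notin> {0<..<1} \<Longrightarrow> z x = 0"
  unfolding test_functions_iff by (meson atLeastAtMost_iff greaterThanLessThan_iff le_less_trans less_le_trans)

lemma test_mult_smooth:
  assumes "z \<in> test_functions" "smooth f"
  shows "(\<lambda>x. f x * z x) \<in> test_functions"
  using assms smooth_mult[of f z] unfolding test_functions_iff by (metis mult_zero_right)

lemma test_cmult: "z \<in> test_functions \<Longrightarrow> (\<lambda>x. c * z x) \<in> test_functions"
  by (intro test_mult_smooth smooth_const)

lemma test_add:
  assumes "z \<in> test_functions" "w \<in> test_functions"
  shows "(\<lambda>x. z x + w x) \<in> test_functions"
proof -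
  obtain a b where z: "0 < a" "a < b" "b < 1" "\<And>x. x \<notin> {a..b} \<Longrightarrow> z x = 0"
    using assms(1) unfolding test_functions_iff by blast
  obtain c d where w: "0 < c" "c < d" "d < 1" "\<And>x. x \<notin> {c..d} \<Longrightarrow> w x = 0"
    using assms(2) unfolding test_functions_iff by blast
  have "z x + w x = 0" if "x \<notin> {min a c..max b d}" for x
    using z(4)[of x] w(4)[of x] that
    by (metis add_0 atLeastAtMost_iff max.coboundedI1 max.coboundedI2 min.coboundedI1 min.coboundedI2)
  moreover have "0 < min a c" "min a c < max b d" "max b d < 1"
    using z w by auto
  ultimately show ?thesis
    using smooth_add[OF assms[THEN test_smooth]] unfolding test_functions_iff by blast
qed

lemma nderiv_vanish:
  assumes "\<And>x. x \<notin> {a..b} \<Longrightarrow> z x = 0" "x \<notin> {a..b}"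
  shows "nderiv k z x = 0"
  using assms(2)
proof (induction k arbitrary: x)
  case (Suc k)
  have "((\<lambda>x. 0) has_vector_derivative 0) (at x)" by simp
  then have "(nderiv k z has_vector_derivative 0) (at x)"
    by (rule has_vector_derivative_transform_within_open[where S = "- {a..b}"])
      (use Suc in auto)
  then show ?case by (simp add: nderiv_Suc vector_derivative_at)
qed (use assms in simp)

lemma test_nderiv: "z \<in> test_functions \<Longrightarrow> nderiv k z \<in> test_functions"
  unfolding test_functions_iff using smooth_nderiv nderiv_vanish by meson

lemma test_zero: "(\<lambda>x. 0) \<in> test_functions"
  unfolding test_functions_iff
  by (intro conjI smooth_const exI[of _ "1/3"] exI[of _ "2/3"]) auto

lemma test_sum: "(\<And>i. i \<in> I \<Longrightarrow> f i \<in> test_functions) \<Longrightarrow> (\<lambda>x. \<Sum>i\<in>I. f i x) \<in> test_functions"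
proof (induction I rule: infinite_finite_induct)
  case (insert i I) then show ?case by (auto intro: test_add)
qed (auto simp: test_zero)

text \<open>With a smooth \<open>w\<close> that is positive exactly on \<open>{a<..<b}\<close> and less than 1, the functions
  \<open>1 - (1 - w) ^ n\<close> increase to the indicator of \<open>{a<..<b}\<close>.\<close>

lemma test_approx_interval:
  assumes "0 < a" "a < b" "b < 1"
  obtains z where "\<And>n::nat. z n \<in> test_functions"
    "\<And>n x. norm (z n x) \<le> 1" "\<And>x. (\<lambda>n. z n x) \<longlonglongrightarrow> indicator {a<..<b} x"
proof -
  define w where "w x = flat 1 (1 * (x - a)) * flat 1 ((- 1) * (x - b))" for x
  define z where "z n x = 1 - (1 - complex_of_real (w x)) ^ n" for n x
  have fl: "0 \<le> flat 1 t" "flat 1 t < 1" "flat 1 t > 0 \<longleftrightarrow> t > 0" for t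
    by (auto simp: flat_def)
  have w: "0 \<le> w x" "w x < 1" for x
    using fl[of "1 * (x - a)"] fl[of "(- 1) * (x - b)"] unfolding w_def
    by (auto intro: mult_nonneg_nonneg) (metis fl(1) fl(2) less_eq_real_def mult_less_cancel_right2 mult_less_le_imp_less mult.left_neutral mult_le_one order_le_less_trans)
  have wp: "w x > 0 \<longleftrightarrow> x \<in> {a<..<b}" for x
    using fl[of "1 * (x - a)"] fl[of "(- 1) * (x - b)"] unfolding w_def
    by (auto simp: zero_less_mult_iff)
  have zr: "z n x = complex_of_real (1 - (1 - w x) ^ n)" for n x
    by (simp add: z_def)
  have "smooth (\<lambda>x. complex_of_real (w x))"
    unfolding w_def of_real_mult by (intro smooth_mult smooth_flat)
  then have "smooth (z n)" for n
    unfolding z_def by (intro smooth_diff smooth_const smooth_power)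
  moreover have "z n x = 0" if "x \<notin> {a..b}" for n x
    using wp[of x] w[of x] that by (auto simp: zr)
  ultimately have "z n \<in> test_functions" for n
    using assms unfolding test_functions_iff by blast
  moreover have "norm (z n x) \<le> 1" for n x
    using w[of x] unfolding zr norm_of_real by (auto simp: abs_le_iff power_le_one)
  moreover have "(\<lambda>n. z n x) \<longlonglongrightarrow> indicator {a<..<b} x" for x
  proof (cases "x \<in> {a<..<b}")
    case True
    then have "(\<lambda>n. (1 - w x) ^ n) \<longlonglongrightarrow> 0"
      using w[of x] wp[of x] by (intro LIMSEQ_abs_realpow_zero2) auto
    then have "(\<lambda>n. z n x) \<longlonglongrightarrow> complex_of_real (1 - 0)"
      unfolding zr by (intro tendsto_of_real tendsto_diff tendsto_const)
    then show ?thesis using True by simp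
  next
    case False
    then have "w x = 0" using w(1)[of x] wp[of x] by linarith
    then show ?thesis using False by (simp add: zr)
  qed
  ultimately show ?thesis using that by blast
qed

text \<open>The primitive from 0 is constant to the right of the support of z; the vanishing mean is
  exactly what makes this constant zero.\<close>

lemma test_antiderivative:
  assumes z: "z \<in> test_functions" and i: "integral {0..1} z = 0"
  obtains Z where "Z \<in> test_functions" "nderiv 1 Z = z"
proof -
  obtain a b where ab: "0 < a" "a < b" "b < 1" "\<And>x. x \<notin> {a..b} \<Longrightarrow> z x = 0"
    using z unfolding test_functions_iff by blast
  have c: "continuous_on S z" for S
    using z by (intro smooth_continuous test_smooth)
  define Z where "Z x = integral {0..x} z" for x
  have Z0: "Z x = 0" if "x < a" for x
  proof -
    have "Z x = integral {0..x} (\<lambda>x. 0)"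
      unfolding Z_def using ab that by (intro integral_cong) auto
    then show ?thesis by simp
  qed
  have Z: "(Z has_vector_derivative z x) (at x)" for x
  proof (cases "x < a")
    case True
    have "((\<lambda>x. 0) has_vector_derivative 0) (at x)" by simp
    then have "(Z has_vector_derivative 0) (at x)"
      by (rule has_vector_derivative_transform_within_open[where S = "{..<a}"]) (use True Z0 in auto)
    then show ?thesis using ab(4)[of x] True by simp
  next
    case False
    \<comment> \<open>The one-sided looking derivative within {0..x + 1} is two-sided, because x
      \<ge> a > 0 is an interior point.\<close>
    have "(Z has_vector_derivative z x) (at x within {0..x + 1})"
      unfolding Z_def using False ab c by (intro integral_has_vector_derivative) auto
    then have "(Z has_vector_derivative z x) (at x within {0<..<x + 1})"
      by (rule has_vector_derivative_within_subset) auto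
    then show ?thesis
      using False ab by (subst (asm) at_within_open) auto
  qed
  have sZ: "smooth Z"
    using Z test_smooth[OF z] by (rule smooth_if_deriv)
  have Zb: "Z x = Z y" if "b < x" "x \<le> y" for x y
  proof -
    have "Z y = Z x + integral {x..y} z"
      unfolding Z_def using that ab(1,2)
      by (intro Henstock_Kurzweil_Integration.integral_combine[symmetric] integrable_continuous_real c) auto
    moreover have "integral {x..y} z = integral {x..y} (\<lambda>x. 0)"
      using that ab by (intro integral_cong) auto
    ultimately show ?thesis by simp
  qed
  have Z1: "Z 1 = 0" by (simp add: Z_def i)
  have "Z x = 0" if "x > b" for x
    using Zb[of x 1] Zb[of 1 x] that ab Z1 by (cases "x \<le> 1") auto
  then have "Z \<in> test_functions"
    using sZ Z0 ab unfolding test_functions_iff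
    by (intro conjI exI[of _ a] exI[of _ b]) auto
  moreover have "nderiv 1 Z = z"
    using Z by (rule nderiv_eqI)
  ultimately show ?thesis using that by blast
qed

subsection \<open>Square integrable functions and regular distributions\<close>

lemma AE_eq_sym: "AE x in M. f x = g x \<Longrightarrow> AE x in M. g x = f x"
  by (auto elim: eventually_mono)

lemma Lp1_iff: "f \<in> Lp 1 \<longleftrightarrow> L1 f" "f \<in> Lp (Suc 0) \<longleftrightarrow> L1 f"
  unfolding Lp_def by (auto simp: integrable_norm_iff)

lemma Lp2_measurable: "f \<in> Lp 2 \<Longrightarrow> f \<in> borel_measurable unit_measure"
  by (simp add: Lp_def)

lemma Lp2_mult:
  assumes "f \<in> Lp 2" "g \<in> Lp 2"
  shows "L1 (\<lambda>x. f x * g x)"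
proof (rule Bochner_Integration.integrable_bound)
  show "integrable unit_measure (\<lambda>x. norm (f x) ^ 2 + norm (g x) ^ 2)"
    using assms by (auto simp: Lp_def)
  show "(\<lambda>x. f x * g x) \<in> borel_measurable unit_measure"
    using assms by (auto simp: Lp_def)
  have "norm (f x * g x) \<le> norm (norm (f x) ^ 2 + norm (g x) ^ 2)" for x
  proof -
    have "2 * (norm (f x) * norm (g x)) \<le> norm (f x) ^ 2 + norm (g x) ^ 2"
      using sum_squares_bound[of "norm (f x)" "norm (g x)"] by (simp add: mult.assoc)
    moreover have "0 \<le> norm (f x) * norm (g x)" by simp
    ultimately show ?thesis unfolding norm_mult real_norm_def by linarith
  qed
  then show "AE x in unit_measure. norm (f x * g x) \<le> norm (norm (f x) ^ 2 + norm (g x) ^ 2)"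
    by simp
qed

lemma Lp2_bounded:
  assumes "f \<in> borel_measurable unit_measure" "AE x in unit_measure. norm (f x) \<le> B"
  shows "f \<in> Lp 2"
  unfolding Lp_def
proof (intro CollectI conjI assms(1))
  show "integrable unit_measure (\<lambda>x. norm (f x) ^ 2)"
  proof (rule finite_measure.integrable_const_bound[OF finite_measure_unit_measure, where B = "B^2"])
    show "AE x in unit_measure. norm (norm (f x) ^ 2) \<le> B ^ 2"
      using assms(2) by eventually_elim (auto intro: power_mono)
  qed (use assms in auto)
qed

lemma Lp2_const: "(\<lambda>x. c) \<in> Lp 2"
  by (rule Lp2_bounded[where B = "norm c"]) auto

lemma Lp2_imp_L1: "f \<in> Lp 2 \<Longrightarrow> L1 f"
  using Lp2_mult[OF _ Lp2_const[of 1]] by simp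

lemma continuous_imp_Lp2:
  assumes "continuous_on {0..1} f"
  shows "f \<in> Lp 2"
proof -
  obtain B where "\<And>x. x \<in> {0..1} \<Longrightarrow> norm (f x) \<le> B"
    using continuous_unit_bounded[OF assms] by blast
  then show ?thesis
    using continuous_imp_measurable_unit[OF assms] by (intro Lp2_bounded[where B = B] AE_I2) auto
qed

lemma Lp2_mult_bounded:
  assumes "h \<in> borel_measurable unit_measure" "AE x in unit_measure. norm (h x) \<le> B" "f \<in> Lp 2"
  shows "(\<lambda>x. h x * f x) \<in> Lp 2"
  unfolding Lp_def
proof (intro CollectI conjI)
  show m: "(\<lambda>x. h x * f x) \<in> borel_measurable unit_measure"
    using assms by (auto simp: Lp_def)
  show "integrable unit_measure (\<lambda>x. norm (h x * f x) ^ 2)"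
  proof (rule Bochner_Integration.integrable_bound)
    show "integrable unit_measure (\<lambda>x. B^2 * norm (f x) ^ 2)"
      using assms by (auto simp: Lp_def)
    show "AE x in unit_measure. norm (norm (h x * f x) ^ 2) \<le> norm (B^2 * norm (f x) ^ 2)"
      using assms(2)
    proof eventually_elim
      case (elim x)
      then have "norm (h x) ^ 2 \<le> B ^ 2" by (intro power_mono) auto
      then show ?case by (auto simp: norm_mult power_mult_distrib intro: mult_right_mono)
    qed
  qed (use m in auto)
qed

lemma Lp2_continuous_mult:
  assumes "continuous_on {0..1} h" "f \<in> Lp 2"
  shows "(\<lambda>x. h x * f x) \<in> Lp 2"
proof -
  obtain B where "\<And>x. x \<in> {0..1} \<Longrightarrow> norm (h x) \<le> B"
    using continuous_unit_bounded[OF assms(1)] by blast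
  then show ?thesis
    by (intro Lp2_mult_bounded[OF continuous_imp_measurable_unit[OF assms(1)] _ assms(2), of B] AE_I2) auto
qed

lemma Lp2_cmult: "f \<in> Lp 2 \<Longrightarrow> (\<lambda>x. c * f x) \<in> Lp 2"
  by (rule Lp2_continuous_mult[where h = "\<lambda>x. c"]) simp_all

lemma Lp2_add:
  assumes "f \<in> Lp 2" "g \<in> Lp 2"
  shows "(\<lambda>x. f x + g x) \<in> Lp 2"
  unfolding Lp_def
proof (intro CollectI conjI)
  show m: "(\<lambda>x. f x + g x) \<in> borel_measurable unit_measure"
    using assms by (auto simp: Lp_def)
  show "integrable unit_measure (\<lambda>x. norm (f x + g x) ^ 2)"
  proof (rule Bochner_Integration.integrable_bound)
    show "integrable unit_measure (\<lambda>x. 2 * norm (f x) ^ 2 + 2 * norm (g x) ^ 2)"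
      using assms by (auto simp: Lp_def)
    have "norm (f x + g x) ^ 2 \<le> 2 * norm (f x) ^ 2 + 2 * norm (g x) ^ 2" for x
    proof -
      have "norm (f x + g x) ^ 2 \<le> (norm (f x) + norm (g x)) ^ 2"
        by (intro power_mono norm_triangle_ineq) auto
      also have "\<dots> \<le> 2 * norm (f x) ^ 2 + 2 * norm (g x) ^ 2"
        using sum_squares_bound[of "norm (f x)" "norm (g x)"] by (simp add: power2_sum)
      finally show ?thesis .
    qed
    then show "AE x in unit_measure. norm (norm (f x + g x) ^ 2) \<le> norm (2 * norm (f x) ^ 2 + 2 * norm (g x) ^ 2)"
      by simp
  qed (use m in auto)
qed

lemma Lp2_diff: "f \<in> Lp 2 \<Longrightarrow> g \<in> Lp 2 \<Longrightarrow> (\<lambda>x. f x - g x) \<in> Lp 2"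
  using Lp2_add[OF _ Lp2_cmult[of g "- 1"]] by simp

lemma Lp2_sum: "(\<And>i. i \<in> I \<Longrightarrow> f i \<in> Lp 2) \<Longrightarrow> (\<lambda>x. \<Sum>i\<in>I. f i x) \<in> Lp 2"
  by (induction I rule: infinite_finite_induct) (auto simp: Lp2_const intro: Lp2_add)

lemma Lp2_AE_cong:
  assumes "f \<in> Lp 2" "AE x in unit_measure. f x = g x"
  shows "g \<in> Lp 2"
proof -
  have m: "g \<in> borel_measurable unit_measure"
    by (rule AE_unit_measure_cong_measurable[OF Lp2_measurable[OF assms(1)] assms(2)])
  have "integrable unit_measure (\<lambda>x. norm (g x) ^ 2)"
  proof (rule integrable_cong_AE_imp[where g = "\<lambda>x. norm (f x) ^ 2"])
    show "AE x in unit_measure. norm (f x) ^ 2 = norm (g x) ^ 2"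
      using assms(2) by eventually_elim simp
  qed (use assms m in \<open>auto simp: Lp_def\<close>)
  with m show ?thesis by (simp add: Lp_def)
qed

lemma test_continuous: "z \<in> test_functions \<Longrightarrow> continuous_on S z"
  by (intro smooth_continuous test_smooth)

lemma L1_mult_test: "L1 f \<Longrightarrow> z \<in> test_functions \<Longrightarrow> L1 (\<lambda>x. f x * z x)"
  by (intro L1_mult_continuous test_continuous)

lemma regular_dist_test: "z \<in> test_functions \<Longrightarrow> regular_dist f z = (\<integral>x. f x * z x \<partial>unit_measure)"
  by (simp add: regular_dist_def)

lemma integral_cong_L1_AE:
  assumes "L1 f" "AE x in unit_measure. f x = g x"
  shows "(\<integral>x. f x \<partial>unit_measure) = (\<integral>x. g x \<partial>unit_measure)"
  by (rule integral_cong_AE) (use assms L1_AE_cong[OF assms] in auto)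

lemma regular_dist_cong_AE:
  assumes "L1 f" "AE x in unit_measure. f x = g x"
  shows "regular_dist f = regular_dist g"
proof
  fix z
  have "(\<integral>x. f x * z x \<partial>unit_measure) = (\<integral>x. g x * z x \<partial>unit_measure)" if "z \<in> test_functions"
  proof (rule integral_cong_L1_AE[OF L1_mult_test[OF assms(1) that]])
    show "AE x in unit_measure. f x * z x = g x * z x"
      using assms(2) by eventually_elim simp
  qed
  then show "regular_dist f z = regular_dist g z" by (simp add: regular_dist_def)
qed

lemma regular_dist_add:
  assumes "L1 f" "L1 g"
  shows "regular_dist (\<lambda>x. f x + g x) z = regular_dist f z + regular_dist g z"
  using L1_mult_test[OF assms(1), of z] L1_mult_test[OF assms(2), of z]
  by (simp add: regular_dist_def distrib_right)

lemma regular_dist_cmult: "regular_dist (\<lambda>x. c * f x) z = c * regular_dist f z"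
  by (simp add: regular_dist_def mult.assoc)

lemma regular_dist_sum:
  assumes "\<And>i. i \<in> I \<Longrightarrow> L1 (f i)"
  shows "regular_dist (\<lambda>x. \<Sum>i\<in>I. f i x) z = (\<Sum>i\<in>I. regular_dist (f i) z)"
  using assms
proof (induction I rule: infinite_finite_induct)
  case (insert i I)
  then show ?case by (simp add: regular_dist_add)
qed (auto simp: regular_dist_def)

subsection \<open>The fundamental lemma of the calculus of variations\<close>

text \<open>Dominated convergence replaces test functions by indicators of open intervals, so the
  primitive of f is constant on (0,1). Continuity at 0 identifies the constant as zero.\<close>

lemma AE_0_if_orthogonal_to_test:
  assumes f: "L1 f" and 0: "\<And>z. z \<in> test_functions \<Longrightarrow> (\<integral>x. f x * z x \<partial>unit_measure) = 0"
  shows "AE x in unit_measure. f x = 0"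
proof (rule prim_eq_0_imp_AE[OF f])
  have open_interval: "(\<integral>x. f x * indicator {a<..<b} x \<partial>unit_measure) = 0" if "0 < a" "a < b" "b < 1" for a b
  proof -
    obtain z where z: "\<And>n::nat. z n \<in> test_functions"
      "\<And>n x. norm (z n x) \<le> 1" "\<And>x. (\<lambda>n. z n x) \<longlonglongrightarrow> indicator {a<..<b} x"
      using test_approx_interval[OF \<open>0 < a\<close> \<open>a < b\<close> \<open>b < 1\<close>] by blast
    have m: "f \<in> borel_measurable unit_measure" using f by auto
    have "(\<lambda>n. \<integral>x. f x * z n x \<partial>unit_measure) \<longlonglongrightarrow> (\<integral>x. f x * indicator {a<..<b} x \<partial>unit_measure)"
    proof (rule integral_dominated_convergence[where w = "\<lambda>x. norm (f x)"])
      show "(\<lambda>x. f x * indicator {a<..<b} x) \<in> borel_measurable unit_measure"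
        by (rule borel_measurable_times[OF m], rule measurable_restrict_space1,
            rule borel_measurable_indicator) simp
      show "(\<lambda>x. f x * z n x) \<in> borel_measurable unit_measure" for n
        using L1_mult_test[OF f z(1)] by auto
      show "AE x in unit_measure. (\<lambda>n. f x * z n x) \<longlonglongrightarrow> f x * indicator {a<..<b} x"
        by (intro AE_I2 tendsto_mult tendsto_const z(3))
      show "AE x in unit_measure. norm (f x * z n x) \<le> norm (f x)" for n
        using z(2) by (auto simp: norm_mult intro!: mult_left_le)
    qed (use f in auto)
    moreover have "(\<integral>x. f x * z n x \<partial>unit_measure) = 0" for n
      using 0[OF z(1)] .
    ultimately show ?thesis by (simp add: LIMSEQ_const_iff)
  qed
  have eq: "prim f b = prim f a" if "0 < a" "a < b" "b < 1" for a b
  proof -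
    have "prim f b - prim f a = (\<integral>x. indicator {..<b} x * f x - indicator {..a} x * f x \<partial>unit_measure)"
      using indicator_mult_L1[OF f] by (subst prim_open[OF f, symmetric], unfold prim_def[of f a]) simp
    also have "\<dots> = (\<integral>x. f x * indicator {a<..<b} x \<partial>unit_measure)"
      using that by (intro Bochner_Integration.integral_cong) (auto split: split_indicator)
    finally show ?thesis using open_interval[OF that] by simp
  qed
  fix x :: real assume x: "x \<in> {0<..<1}"
  have "(prim f \<longlongrightarrow> prim f 0) (at 0 within {0..1})"
    using continuous_prim[OF f] unfolding continuous_on_def by (rule bspec) simp
  then have "(prim f \<longlongrightarrow> prim f 0) (at_right 0)"
    by (simp add: at_within_Icc_at_right)
  moreover have "\<forall>\<^sub>F t in at_right 0. prim f t = prim f x"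
    using eventually_at_right_real[of 0 x] x by (auto elim!: eventually_mono intro!: eq[symmetric])
  ultimately have "((\<lambda>t. prim f x) \<longlongrightarrow> prim f 0) (at_right (0::real))"
    by (rule Lim_transform_eventually)
  then show "prim f x = 0"
    by (simp add: tendsto_const_iff)
qed

lemma regular_dist_eq_imp_AE:
  assumes "L1 f" "L1 g" "\<And>z. z \<in> test_functions \<Longrightarrow> regular_dist f z = regular_dist g z"
  shows "AE x in unit_measure. f x = g x"
proof -
  have "AE x in unit_measure. f x - g x = 0"
  proof (rule AE_0_if_orthogonal_to_test)
    fix z assume z: "z \<in> test_functions"
    have "(\<integral>x. f x * z x \<partial>unit_measure) = (\<integral>x. g x * z x \<partial>unit_measure)"
      using assms(3)[OF z] z by (simp add: regular_dist_def)
    then show "(\<integral>x. (f x - g x) * z x \<partial>unit_measure) = 0"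
      using L1_mult_test[OF assms(1) z] L1_mult_test[OF assms(2) z] by (simp add: left_diff_distrib)
  qed (use assms in auto)
  then show ?thesis by simp
qed

text \<open>The choice in \<open>dist_fun\<close> is harmless: by the fundamental lemma any two
  integrable functions with the same regular distribution agree almost everywhere.\<close>

lemma dist_fun_regular:
  assumes "L1 f"
  shows "L1 (dist_fun (regular_dist f))" "AE x in unit_measure. dist_fun (regular_dist f) x = f x"
    "regular_dist (dist_fun (regular_dist f)) = regular_dist f"
proof -
  have "\<exists>g. g \<in> Lp 1 \<and> regular_dist f = regular_dist g"
    using assms Lp1_iff by blast
  from someI_ex[OF this] have *: "L1 (dist_fun (regular_dist f))"
    "regular_dist f = regular_dist (dist_fun (regular_dist f))"
    by (simp_all add: dist_fun_def Lp1_iff)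
  then show "L1 (dist_fun (regular_dist f))" "regular_dist (dist_fun (regular_dist f)) = regular_dist f"
    by simp_all
  show "AE x in unit_measure. dist_fun (regular_dist f) x = f x"
    by (rule regular_dist_eq_imp_AE[OF *(1) assms]) (simp flip: *(2))
qed

section \<open>Derivatives of functionals, and functionals that kill derivatives\<close>

lemma dist_deriv_pow_test:
  "z \<in> test_functions \<Longrightarrow> (dist_deriv ^^ i) T z = (- 1) ^ i * T (nderiv i z)"
proof (induction i arbitrary: z)
  case (Suc i)
  then show ?case
    by (simp add: dist_deriv_def test_nderiv nderiv_nderiv)
qed simp

lemma dist_deriv_pow_off_test:
  "z \<notin> test_functions \<Longrightarrow> T z = 0 \<Longrightarrow> (dist_deriv ^^ i) T z = 0"
  by (cases i) (simp_all add: dist_deriv_def)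

lemma regular_dist_off_test: "z \<notin> test_functions \<Longrightarrow> regular_dist f z = 0"
  by (simp add: regular_dist_def)

lemma smooth_ac_deriv: "smooth f \<Longrightarrow> ac_deriv (nderiv k f) (nderiv (Suc k) f)"
  by (rule C1_imp_ac_deriv)
    (auto intro: has_vector_derivative_at_within[OF smooth_has_vector_derivative] smooth_continuous smooth_nderiv)

lemma integral_mult_test_by_parts:
  assumes "ac_deriv f g" "z \<in> test_functions"
  shows "(\<integral>x. f x * nderiv 1 z x \<partial>unit_measure) = - (\<integral>x. g x * z x \<partial>unit_measure)"
  using ac_deriv_by_parts[OF assms(1) smooth_ac_deriv[OF test_smooth[OF assms(2)], of 0]]
    test_vanish[OF assms(2), of 0] test_vanish[OF assms(2), of 1]
  by (simp add: add_eq_0_iff2)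

lemma ac_deriv_dist_deriv:
  assumes "ac_deriv f g"
  shows "dist_deriv (regular_dist f) = regular_dist g"
  using integral_mult_test_by_parts[OF assms]
  by (auto simp: fun_eq_iff dist_deriv_def regular_dist_def test_nderiv)

text \<open>The linearity clause of \<open>distributions\<close> on its own. Functionals such as z
  \<mapsto> T (\<open>nderiv k z\<close>) have uncontrolled values off the test functions and so
  need not belong to \<open>distributions\<close>.\<close>

definition test_linear :: "functional \<Rightarrow> bool" where
  "test_linear T \<longleftrightarrow> (\<forall>a b. \<forall>z\<in>test_functions. \<forall>w\<in>test_functions.
        T (\<lambda>x. a * z x + b * w x) = a * T z + b * T w)"

lemma test_linear_regular:
  assumes "L1 f"
  shows "test_linear (regular_dist f)"
  unfolding test_linear_def
proof (intro allI ballI)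
  fix a b z w assume zw: "z \<in> test_functions" "w \<in> test_functions"
  have "(\<integral>x. f x * (a * z x + b * w x) \<partial>unit_measure) =
    (\<integral>x. a * (f x * z x) + b * (f x * w x) \<partial>unit_measure)"
    by (intro Bochner_Integration.integral_cong) (auto simp: algebra_simps)
  also have "\<dots> = a * (\<integral>x. f x * z x \<partial>unit_measure) + b * (\<integral>x. f x * w x \<partial>unit_measure)"
    using L1_mult_test[OF assms] zw by simp
  finally show "regular_dist f (\<lambda>x. a * z x + b * w x) = a * regular_dist f z + b * regular_dist f w"
    using zw test_add[OF test_cmult test_cmult] by (simp add: regular_dist_def)
qed

lemma test_linear_comp_nderiv:
  assumes "test_linear T"
  shows "test_linear (\<lambda>z. T (nderiv k z))"
  using assms unfolding test_linear_def
  by (auto simp: nderiv_add nderiv_cmult smooth_cmult test_smooth test_nderiv)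

lemma test_linear_add: "test_linear S \<Longrightarrow> test_linear T \<Longrightarrow> test_linear (\<lambda>z. S z + T z)"
  unfolding test_linear_def by (simp add: algebra_simps)

lemma test_linear_scale: "test_linear S \<Longrightarrow> test_linear (\<lambda>z. c * S z)"
  unfolding test_linear_def by (simp add: algebra_simps)

lemma test_linear_sum: "(\<And>i. i \<in> I \<Longrightarrow> test_linear (S i)) \<Longrightarrow> test_linear (\<lambda>z. \<Sum>i\<in>I. S i z)"
proof (induction I rule: infinite_finite_induct)
  case (insert i I) then show ?case by (auto intro: test_linear_add)
qed (auto simp: test_linear_def)

lemma test_linear_dist_deriv:
  assumes "test_linear T"
  shows "test_linear (dist_deriv T)"
  using test_linear_comp_nderiv[OF assms, of 1]
  unfolding test_linear_def dist_deriv_def by (simp add: test_add test_cmult)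

lemma HK_integral_test:
  "z \<in> test_functions \<Longrightarrow> integral {0..1} z = (\<integral>x. z x \<partial>unit_measure)"
  by (intro lebesgue_integral_eq_integral[symmetric] continuous_imp_L1 test_continuous) auto

text \<open>If all integrals vanished, the constant 1 would be orthogonal to every test function; so
  no bump has to be integrated explicitly.\<close>

lemma test_with_integral_1:
  obtains \<phi> where "\<phi> \<in> test_functions" "(\<integral>x. \<phi> x \<partial>unit_measure) = 1"
proof -
  have "\<exists>z\<in>test_functions. (\<integral>x. z x \<partial>unit_measure) \<noteq> 0"
  proof (rule ccontr)
    assume "\<not> ?thesis"
    then have "AE x in unit_measure. (1::complex) = 0"
      by (intro AE_0_if_orthogonal_to_test) auto
    then show False
      using continuous_AE_0_imp_0[of "\<lambda>x. 1" 0] by simp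
  qed
  then obtain z where "z \<in> test_functions" "(\<integral>x. z x \<partial>unit_measure) \<noteq> 0" by blast
  then show ?thesis
    by (intro that[of "\<lambda>x. inverse (\<integral>x. z x \<partial>unit_measure) * z x"] test_cmult) auto
qed

text \<open>Subtracting from z the multiple of a normalised \<phi> with the same integral leaves a
  function of mean zero, which is the derivative of a test function. Hence the constant is T
  \<phi>.\<close>

lemma constant_if_kills_derivatives:
  assumes "test_linear T" "\<And>z. z \<in> test_functions \<Longrightarrow> T (nderiv 1 z) = 0"
  obtains c where "\<And>z. z \<in> test_functions \<Longrightarrow> T z = (\<integral>x. c * z x \<partial>unit_measure)"
proof -
  obtain \<phi> where \<phi>: "\<phi> \<in> test_functions" "(\<integral>x. \<phi> x \<partial>unit_measure) = 1"
    by (rule test_with_integral_1)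
  have "T z = (\<integral>x. T \<phi> * z x \<partial>unit_measure)" if z: "z \<in> test_functions" for z
  proof -
    define I where "I = (\<integral>x. z x \<partial>unit_measure)"
    define w where "w x = 1 * z x + (- I) * \<phi> x" for x
    have w: "w \<in> test_functions"
      unfolding w_def using z \<phi> by (intro test_add test_cmult)
    have "(\<integral>x. w x \<partial>unit_measure) = 0"
      unfolding w_def using z \<phi> by (simp add: I_def continuous_imp_L1 test_continuous)
    then obtain Z where "Z \<in> test_functions" "nderiv 1 Z = w"
      using test_antiderivative[OF w] HK_integral_test[OF w] by metis
    then have "T w = 0" using assms(2) by blast
    then have "1 * T z + (- I) * T \<phi> = 0"
      using assms(1) z \<phi>(1) unfolding test_linear_def w_def by metis
    then show ?thesis by (simp add: I_def)
  qed
  then show ?thesis using that by blast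
qed

text \<open>The difference of f and the primitive of g kills derivatives, hence is constant almost
  everywhere. This supplies the absolutely continuous representative.\<close>

lemma weak_deriv_imp_ac_deriv:
  assumes "L1 f" "L1 g" "dist_deriv (regular_dist f) = regular_dist g"
  obtains h where "ac_deriv h g" "AE x in unit_measure. f x = h x"
proof -
  have F: "ac_deriv (prim g) g"
    using ac_deriv_prim[OF assms(2), of 0] by simp
  have L: "L1 (prim g)" using F by (rule ac_deriv_imp_L1)
  have D: "L1 (\<lambda>x. f x + (- 1) * prim g x)" using assms(1) L by auto
  define T where "T = regular_dist (\<lambda>x. f x + (- 1) * prim g x)"
  have T: "T z = regular_dist f z - regular_dist (prim g) z" for z
    unfolding T_def using assms(1) L by (subst regular_dist_add) (auto simp: regular_dist_def mult.assoc)
  have "T (nderiv 1 z) = 0" if "z \<in> test_functions" for z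
  proof -
    have "- regular_dist f (nderiv 1 z) = - regular_dist (prim g) (nderiv 1 z)"
      using fun_cong[OF assms(3), of z] fun_cong[OF ac_deriv_dist_deriv[OF F], of z] that
      by (simp add: dist_deriv_def)
    then show ?thesis by (simp add: T)
  qed
  moreover have "test_linear T" unfolding T_def using D by (rule test_linear_regular)
  ultimately obtain c where c: "\<And>z. z \<in> test_functions \<Longrightarrow> T z = (\<integral>x. c * z x \<partial>unit_measure)"
    using constant_if_kills_derivatives by blast
  have "AE x in unit_measure. f x + (- 1) * prim g x = c"
    by (rule regular_dist_eq_imp_AE[OF D]) (use c in \<open>auto simp: T_def regular_dist_def\<close>)
  then have "AE x in unit_measure. f x = c + prim g x"
    by eventually_elim (simp add: algebra_simps)
  then show ?thesis using that ac_deriv_prim[OF assms(2)] by blast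
qed

section \<open>The space W_1^1 and chains of successive derivatives\<close>

lemma sobolev_1_1E:
  assumes "f \<in> sobolev 1 1"
  obtains h g where "ac_deriv h g" "AE x in unit_measure. f x = h x" "L1 f"
proof -
  have "f \<in> Lp 1 \<and> (\<forall>i\<le>1. \<exists>g\<in>Lp 1. (dist_deriv ^^ i) (regular_dist f) = regular_dist g)"
    using assms unfolding sobolev_def by blast
  then have f: "L1 f" and "\<exists>g\<in>Lp 1. (dist_deriv ^^ 1) (regular_dist f) = regular_dist g"
    using Lp1_iff by blast+
  then obtain g where g: "L1 g" "dist_deriv (regular_dist f) = regular_dist g"
    by (auto simp: Lp1_iff)
  obtain h where "ac_deriv h g" "AE x in unit_measure. f x = h x"
    using weak_deriv_imp_ac_deriv[OF f g] by blast
  with f show ?thesis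
    by (rule that[rotated 2])
qed

lemma sobolev_1_1I:
  assumes "ac_deriv h g" "AE x in unit_measure. f x = h x"
  shows "f \<in> sobolev 1 1"
proof -
  have f: "L1 f"
    by (rule L1_AE_cong[OF ac_deriv_imp_L1[OF assms(1)] AE_eq_sym[OF assms(2)]])
  have "dist_deriv (regular_dist f) = regular_dist g"
    using regular_dist_cong_AE[OF f assms(2)] ac_deriv_dist_deriv[OF assms(1)] by simp
  then have d: "(dist_deriv ^^ 1) (regular_dist f) = regular_dist g"
    by simp
  have "\<exists>g\<in>Lp 1. (dist_deriv ^^ i) (regular_dist f) = regular_dist g" if "i \<le> 1" for i
  proof -
    consider "i = 0" | "i = 1" using \<open>i \<le> 1\<close> by fastforce
    then show ?thesis
    proof cases
      case 1
      then show ?thesis using f Lp1_iff(1) by (intro bexI[of _ f]) simp_all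
    next
      case 2
      show ?thesis
        unfolding 2 using ac_deriv_L1[OF assms(1)] d Lp1_iff(1) by (intro bexI[of _ g]) blast+
    qed
  qed
  then show ?thesis
    unfolding sobolev_def using f Lp1_iff(1) by blast
qed

text \<open>Representatives of a function and its first i derivatives, fixed as one sequence. All
  entries below the last are absolutely continuous, so pointwise values and boundary terms make
  sense.\<close>

definition ac_chain :: "nat \<Rightarrow> (nat \<Rightarrow> real \<Rightarrow> complex) \<Rightarrow> bool" where
  "ac_chain i h \<longleftrightarrow> (\<forall>l<i. ac_deriv (h l) (h (Suc l))) \<and> L1 (h i)"

lemma ac_chain_L1: "ac_chain i h \<Longrightarrow> l \<le> i \<Longrightarrow> L1 (h l)"
  unfolding ac_chain_def by (metis ac_deriv_imp_L1 le_neq_implies_less)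

lemma ac_chain_continuous: "ac_chain i h \<Longrightarrow> l < i \<Longrightarrow> continuous_on {0..1} (h l)"
  unfolding ac_chain_def by (auto dest: ac_deriv_continuous)

lemma ac_chain_shift: "ac_chain i h \<Longrightarrow> k + j \<le> i \<Longrightarrow> ac_chain j (\<lambda>l. h (k + l))"
  using ac_chain_L1[of i h "k + j"] unfolding ac_chain_def by auto

lemma ac_chain_dist_deriv:
  assumes "ac_chain i h" "l \<le> i"
  shows "(dist_deriv ^^ l) (regular_dist (h 0)) = regular_dist (h l)"
  using assms(2)
proof (induction l)
  case (Suc l)
  then show ?case
    using assms(1) by (simp add: ac_chain_def ac_deriv_dist_deriv)
qed simp

text \<open>The bridge to the definitions: whatever function \<open>weak_deriv\<close> selects
  agrees almost everywhere with the entry of the chain.\<close>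

lemma ac_chain_weak_deriv:
  assumes "ac_chain i h" "l \<le> i" "AE x in unit_measure. f x = h 0 x"
  shows "AE x in unit_measure. weak_deriv l f x = h l x" "L1 (weak_deriv l f)"
    "regular_dist (weak_deriv l f) = regular_dist (h l)"
proof -
  have "L1 f"
    by (rule L1_AE_cong[OF ac_chain_L1[OF assms(1), of 0] AE_eq_sym[OF assms(3)]]) simp
  then have "weak_deriv l f = dist_fun (regular_dist (h l))"
    unfolding weak_deriv_def
    by (simp only: regular_dist_cong_AE[OF _ assms(3)] ac_chain_dist_deriv[OF assms(1,2)])
  then show "AE x in unit_measure. weak_deriv l f x = h l x" "L1 (weak_deriv l f)"
    "regular_dist (weak_deriv l f) = regular_dist (h l)"
    using dist_fun_regular[OF ac_chain_L1[OF assms(1,2)]] by simp_all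
qed

lemma ac_chain_leibniz:
  assumes "ac_chain i a" "\<And>p. continuous_on {0..1} (b p)" "\<And>p. ac_deriv (b p) (b (Suc p))"
  shows "ac_chain i (\<lambda>l x. leibniz l (\<lambda>p. a p x) (\<lambda>p. b p x))"
  unfolding ac_chain_def
proof (intro conjI allI impI)
  fix l assume l: "l < i"
  have "ac_deriv (\<lambda>x. leibniz l (\<lambda>p. a p x) (\<lambda>p. b p x))
    (\<lambda>x. \<Sum>p\<le>l. (of_nat (l choose p) * a (Suc p) x) * b (l - p) x + (of_nat (l choose p) * a p x) * b (Suc (l - p)) x)"
    unfolding leibniz_def
    by (rule ac_deriv_sum, rule ac_deriv_mult, rule ac_deriv_cmult)
      (use assms l in \<open>auto simp: ac_chain_def\<close>)
  then show "ac_deriv (\<lambda>x. leibniz l (\<lambda>p. a p x) (\<lambda>p. b p x)) (\<lambda>x. leibniz (Suc l) (\<lambda>p. a p x) (\<lambda>p. b p x))"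
    by (simp add: leibniz_Suc) (simp add: leibniz_def sum.distrib)
next
  have "L1 (\<lambda>x. a p x * b (i - p) x)" if "p \<le> i" for p
    by (rule L1_mult_continuous[OF ac_chain_L1[OF assms(1) that] assms(2)])
  then show "L1 (\<lambda>x. leibniz i (\<lambda>p. a p x) (\<lambda>p. b p x))"
    unfolding leibniz_def mult.assoc by (intro Bochner_Integration.integrable_sum integrable_mult_right) auto
qed

lemma ac_chain_leibniz_smooth:
  assumes "ac_chain i a" "smooth z"
  shows "ac_chain i (\<lambda>l x. leibniz l (\<lambda>p. a p x) (\<lambda>p. nderiv (k + p) z x))"
proof (rule ac_chain_leibniz[OF assms(1)])
  show "continuous_on {0..1} (nderiv (k + p) z)" for p
    by (intro smooth_continuous smooth_nderiv assms(2))
  show "ac_deriv (nderiv (k + p) z) (nderiv (k + Suc p) z)" for p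
    using smooth_ac_deriv[OF assms(2), of "k + p"] by simp
qed

lemma ac_chain_diff: "ac_chain i g \<Longrightarrow> ac_chain i h \<Longrightarrow> ac_chain i (\<lambda>l x. g l x - h l x)"
  unfolding ac_chain_def by (auto intro: ac_deriv_diff)

text \<open>The induction replaces \<open>u 0\<close> by a primitive, which shifts all orders down by one; no mollification of
  \<open>h\<close> is needed.\<close>

lemma functional_vanishes_on_ac_chain:
  assumes "\<And>j. j \<le> i \<Longrightarrow> L1 (u j)"
    and "\<And>z. z \<in> test_functions \<Longrightarrow> (\<Sum>j\<le>i. \<integral>x. u j x * nderiv j z x \<partial>unit_measure) = 0"
    and "ac_chain i h" "\<And>l. l < i \<Longrightarrow> h l 0 = 0 \<and> h l 1 = 0"
    and "L1 (\<lambda>x. u i x * h i x)"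
  shows "(\<Sum>j\<le>i. \<integral>x. u j x * h j x \<partial>unit_measure) = 0"
  using assms
proof (induction i arbitrary: u h)
  case 0
  have "AE x in unit_measure. u 0 x = 0"
    by (rule AE_0_if_orthogonal_to_test) (use 0(1,2) in auto)
  then have "AE x in unit_measure. u 0 x * h 0 x = 0" by eventually_elim simp
  from integral_cong_L1_AE[OF 0(5) this] show ?case by simp
next
  case (Suc i)
  define V where "V = prim (u 0)"
  have V: "ac_deriv V (u 0)"
    using ac_deriv_prim[of "u 0" 0] Suc.prems(1)[of 0] by (simp add: V_def)
  have LV: "L1 V" using V by (rule ac_deriv_imp_L1)
  \<comment> \<open>Since V' = u 0, integration by parts trades u 0 z for - V z'. Every term then
    contains a derivative of z, so the functional of the hypothesis is T applied to z'.\<close>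
  define u' where "u' j x = u (Suc j) x - (if j = 0 then V x else 0)" for j x
  have L': "L1 (u' j)" if "j \<le> i" for j
    unfolding u'_def using Suc.prems(1)[of "Suc j"] that LV by (cases "j = 0") auto
  define T where "T z = (\<Sum>j\<le>i. \<integral>x. u' j x * nderiv j z x \<partial>unit_measure)" for z
  have Tu: "T z = (\<Sum>j\<le>i. \<integral>x. u (Suc j) x * nderiv j z x \<partial>unit_measure) - (\<integral>x. V x * z x \<partial>unit_measure)"
    if z: "z \<in> test_functions" for z
  proof -
    have "(\<integral>x. u' j x * nderiv j z x \<partial>unit_measure) = (\<integral>x. u (Suc j) x * nderiv j z x \<partial>unit_measure)
        - (if j = 0 then \<integral>x. V x * z x \<partial>unit_measure else 0)" if "j \<le> i" for j
      unfolding u'_def using L1_mult_test[OF Suc.prems(1)[of "Suc j"] test_nderiv[OF z, of j]] that L1_mult_test[OF LV z]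
      by (cases "j = 0") (simp_all add: left_diff_distrib)
    then have "T z = (\<Sum>j\<le>i. (\<integral>x. u (Suc j) x * nderiv j z x \<partial>unit_measure) - (if j = 0 then \<integral>x. V x * z x \<partial>unit_measure else 0))"
      unfolding T_def by (intro sum.cong) auto
    then show ?thesis by (simp add: sum_subtractf)
  qed
  have "T (nderiv 1 z) = 0" if z: "z \<in> test_functions" for z
  proof -
    have "T (nderiv 1 z) = (\<Sum>j\<le>i. \<integral>x. u (Suc j) x * nderiv (Suc j) z x \<partial>unit_measure) + (\<integral>x. u 0 x * z x \<partial>unit_measure)"
      using Tu[OF test_nderiv[OF z]] integral_mult_test_by_parts[OF V z] by (simp add: nderiv_nderiv)
    also have "\<dots> = (\<Sum>j\<le>Suc i. \<integral>x. u j x * nderiv j z x \<partial>unit_measure)"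
      by (subst sum.atMost_Suc_shift) simp
    finally show ?thesis using Suc.prems(2)[OF z] by simp
  qed
  moreover have "test_linear T"
  proof -
    have "test_linear (\<lambda>z. \<Sum>j\<le>i. regular_dist (u' j) (nderiv j z))"
      by (intro test_linear_sum test_linear_comp_nderiv test_linear_regular L') auto
    then show ?thesis
      unfolding test_linear_def T_def by (simp add: regular_dist_test test_nderiv test_add test_cmult)
  qed
  ultimately obtain c where c: "\<And>z. z \<in> test_functions \<Longrightarrow> T z = (\<integral>x. c * z x \<partial>unit_measure)"
    using constant_if_kills_derivatives by blast
  \<comment> \<open>T is integration against c, so moving c into the zeroth coefficient makes the
    functional vanish: v satisfies the hypothesis one order lower. It is tested with the shifted
    chain, and h 0 returns by parts, its boundary values being zero.\<close>
  define v where "v j x = u (Suc j) x - (if j = 0 then V x + c else 0)" for j x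
  have Vc: "ac_deriv (\<lambda>x. V x + c) (u 0)"
    using ac_deriv_add[OF V ac_deriv_const[of c]] by simp
  have LVc: "L1 (\<lambda>x. V x + c)" using Vc by (rule ac_deriv_imp_L1)
  have split: "(\<integral>x. v j x * g x \<partial>unit_measure) = (\<integral>x. u (Suc j) x * g x \<partial>unit_measure)
      - (if j = 0 then \<integral>x. (V x + c) * g x \<partial>unit_measure else 0)"
    "L1 (\<lambda>x. v j x * g x)" if "L1 (\<lambda>x. u (Suc j) x * g x)" "L1 g" for j g
  proof -
    have "L1 (\<lambda>x. (V x + c) * g x)"
      using ac_deriv_continuous[OF Vc] that(2) by (rule continuous_mult_L1)
    with that show "(\<integral>x. v j x * g x \<partial>unit_measure) = (\<integral>x. u (Suc j) x * g x \<partial>unit_measure)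
      - (if j = 0 then \<integral>x. (V x + c) * g x \<partial>unit_measure else 0)" "L1 (\<lambda>x. v j x * g x)"
      unfolding v_def left_diff_distrib by (cases "j = 0"; simp)+
  qed
  have h': "ac_chain i (\<lambda>l. h (Suc l))"
    using ac_chain_shift[OF Suc.prems(3), of 1 i] by simp
  have uh: "L1 (\<lambda>x. u (Suc j) x * h (Suc j) x)" if "j \<le> i" for j
  proof (cases "j = i")
    case False
    then show ?thesis
      using that by (intro L1_mult_continuous Suc.prems(1) ac_chain_continuous[OF Suc.prems(3)]) auto
  qed (use Suc.prems(5) in simp)
  have "(\<Sum>j\<le>i. \<integral>x. v j x * h (Suc j) x \<partial>unit_measure) = 0"
  proof (rule Suc.IH)
    show "L1 (v j)" if "j \<le> i" for j
      unfolding v_def using Suc.prems(1)[of "Suc j"] that LVc by (cases "j = 0") auto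
    show "(\<Sum>j\<le>i. \<integral>x. v j x * nderiv j z x \<partial>unit_measure) = 0" if z: "z \<in> test_functions" for z
    proof -
      have L: "L1 (\<lambda>x. u (Suc j) x * nderiv j z x)" if "j \<le> i" for j
        using that by (intro L1_mult_test Suc.prems(1) test_nderiv z) auto
      have "(\<Sum>j\<le>i. \<integral>x. v j x * nderiv j z x \<partial>unit_measure) =
        (\<Sum>j\<le>i. (\<integral>x. u (Suc j) x * nderiv j z x \<partial>unit_measure) - (if j = 0 then \<integral>x. (V x + c) * z x \<partial>unit_measure else 0))"
        by (intro sum.cong refl) (use z in \<open>auto simp: split[OF L continuous_imp_L1[OF test_continuous[OF test_nderiv]]]\<close>)
      also have "\<dots> = T z - (\<integral>x. c * z x \<partial>unit_measure)"
        using L1_mult_test[OF LV z] L1_mult_test[OF L1_const z, of c]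
        by (simp add: sum_subtractf Tu[OF z] distrib_right)
      finally show ?thesis using c[OF z] by simp
    qed
    show "ac_chain i (\<lambda>l. h (Suc l))" by (rule h')
    show "h (Suc l) 0 = 0 \<and> h (Suc l) 1 = 0" if "l < i" for l
      using Suc.prems(4)[of "Suc l"] that by simp
    show "L1 (\<lambda>x. v i x * h (Suc i) x)"
      using split(2)[OF uh] ac_chain_L1[OF h', of i] by simp
  qed
  also have "(\<Sum>j\<le>i. \<integral>x. v j x * h (Suc j) x \<partial>unit_measure) =
    (\<Sum>j\<le>i. (\<integral>x. u (Suc j) x * h (Suc j) x \<partial>unit_measure) - (if j = 0 then \<integral>x. (V x + c) * h (Suc 0) x \<partial>unit_measure else 0))"
    by (intro sum.cong refl) (auto simp: split[OF uh ac_chain_L1[OF h']])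
  also have "\<dots> = (\<Sum>j\<le>i. \<integral>x. u (Suc j) x * h (Suc j) x \<partial>unit_measure) - (\<integral>x. (V x + c) * h 1 x \<partial>unit_measure)"
    by (simp add: sum_subtractf)
  also have "(\<integral>x. (V x + c) * h 1 x \<partial>unit_measure) = - (\<integral>x. u 0 x * h 0 x \<partial>unit_measure)"
  proof -
    have "ac_deriv (h 0) (h 1)" using Suc.prems(3) by (auto simp: ac_chain_def)
    from ac_deriv_by_parts[OF Vc this] Suc.prems(4)[of 0]
    show ?thesis by (simp add: eq_neg_iff_add_eq_0 add.commute)
  qed
  finally show ?case
    by (subst sum.atMost_Suc_shift) (simp add: add.commute)
qed

subsection \<open>Antiderivatives of distributions\<close>

lemma SUP_norm_nonneg:
  assumes "continuous_on {0..1} (f :: real \<Rightarrow> complex)"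
  shows "0 \<le> (SUP x\<in>{0..1}. norm (f x))"
    "\<And>x. x \<in> {0..1} \<Longrightarrow> norm (f x) \<le> (SUP x\<in>{0..1}. norm (f x))"
proof -
  obtain B where "\<And>x. x \<in> {0..1} \<Longrightarrow> norm (f x) \<le> B"
    using continuous_unit_bounded[OF assms] by blast
  then have bdd: "bdd_above ((\<lambda>x. norm (f x)) ` {0..1})"
    by (intro bdd_aboveI2)
  show 1: "norm (f x) \<le> (SUP x\<in>{0..1}. norm (f x))" if "x \<in> {0..1}" for x
    using bdd that by (intro cSUP_upper)
  show "0 \<le> (SUP x\<in>{0..1}. norm (f x))"
    by (rule order_trans[OF norm_ge_zero 1[of 0]]) simp
qed

lemma regular_dist_distributions:
  assumes "L1 f"
  shows "regular_dist f \<in> distributions"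
proof -
  have "norm (regular_dist f z) \<le> (\<integral>x. norm (f x) \<partial>unit_measure) * (\<Sum>k\<le>0. SUP x\<in>{0..1}. norm (nderiv k z x))"
    if z: "z \<in> test_functions" for z
  proof -
    have "norm (regular_dist f z) \<le> (\<integral>x. norm (f x * z x) \<partial>unit_measure)"
      unfolding regular_dist_test[OF z] by (rule integral_norm_bound)
    also have "\<dots> \<le> (\<integral>x. norm (f x) * (SUP x\<in>{0..1}. norm (z x)) \<partial>unit_measure)"
    proof (rule integral_mono)
      show "norm (f x * z x) \<le> norm (f x) * (SUP x\<in>{0..1}. norm (z x))" if "x \<in> space unit_measure" for x
        using SUP_norm_nonneg(2)[OF test_continuous[OF z], of x] that by (auto simp: norm_mult intro: mult_left_mono)
    qed (use L1_mult_test[OF assms z] assms in auto)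
    finally show ?thesis by simp
  qed
  then show ?thesis
    unfolding distributions_def
    using test_linear_regular[OF assms, unfolded test_linear_def] regular_dist_off_test by blast
qed

lemma dist_deriv_distributions:
  assumes "T \<in> distributions"
  shows "dist_deriv T \<in> distributions"
proof -
  have lin: "test_linear T"
    using assms by (simp add: distributions_def test_linear_def)
  have bound: "\<forall>K. compact K \<and> K \<subseteq> {0<..<1} \<longrightarrow>
        (\<exists>C N. \<forall>z\<in>test_functions. {x. z x \<noteq> 0} \<subseteq> K \<longrightarrow>
           norm (T z) \<le> C * (\<Sum>k\<le>N. SUP x\<in>{0..1}. norm (nderiv k z x)))"
    using assms unfolding distributions_def by (elim CollectE conjE)
  have "\<exists>C N. \<forall>z\<in>test_functions. {x. z x \<noteq> 0} \<subseteq> K \<longrightarrow>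
      norm (dist_deriv T z) \<le> C * (\<Sum>k\<le>N. SUP x\<in>{0..1}. norm (nderiv k z x))"
    if K: "compact K" "K \<subseteq> {0<..<1}" for K
  proof -
    obtain C N where CN: "\<And>z. z \<in> test_functions \<Longrightarrow> {x. z x \<noteq> 0} \<subseteq> K \<Longrightarrow>
        norm (T z) \<le> C * (\<Sum>k\<le>N. SUP x\<in>{0..1}. norm (nderiv k z x))"
      using bound K by meson
    \<comment> \<open>The bound needs one more derivative. The absolute value is taken because C may
      be negative, and then enlarging the sum would lower the bound.\<close>
    have "norm (dist_deriv T z) \<le> \<bar>C\<bar> * (\<Sum>k\<le>Suc N. SUP x\<in>{0..1}. norm (nderiv k z x))"
      if z: "z \<in> test_functions" and s: "{x. z x \<noteq> 0} \<subseteq> K" for z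
    proof -
      let ?S = "\<lambda>k. SUP x\<in>{0..1}. norm (nderiv k z x)"
      have S: "0 \<le> ?S k" for k
        by (rule SUP_norm_nonneg(1)[OF test_continuous[OF test_nderiv[OF z]]])
      have "nderiv 1 z x = 0" if "x \<notin> K" for x
      proof -
        have "((\<lambda>x. 0) has_vector_derivative 0) (at x)" by simp
        then have "(z has_vector_derivative 0) (at x)"
          by (rule has_vector_derivative_transform_within_open[where S = "- K"])
            (use s K(1) that in \<open>auto simp: compact_imp_closed open_Compl\<close>)
        then show ?thesis by (simp add: nderiv_Suc vector_derivative_at)
      qed
      then have "{x. nderiv 1 z x \<noteq> 0} \<subseteq> K" by blast
      from CN[OF test_nderiv[OF z] this]
      have "norm (dist_deriv T z) \<le> C * (\<Sum>k\<le>N. ?S (Suc k))"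
        using z by (simp add: dist_deriv_def nderiv_nderiv)
      also have "\<dots> \<le> \<bar>C\<bar> * (\<Sum>k\<le>N. ?S (Suc k))"
        by (intro mult_right_mono sum_nonneg S) auto
      also have "\<dots> \<le> \<bar>C\<bar> * (\<Sum>k\<le>Suc N. ?S k)"
        using S[of 0] by (intro mult_left_mono, subst sum.atMost_Suc_shift) auto
      finally show ?thesis .
    qed
    then show ?thesis by blast
  qed
  moreover have "dist_deriv T z = 0" if "z \<notin> test_functions" for z
    using that by (simp add: dist_deriv_def)
  ultimately show ?thesis
    unfolding distributions_def mem_Collect_eq test_linear_def[symmetric]
    by (intro conjI allI impI test_linear_dist_deriv[OF lin]) simp_all
qed

lemma dist_deriv_pow_distributions: "T \<in> distributions \<Longrightarrow> (dist_deriv ^^ i) T \<in> distributions"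
  by (induction i) (auto intro: dist_deriv_distributions)

text \<open>One integration already makes an L1 function continuous, hence square integrable. This
  is why parameters below the top index may be merely integrable.\<close>

lemma L2_antiderivative:
  assumes "L1 t" "i > 0"
  obtains s where "s \<in> Lp 2" "(dist_deriv ^^ i) (regular_dist s) = regular_dist t"
proof -
  have "\<exists>s. s \<in> Lp 2 \<and> (dist_deriv ^^ Suc i) (regular_dist s) = regular_dist t" for i
    using assms(1)
  proof (induction i arbitrary: t)
    case (0 t)
    have "ac_deriv (prim t) t" using ac_deriv_prim[OF 0, of 0] by simp
    then show ?case
      using continuous_imp_Lp2[OF continuous_prim[OF 0]] ac_deriv_dist_deriv by auto
  next
    case (Suc i t)
    have F: "ac_deriv (prim t) t" using ac_deriv_prim[OF Suc.prems, of 0] by simp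
    obtain s where s: "s \<in> Lp 2" "(dist_deriv ^^ Suc i) (regular_dist s) = regular_dist (prim t)"
      using Suc.IH[OF ac_deriv_imp_L1[OF F]] by blast
    have "(dist_deriv ^^ Suc (Suc i)) (regular_dist s) = dist_deriv ((dist_deriv ^^ Suc i) (regular_dist s))"
      by simp
    also have "\<dots> = regular_dist t" unfolding s(2) by (rule ac_deriv_dist_deriv[OF F])
    finally show ?case using s(1) by blast
  qed
  then show ?thesis
    using that assms(2) by (metis gr0_implies_Suc)
qed

section \<open>Distributions whose i-th derivative vanishes\<close>

lemma has_vector_derivative_of_real_power:
  "((\<lambda>x. complex_of_real x ^ Suc j) has_vector_derivative of_nat (Suc j) * complex_of_real x ^ j) (at x)"
proof -
  have "((\<lambda>x. x ^ Suc j) has_real_derivative real (Suc j) * x ^ j) (at x)"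
    by (rule DERIV_cong[OF DERIV_power[OF DERIV_ident]]) simp
  from has_vector_derivative_of_real[OF this, where ?'a = complex]
  show ?thesis by simp
qed

text \<open>Induction over \<open>constant_if_kills_derivatives\<close>: the derivative of T is a
  polynomial, and removing an antiderivative of it leaves a constant.\<close>

lemma polynomial_if_derivative_0:
  assumes "test_linear T" "\<And>z. z \<in> test_functions \<Longrightarrow> T (nderiv i z) = 0"
  obtains c where "\<And>z. z \<in> test_functions \<Longrightarrow>
    T z = regular_dist (\<lambda>x. \<Sum>j<i. c j * complex_of_real x ^ j) z"
proof -
  have "\<exists>c. \<forall>z\<in>test_functions. T z = regular_dist (\<lambda>x. \<Sum>j<i. c j * complex_of_real x ^ j) z"
    using assms
  proof (induction i arbitrary: T)
    case 0
    then show ?case by (simp add: regular_dist_def)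
  next
    case (Suc i)
    have "test_linear (\<lambda>z. T (nderiv 1 z))"
      by (rule test_linear_comp_nderiv[OF Suc.prems(1)])
    moreover have "T (nderiv 1 (nderiv i z)) = 0" if "z \<in> test_functions" for z
      using Suc.prems(2)[OF that] by (simp add: nderiv_nderiv)
    ultimately obtain c where c: "\<And>z. z \<in> test_functions \<Longrightarrow>
        T (nderiv 1 z) = regular_dist (\<lambda>x. \<Sum>j<i. c j * complex_of_real x ^ j) z"
      using Suc.IH[of "\<lambda>z. T (nderiv 1 z)"] by blast
    let ?p = "\<lambda>x. \<Sum>j<i. c j * complex_of_real x ^ j"
    \<comment> \<open>The sign comes from duality: z \<mapsto> T z' is integration against p, so the
      distributional derivative of T is - p, and P is its antiderivative vanishing at 0.\<close>
    let ?P = "\<lambda>x. \<Sum>j<i. (- c j / of_nat (Suc j)) * complex_of_real x ^ Suc j"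
    have "(?P has_vector_derivative - ?p x) (at x)" for x
    proof -
      have "(?P has_vector_derivative (\<Sum>j<i. (- c j / of_nat (Suc j)) * (of_nat (Suc j) * complex_of_real x ^ j))) (at x)"
        by (intro has_vector_derivative_sum has_vector_derivative_mult_right has_vector_derivative_of_real_power)
      then show ?thesis by (simp add: sum_negf del: of_nat_Suc)
    qed
    then have P: "ac_deriv ?P (\<lambda>x. - ?p x)"
      by (intro C1_imp_ac_deriv) (auto intro!: continuous_intros intro: has_vector_derivative_at_within)
    have LP: "L1 ?P" and Lp: "L1 ?p"
      by (intro continuous_imp_L1 continuous_intros)+
    define S where "S z = T z - regular_dist ?P z" for z
    have "test_linear S"
      using test_linear_add[OF Suc.prems(1) test_linear_scale[OF test_linear_regular[OF LP], of "- 1"]]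
      by (simp add: S_def[abs_def])
    moreover have "S (nderiv 1 z) = 0" if z: "z \<in> test_functions" for z
      using c[OF z] integral_mult_test_by_parts[OF P z] z
      by (simp add: S_def regular_dist_test test_nderiv)
    ultimately obtain d where d: "\<And>z. z \<in> test_functions \<Longrightarrow> S z = (\<integral>x. d * z x \<partial>unit_measure)"
      using constant_if_kills_derivatives by blast
    define c' where "c' j = (case j of 0 \<Rightarrow> d | Suc j \<Rightarrow> - c j / of_nat (Suc j))" for j
    have eq: "(\<lambda>x. \<Sum>j<Suc i. c' j * complex_of_real x ^ j) = (\<lambda>x. d + ?P x)"
      by (rule ext, subst sum.lessThan_Suc_shift) (simp add: c'_def)
    have "T z = regular_dist (\<lambda>x. \<Sum>j<Suc i. c' j * complex_of_real x ^ j) z" if z: "z \<in> test_functions" for z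
      unfolding eq using d[OF z] regular_dist_add[OF L1_const LP, of d z]
      by (simp add: S_def regular_dist_test[OF z] algebra_simps)
    then show ?case by blast
  qed
  then show ?thesis using that by blast
qed

lemma distributions_test_linear: "T \<in> distributions \<Longrightarrow> test_linear T"
  by (simp add: distributions_def test_linear_def)

lemma distributions_off_test: "T \<in> distributions \<Longrightarrow> z \<notin> test_functions \<Longrightarrow> T z = 0"
  by (simp add: distributions_def)

lemma L1_polynomial: "L1 (\<lambda>x. \<Sum>j<i. c j * complex_of_real x ^ j)"
  by (intro continuous_imp_L1 continuous_intros)

lemma polynomial_Lp2: "(\<lambda>x. \<Sum>j<i. c j * complex_of_real x ^ j) \<in> Lp 2"
  by (intro continuous_imp_Lp2 continuous_intros)

lemma regular_polynomial_nderiv: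
  assumes z: "z \<in> test_functions"
  shows "regular_dist (\<lambda>x. \<Sum>j<i. c j * complex_of_real x ^ j) (nderiv i z) = 0"
proof -
  have "regular_dist (\<lambda>x. complex_of_real x ^ j) (nderiv i z) = 0" if "j < i" "z \<in> test_functions" for j i z
    using that
  proof (induction j arbitrary: i z)
    case 0
    have "i = Suc (i - 1)" using 0 by simp
    then have "nderiv i z = nderiv 1 (nderiv (i - 1) z)" by (simp add: nderiv_nderiv)
    then show ?case
      using integral_mult_test_by_parts[OF ac_deriv_const[of 1] test_nderiv[OF 0(2), of "i - 1"]]
      by (simp add: regular_dist_def)
  next
    case (Suc j)
    have i: "nderiv i z = nderiv 1 (nderiv (i - 1) z)" using Suc.prems by (simp add: nderiv_nderiv)
    have P: "ac_deriv (\<lambda>x. complex_of_real x ^ Suc j) (\<lambda>x. of_nat (Suc j) * complex_of_real x ^ j)"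
      by (rule C1_imp_ac_deriv, rule has_vector_derivative_at_within, rule has_vector_derivative_of_real_power)
        (intro continuous_intros)
    have t: "nderiv (i - 1) z \<in> test_functions" using Suc.prems by (intro test_nderiv)
    have "regular_dist (\<lambda>x. complex_of_real x ^ j) (nderiv (i - 1) z) = 0"
      using Suc.IH[of "i - 1" z] Suc.prems by simp
    then have "(\<integral>x. of_nat (Suc j) * complex_of_real x ^ j * nderiv (i - 1) z x \<partial>unit_measure) = 0"
      using t by (simp add: regular_dist_def mult.assoc)
    then show ?case
      using integral_mult_test_by_parts[OF P t] Suc.prems test_nderiv[OF t, of 1]
      unfolding i by (simp only: regular_dist_test minus_zero)
  qed
  then have "(\<Sum>j<i. regular_dist (\<lambda>x. c j * complex_of_real x ^ j) (nderiv i z)) = 0"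
    using z by (intro sum.neutral) (simp add: regular_dist_cmult)
  then show ?thesis
    by (subst regular_dist_sum) (auto intro!: continuous_imp_L1 continuous_intros)
qed

text \<open>Up to sign, \<open>top_coeff\<close> is the \<open>i\<close>-th order antiderivative of the following functional.\<close>

definition remainder :: "nat \<Rightarrow> functional \<Rightarrow> (nat \<Rightarrow> real \<Rightarrow> complex) \<Rightarrow> functional" where
  "remainder i \<tau> t = (\<lambda>w. \<tau> w - (\<Sum>j<i. (-1) ^ j * (dist_deriv ^^ j) (regular_dist (t j)) w))"

lemma remainder_test:
  assumes "z \<in> test_functions"
  shows "remainder i \<tau> t z = \<tau> z - (\<Sum>j<i. \<integral>x. t j x * nderiv j z x \<partial>unit_measure)"
proof -
  have "(-1) ^ j * (dist_deriv ^^ j) (regular_dist (t j)) z = (\<integral>x. t j x * nderiv j z x \<partial>unit_measure)" for j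
    by (simp add: dist_deriv_pow_test[OF assms] regular_dist_test test_nderiv assms flip: power_add mult.assoc)
  then show ?thesis by (simp add: remainder_def)
qed

text \<open>Each t j with j < i is itself a derivative of order i - j of an L2 function, so all
  terms of the remainder are i-th derivatives of L2 functions.\<close>

lemma remainder_antiderivative:
  assumes "\<tau> \<in> neg_sobolev i" "\<And>j. j < i \<Longrightarrow> L1 (t j)"
  obtains S where "S \<in> Lp 2" "remainder i \<tau> t = (dist_deriv ^^ i) (regular_dist S)"
proof -
  obtain \<sigma> where \<sigma>: "\<sigma> \<in> Lp 2" "\<tau> = (dist_deriv ^^ i) (regular_dist \<sigma>)"
    using assms(1) by (auto simp: neg_sobolev_def)
  have "\<exists>s. s \<in> Lp 2 \<and> (dist_deriv ^^ (i - j)) (regular_dist s) = regular_dist (t j)" if "j < i" for j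
    using L2_antiderivative[OF assms(2)[OF that], of "i - j"] that by (metis zero_less_diff)
  then obtain s where s: "\<And>j. j < i \<Longrightarrow> s j \<in> Lp 2"
    "\<And>j. j < i \<Longrightarrow> (dist_deriv ^^ (i - j)) (regular_dist (s j)) = regular_dist (t j)"
    by metis
  let ?S = "\<lambda>x. \<sigma> x - (\<Sum>j<i. (-1) ^ j * s j x)"
  have L: "L1 \<sigma>" "\<And>j. j < i \<Longrightarrow> L1 (s j)" using \<sigma> s Lp2_imp_L1 by auto
  have "?S \<in> Lp 2"
    using \<sigma> s by (intro Lp2_diff Lp2_sum Lp2_cmult) auto
  moreover have "remainder i \<tau> t z = (dist_deriv ^^ i) (regular_dist ?S) z" for z
  proof (cases "z \<in> test_functions")
    case True
    have "regular_dist ?S (nderiv i z) = regular_dist \<sigma> (nderiv i z) + regular_dist (\<lambda>x. \<Sum>j<i. (- ((-1) ^ j)) * s j x) (nderiv i z)"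
      by (subst regular_dist_add[symmetric]) (use L in \<open>auto simp: sum_negf\<close>)
    also have "\<dots> = regular_dist \<sigma> (nderiv i z) - (\<Sum>j<i. (-1) ^ j * regular_dist (s j) (nderiv i z))"
      by (subst regular_dist_sum, use L in simp, simp only: regular_dist_cmult) (simp add: sum_negf)
    finally have 1: "regular_dist ?S (nderiv i z) = \<dots>" .
    have 2: "(-1) ^ j * regular_dist (s j) (nderiv i z) = (-1) ^ i * ((-1) ^ j * (dist_deriv ^^ j) (regular_dist (t j)) z)"
      if j: "j < i" for j
    proof -
      have "(-1) ^ j * (dist_deriv ^^ j) (regular_dist (t j)) z = regular_dist (t j) (nderiv j z)"
        by (simp add: dist_deriv_pow_test[OF True] flip: power_add mult.assoc)
      also have "\<dots> = (-1) ^ (i - j) * regular_dist (s j) (nderiv i z)"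
        unfolding s(2)[OF j, symmetric] using j
        by (simp add: dist_deriv_pow_test[OF test_nderiv[OF True]] nderiv_nderiv)
      finally have "(-1) ^ i * ((-1) ^ j * (dist_deriv ^^ j) (regular_dist (t j)) z) =
          (-1) ^ (i + (i - j)) * regular_dist (s j) (nderiv i z)"
        by (simp add: power_add)
      moreover have "(-1) ^ (i + (i - j)) = ((-1) ^ j :: complex)"
        using j by (auto simp: minus_one_power_iff)
      ultimately show ?thesis by simp
    qed
    have "(dist_deriv ^^ i) (regular_dist ?S) z = (-1) ^ i * (regular_dist \<sigma> (nderiv i z)
       - (-1) ^ i * (\<Sum>j<i. (-1) ^ j * (dist_deriv ^^ j) (regular_dist (t j)) z))"
    proof -
      have "(\<Sum>j<i. (-1) ^ j * regular_dist (s j) (nderiv i z)) =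
          (-1) ^ i * (\<Sum>j<i. (-1) ^ j * (dist_deriv ^^ j) (regular_dist (t j)) z)"
        unfolding sum_distrib_left by (rule sum.cong[OF refl], rule 2) simp
      then show ?thesis
        unfolding dist_deriv_pow_test[OF True, of i "regular_dist ?S"] 1 by (simp only:)
    qed
    also have "\<dots> = remainder i \<tau> t z"
      unfolding remainder_def \<sigma>(2) dist_deriv_pow_test[OF True, of i]
      by (simp add: right_diff_distrib flip: power_add mult.assoc)
    finally show ?thesis by simp
  next
    case False
    then show ?thesis
      by (simp add: remainder_def \<sigma>(2) dist_deriv_pow_off_test regular_dist_off_test)
  qed
  ultimately show ?thesis using that by blast
qed

lemma top_coeff_remainder:
  "top_coeff A i \<tau> t c z = (-1) ^ i * A i (remainder i \<tau> t) z
     + regular_dist (\<lambda>x. \<Sum>j<i. c j * complex_of_real x ^ j) z"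
  by (simp add: top_coeff_def remainder_def)

lemma remainder_distributions:
  assumes "\<tau> \<in> neg_sobolev i" "\<And>j. j < i \<Longrightarrow> L1 (t j)"
  shows "remainder i \<tau> t \<in> distributions"
proof -
  obtain S where "S \<in> Lp 2" "remainder i \<tau> t = (dist_deriv ^^ i) (regular_dist S)"
    using remainder_antiderivative[OF assms(1), of t] assms(2) by blast
  then show ?thesis
    by (simp add: dist_deriv_pow_distributions regular_dist_distributions Lp2_imp_L1)
qed

text \<open>Whatever antiderivative A selects, it differs from the square integrable one by a
  polynomial of degree below i, and so does the choice of c. The last conclusion expresses \<tau>
  through the whole family of parameters.\<close>

lemma top_coeff_L2:
  assumes A: "antiderivative_choice A" and "\<tau> \<in> neg_sobolev i" "\<And>j. j < i \<Longrightarrow> L1 (t j)"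
  obtains s where "s \<in> Lp 2" "top_coeff A i \<tau> t c = regular_dist s"
    "\<And>z. z \<in> test_functions \<Longrightarrow> \<tau> z = (\<Sum>j<i. \<integral>x. t j x * nderiv j z x \<partial>unit_measure)
       + (\<integral>x. s x * nderiv i z x \<partial>unit_measure)"
proof -
  let ?R = "remainder i \<tau> t"
  let ?p = "\<lambda>c x. \<Sum>j<i. c j * complex_of_real x ^ j"
  have "?R \<in> distributions" using assms(2,3) by (rule remainder_distributions)
  then have AR: "A i ?R \<in> distributions" "(dist_deriv ^^ i) (A i ?R) = ?R"
    using A by (auto simp: antiderivative_choice_def)
  obtain S where S: "S \<in> Lp 2" "?R = (dist_deriv ^^ i) (regular_dist S)"
    using remainder_antiderivative[OF assms(2), of t] assms(3) by blast
  have LS: "L1 S" using S(1) by (rule Lp2_imp_L1)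
  have eqi: "A i ?R (nderiv i z) = regular_dist S (nderiv i z)" if z: "z \<in> test_functions" for z
    using fun_cong[OF AR(2), of z] fun_cong[OF S(2), of z] by (simp add: dist_deriv_pow_test[OF z])
  have "test_linear (\<lambda>z. A i ?R z + (- 1) * regular_dist S z)"
    using AR(1) LS by (intro test_linear_add test_linear_scale distributions_test_linear test_linear_regular)
  then obtain d where d: "\<And>z. z \<in> test_functions \<Longrightarrow> A i ?R z + (- 1) * regular_dist S z = regular_dist (?p d) z"
    using polynomial_if_derivative_0[of "\<lambda>z. A i ?R z + (- 1) * regular_dist S z" i] eqi by force
  define s where "s x = (-1) ^ i * (S x + ?p d x) + ?p c x" for x
  have s: "s \<in> Lp 2"
    unfolding s_def using S(1) by (intro Lp2_add Lp2_cmult polynomial_Lp2)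
  have L: "L1 (\<lambda>x. (-1) ^ i * (S x + ?p d x))" using LS L1_polynomial by auto
  have sz: "regular_dist s z = (-1) ^ i * (regular_dist S z + regular_dist (?p d) z) + regular_dist (?p c) z" for z
    unfolding s_def by (simp only: regular_dist_add[OF L L1_polynomial] regular_dist_cmult regular_dist_add[OF LS L1_polynomial])
  have "top_coeff A i \<tau> t c z = regular_dist s z" for z
  proof (cases "z \<in> test_functions")
    case True
    have "A i ?R z = regular_dist S z + regular_dist (?p d) z" using d[OF True] by (simp add: algebra_simps)
    then show ?thesis by (simp only: top_coeff_remainder sz)
  next
    case False
    then show ?thesis
      by (simp add: top_coeff_remainder regular_dist_off_test distributions_off_test[OF AR(1)])
  qed
  moreover have "\<tau> z = (\<Sum>j<i. \<integral>x. t j x * nderiv j z x \<partial>unit_measure) + (\<integral>x. s x * nderiv i z x \<partial>unit_measure)"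
    if z: "z \<in> test_functions" for z
  proof -
    have "(\<integral>x. s x * nderiv i z x \<partial>unit_measure) = regular_dist s (nderiv i z)"
      using z by (simp add: regular_dist_test test_nderiv)
    \<comment> \<open>Both polynomial parts, the one hidden in A and the one given by c, vanish
      against the i-th derivative of z.\<close>
    also have "\<dots> = (-1) ^ i * regular_dist S (nderiv i z)"
      by (simp add: sz regular_polynomial_nderiv[OF z])
    also have "\<dots> = ?R z" by (simp add: S(2) dist_deriv_pow_test[OF z])
    finally show ?thesis by (simp add: remainder_test[OF z])
  qed
  ultimately show ?thesis using that s by blast
qed

text \<open>Two solutions s and r of the same representation of \<tau> have equal i-th derivatives,
  so they differ by a polynomial of degree below i. Taking r with c = 0, its coefficients are the
  required c.\<close>

lemma top_coeff_surjective:
  assumes A: "antiderivative_choice A" and \<tau>: "\<tau> \<in> neg_sobolev i" and t: "\<And>j. j < i \<Longrightarrow> L1 (t j)"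
    and s: "s \<in> Lp 2" and eq: "\<And>z. z \<in> test_functions \<Longrightarrow> \<tau> z = (\<Sum>j<i. \<integral>x. t j x * nderiv j z x \<partial>unit_measure)
       + (\<integral>x. s x * nderiv i z x \<partial>unit_measure)"
  obtains c where "top_coeff A i \<tau> t c = regular_dist s"
proof -
  obtain r where r: "r \<in> Lp 2" "top_coeff A i \<tau> t (\<lambda>_. 0) = regular_dist r"
    "\<And>z. z \<in> test_functions \<Longrightarrow> \<tau> z = (\<Sum>j<i. \<integral>x. t j x * nderiv j z x \<partial>unit_measure)
       + (\<integral>x. r x * nderiv i z x \<partial>unit_measure)"
    using top_coeff_L2[OF A \<tau>, of t] t by blast
  have L: "L1 s" "L1 r" using s r(1) Lp2_imp_L1 by auto
  have "test_linear (\<lambda>z. regular_dist s z + (- 1) * regular_dist r z)"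
    using L by (intro test_linear_add test_linear_scale test_linear_regular)
  moreover have "regular_dist s (nderiv i z) + (- 1) * regular_dist r (nderiv i z) = 0" if z: "z \<in> test_functions" for z
    using eq[OF z] r(3)[OF z] z by (simp add: regular_dist_test test_nderiv)
  ultimately obtain c where c: "\<And>z. z \<in> test_functions \<Longrightarrow>
      regular_dist s z + (- 1) * regular_dist r z = regular_dist (\<lambda>x. \<Sum>j<i. c j * complex_of_real x ^ j) z"
    using polynomial_if_derivative_0[of "\<lambda>z. regular_dist s z + (- 1) * regular_dist r z" i] by blast
  have "top_coeff A i \<tau> t c z = regular_dist s z" for z
  proof (cases "z \<in> test_functions")
    case True
    have "top_coeff A i \<tau> t c z = top_coeff A i \<tau> t (\<lambda>_. 0) z + regular_dist (\<lambda>x. \<Sum>j<i. c j * complex_of_real x ^ j) z"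
      by (simp add: top_coeff_remainder) (simp add: regular_dist_def)
    then show ?thesis using c[OF True] unfolding r(2) by (simp add: algebra_simps)
  next
    case False
    have "top_coeff A i \<tau> t c z = top_coeff A i \<tau> t (\<lambda>_. 0) z"
      by (simp add: top_coeff_remainder regular_dist_off_test[OF False])
    then show ?thesis unfolding r(2) by (simp add: regular_dist_off_test[OF False])
  qed
  then show ?thesis using that by blast
qed

subsection \<open>Linear systems with integrable coefficients\<close>

lemma integral_unit_reflect:
  assumes "L1 g"
  shows "L1 (\<lambda>x. g (1 - x))" "(\<integral>x. g (1 - x) \<partial>unit_measure) = (\<integral>x. g x \<partial>unit_measure)"
proof -
  have "has_bochner_integral lebesgue (\<lambda>x. indicator {0..1} x *\<^sub>R g x) (\<integral>x. g x \<partial>unit_measure)"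
    using has_bochner_integral_integrable[OF assms] by (subst (asm) has_bochner_integral_restrict_space) auto
  then have "has_bochner_integral lebesgue (\<lambda>x. indicator {0..1} (1 + (- 1) * x) *\<^sub>R g (1 + (- 1) * x))
      ((\<integral>x. g x \<partial>unit_measure) /\<^sub>R \<bar>- 1\<bar>)"
    by (subst (asm) has_bochner_integral_lebesgue_real_affine_iff[of "- 1" _ _ 1]) auto
  moreover have "indicator {0..1} (1 + (- 1) * x) = (indicator {0..1} x :: real)" for x :: real
    by (auto split: split_indicator)
  ultimately have "has_bochner_integral lebesgue (\<lambda>x. indicator {0..1} x *\<^sub>R g (1 - x)) (\<integral>x. g x \<partial>unit_measure)"
    by simp
  then have "has_bochner_integral unit_measure (\<lambda>x. g (1 - x)) (\<integral>x. g x \<partial>unit_measure)"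
    by (subst has_bochner_integral_restrict_space) auto
  then show "L1 (\<lambda>x. g (1 - x))" "(\<integral>x. g (1 - x) \<partial>unit_measure) = (\<integral>x. g x \<partial>unit_measure)"
    by (simp_all only: has_bochner_integral_iff)
qed

lemma ac_deriv_reflect:
  assumes "ac_deriv f g"
  shows "ac_deriv (\<lambda>x. f (1 - x)) (\<lambda>x. - g (1 - x))"
proof (rule ac_derivI)
  have L: "L1 g" using assms by (rule ac_deriv_L1)
  show "L1 (\<lambda>x. - g (1 - x))" using integral_unit_reflect(1)[OF L] by simp
  fix x :: real assume x: "x \<in> {0..1}"
  have "prim (\<lambda>t. g (1 - t)) x = (\<integral>t. indicator {..x} (1 - (1 - t)) * g (1 - t) \<partial>unit_measure)"
    by (simp add: prim_def)
  also have "\<dots> = (\<integral>t. indicator {..x} (1 - t) * g t \<partial>unit_measure)"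
  proof (rule integral_unit_reflect(2)[of "\<lambda>t. indicator {..x} (1 - t) * g t"])
    have "(\<lambda>t. indicator {..x} (1 - t) * g t) = (\<lambda>t. g t - indicator {..<1 - x} t * g t)"
      by (auto split: split_indicator)
    then show "L1 (\<lambda>t. indicator {..x} (1 - t) * g t)"
      using L indicator_mult_L1(2)[OF L] by simp
  qed
  also have "\<dots> = (\<integral>t. g t - indicator {..<1 - x} t * g t \<partial>unit_measure)"
    by (intro Bochner_Integration.integral_cong) (auto split: split_indicator)
  also have "\<dots> = prim g 1 - prim g (1 - x)"
    using L indicator_mult_L1(2)[OF L] by (simp add: prim_1 prim_open)
  finally have p: "prim (\<lambda>t. g (1 - t)) x = prim g 1 - prim g (1 - x)" .
  have "f (1 - x) = f 0 + prim g (1 - x)" "f 1 = f 0 + prim g 1"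
    using x by (auto intro: ac_derivD[OF assms])
  then show "f (1 - x) = f (1 - 0) + prim (\<lambda>x. - g (1 - x)) x"
    using prim_cmult[of "- 1" "\<lambda>t. g (1 - t)" x] p by simp
qed

text \<open>As \<open>prim\<close> is complex valued, the majorant is compared through its real
  part.\<close>

lemma norm_prim_le:
  assumes "L1 f" "L1 h" "\<And>t. t \<in> {0..1} \<Longrightarrow> norm (f t) \<le> Re (h t)"
  shows "norm (prim f x) \<le> Re (prim h x)"
proof -
  have "norm (prim f x) \<le> (\<integral>t. norm (indicator {..x} t * f t) \<partial>unit_measure)"
    unfolding prim_def by (rule integral_norm_bound)
  also have "\<dots> \<le> (\<integral>t. Re (indicator {..x} t * h t) \<partial>unit_measure)"
  proof (rule integral_mono)
    show "norm (indicator {..x} t * f t) \<le> Re (indicator {..x} t * h t)" if "t \<in> space unit_measure" for t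
      using assms(3)[of t] that by (auto split: split_indicator)
    show "integrable unit_measure (\<lambda>t. norm (indicator {..x} t * f t))"
      by (rule integrable_norm[OF indicator_mult_L1(1)[OF assms(1)]])
    show "integrable unit_measure (\<lambda>t. Re (indicator {..x} t * h t))"
      by (rule integrable_bounded_linear[OF bounded_linear_Re indicator_mult_L1(1)[OF assms(2)]])
  qed
  also have "\<dots> = Re (prim h x)"
    unfolding prim_def
    by (rule integral_bounded_linear[OF bounded_linear_Re indicator_mult_L1(1)[OF assms(2)]])
  finally show ?thesis .
qed

text \<open>Integrating M' M^p gives M^(p+1) / (p+1); iterated, this is the source of the factorials
  in the Picard bound.\<close>

lemma prim_mult_power:
  assumes "L1 a" "x \<in> {0..1}"
  shows "prim (\<lambda>t. a t * prim a t ^ p) x * of_nat (Suc p) = prim a x ^ Suc p"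
proof -
  have a: "ac_deriv (prim a) a" using ac_deriv_prim[OF assms(1), of 0] by simp
  have "ac_deriv (\<lambda>t. prim a t ^ Suc p) (\<lambda>t. of_nat (Suc p) * (a t * prim a t ^ p))"
  proof (induction p)
    case (Suc p)
    have "ac_deriv (\<lambda>t. prim a t * prim a t ^ Suc p)
        (\<lambda>t. a t * prim a t ^ Suc p + prim a t * (of_nat (Suc p) * (a t * prim a t ^ p)))"
      by (rule ac_deriv_mult[OF a Suc])
    then show ?case by (simp add: algebra_simps)
  qed (use a in simp)
  from ac_derivD[OF this assms(2)] show ?thesis
    by (simp add: prim_cmult mult.commute del: of_nat_Suc)
qed

text \<open>Picard iteration: the \<open>p\<close>-th term is bounded by \<open>G M\<^sup>p / p!\<close>, where \<open>M\<close> is a primitive of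
  the sum of the absolute values of the coefficients.\<close>

primrec picard :: "nat \<Rightarrow> (nat \<Rightarrow> nat \<Rightarrow> real \<Rightarrow> complex) \<Rightarrow> (nat \<Rightarrow> real \<Rightarrow> complex) \<Rightarrow> nat \<Rightarrow> nat \<Rightarrow> real \<Rightarrow> complex" where
  "picard n A g 0 = g"
| "picard n A g (Suc p) = (\<lambda>k. prim (\<lambda>t. \<Sum>l<n. A k l t * picard n A g p l t))"

lemma linear_system_solution:
  fixes A :: "nat \<Rightarrow> nat \<Rightarrow> real \<Rightarrow> complex"
  assumes A: "\<And>k l. k < n \<Longrightarrow> l < n \<Longrightarrow> L1 (A k l)" and g: "\<And>k. k < n \<Longrightarrow> L1 (g k)"
  obtains u where
    "\<And>k. k < n \<Longrightarrow> ac_deriv (u k) (\<lambda>x. (\<Sum>l<n. A k l x * u l x) + g k x)"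
    "\<And>k. k < n \<Longrightarrow> u k 0 = c k"
proof -
  define g' where "g' k x = c k + prim (g k) x" for k x
  define U where "U = picard n A g'"
  have U0: "U 0 = g'" and US: "U (Suc p) = (\<lambda>k. prim (\<lambda>t. \<Sum>l<n. A k l t * U p l t))" for p
    by (simp_all add: U_def)
  have AU: "L1 (\<lambda>t. \<Sum>l<n. A k l t * v l t)" if "k < n" "\<And>l. l < n \<Longrightarrow> continuous_on {0..1} (v l)" for k v
    using that A by (intro Bochner_Integration.integrable_sum L1_mult_continuous) auto
  have Uc: "continuous_on {0..1} (U p k)" if "k < n" for p k
    using that
  proof (induction p arbitrary: k)
    case 0
    then show ?case
      unfolding U0 g'_def by (intro continuous_on_add continuous_on_const continuous_prim g)
  next
    case (Suc p)
    then show ?case unfolding US by (intro continuous_prim AU)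
  qed
  \<comment> \<open>One scalar majorant for all entries of the coefficient matrix, as a complex
    function so that \<open>prim\<close> applies to it.\<close>
  define a where "a t = complex_of_real (\<Sum>k<n. \<Sum>l<n. norm (A k l t))" for t
  have La: "L1 a"
    unfolding a_def of_real_sum using A by (intro Bochner_Integration.integrable_sum integrable_of_real integrable_norm) auto
  define m where "m x = (\<integral>t. indicator {..x} t * (\<Sum>k<n. \<Sum>l<n. norm (A k l t)) \<partial>unit_measure)" for x
  have am: "prim a x = complex_of_real (m x)" for x
  proof -
    have "(\<lambda>t. indicator {..x} t * a t) = (\<lambda>t. complex_of_real (indicator {..x} t * (\<Sum>k<n. \<Sum>l<n. norm (A k l t))))"
      unfolding a_def by (auto split: split_indicator)
    then show ?thesis unfolding prim_def m_def by (simp only: integral_complex_of_real)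
  qed
  have m0: "0 \<le> m x" for x
    unfolding m_def by (intro integral_nonneg_AE AE_I2 mult_nonneg_nonneg sum_nonneg) auto
  obtain B where B: "\<And>x. x \<in> {0..1} \<Longrightarrow> m x \<le> B"
    using continuous_unit_bounded[OF continuous_prim[OF La]] am m0 by (metis abs_of_nonneg norm_of_real)
  have "\<exists>G. \<forall>k<n. \<forall>x\<in>{0..1}. norm (U 0 k x) \<le> G"
  proof -
    have "\<forall>k. \<exists>G. k < n \<longrightarrow> (\<forall>x\<in>{0..1}. norm (U 0 k x) \<le> G)"
      using continuous_unit_bounded[OF Uc[of _ 0]] by metis
    then obtain G where G: "\<And>k x. k < n \<Longrightarrow> x \<in> {0..1} \<Longrightarrow> norm (U 0 k x) \<le> G k" by metis
    have "norm (U 0 k x) \<le> (\<Sum>k<n. \<bar>G k\<bar>)" if "k < n" "x \<in> {0..1}" for k x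
    proof -
      have "norm (U 0 k x) \<le> \<bar>G k\<bar>" using G[OF that] by linarith
      also have "\<dots> \<le> (\<Sum>k<n. \<bar>G k\<bar>)" using that by (intro member_le_sum) auto
      finally show ?thesis .
    qed
    then show ?thesis by blast
  qed
  then obtain G0 where G0: "\<And>k x. k < n \<Longrightarrow> x \<in> {0..1} \<Longrightarrow> norm (U 0 k x) \<le> G0" by blast
  define G where "G = \<bar>G0\<bar>"
  have G: "G \<ge> 0" "\<And>k x. k < n \<Longrightarrow> x \<in> {0..1} \<Longrightarrow> norm (U 0 k x) \<le> G"
    using G0 unfolding G_def by force+
  have row: "(\<Sum>l<n. norm (A k l t)) \<le> (\<Sum>k<n. \<Sum>l<n. norm (A k l t))" if "k < n" for k t
    using that by (intro member_le_sum sum_nonneg) auto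
  have bound: "norm (U p k x) \<le> G * (m x ^ p / fact p)" if "k < n" "x \<in> {0..1}" for p k x
    using that
  proof (induction p arbitrary: k x)
    case 0
    then show ?case using G by simp
  next
    case (Suc p)
    let ?h = "\<lambda>t. complex_of_real (G / fact p) * (a t * prim a t ^ p)"
    have "norm (U (Suc p) k x) \<le> Re (prim ?h x)"
      unfolding US
    proof (rule norm_prim_le)
      show "L1 (\<lambda>t. \<Sum>l<n. A k l t * U p l t)" using Suc.prems(1) Uc by (intro AU)
      show "L1 ?h"
        by (intro integrable_mult_right L1_mult_continuous[OF La] continuous_on_power continuous_prim[OF La])
      fix t :: real assume t: "t \<in> {0..1}"
      have "norm (\<Sum>l<n. A k l t * U p l t) \<le> (\<Sum>l<n. norm (A k l t) * (G * (m t ^ p / fact p)))"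
        unfolding norm_mult by (rule sum_norm_le, unfold norm_mult, rule mult_left_mono, rule Suc.IH) (use t in auto)
      also have "\<dots> \<le> (\<Sum>k<n. \<Sum>l<n. norm (A k l t)) * (G * (m t ^ p / fact p))"
        unfolding sum_distrib_right[symmetric]
        using G m0 row[OF Suc.prems(1)] by (intro mult_right_mono mult_nonneg_nonneg divide_nonneg_nonneg) auto
      also have "\<dots> = Re (complex_of_real ((G / fact p) * ((\<Sum>k<n. \<Sum>l<n. norm (A k l t)) * m t ^ p)))"
        unfolding Re_complex_of_real by (simp add: mult_ac)
      also have "\<dots> = Re (?h t)"
        unfolding a_def am by (simp only: of_real_mult of_real_power)
      finally show "norm (\<Sum>l<n. A k l t * U p l t) \<le> Re (?h t)" .
    qed
    also have "prim ?h x = complex_of_real (G / fact p) * prim (\<lambda>t. a t * prim a t ^ p) x"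
      by (rule prim_cmult)
    also have "prim (\<lambda>t. a t * prim a t ^ p) x = complex_of_real (m x ^ Suc p / real (Suc p))"
      using prim_mult_power[OF La Suc.prems(2), of p] unfolding am
      by (simp add: field_simps del: of_nat_Suc)
    also have "Re (complex_of_real (G / fact p) * complex_of_real (m x ^ Suc p / real (Suc p))) = G * (m x ^ Suc p / fact (Suc p))"
      unfolding of_real_mult[symmetric] Re_complex_of_real by (simp add: mult_ac del: of_nat_Suc)
    finally show ?case .
  qed
  have sume: "summable (\<lambda>p. G * (B ^ p / fact p))" "\<And>N. (\<Sum>p<N. G * (B ^ p / fact p)) \<le> (\<Sum>p. G * (B ^ p / fact p))"
  proof -
    show s: "summable (\<lambda>p. G * (B ^ p / fact p))"
      using summable_exp[of B] by (intro summable_mult) (simp add: field_simps)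
    have "0 \<le> B" using B[of 0] m0[of 0] by simp
    then show "(\<Sum>p<N. G * (B ^ p / fact p)) \<le> (\<Sum>p. G * (B ^ p / fact p))" for N
      using s G by (intro sum_le_suminf) auto
  qed
  have bound': "norm (U p k x) \<le> G * (B ^ p / fact p)" if "k < n" "x \<in> {0..1}" for p k x
    by (rule order_trans[OF bound[OF that]])
      (use that B m0 G in \<open>intro mult_left_mono divide_right_mono power_mono; simp\<close>)
  have sumU: "summable (\<lambda>p. U p k x)" if "k < n" "x \<in> {0..1}" for k x
    by (rule summable_comparison_test'[OF sume(1), of 0]) (rule bound'[OF that])
  define u where "u k x = (\<Sum>p. U p k x)" for k x
  define S where "S N k x = (\<Sum>p<N. U p k x)" for N k x
  have Su: "(\<lambda>N. S N k x) \<longlonglongrightarrow> u k x" if "k < n" "x \<in> {0..1}" for k x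
    unfolding S_def u_def using sumU[OF that] by (rule summable_LIMSEQ)
  define K where "K = (\<Sum>p. G * (B ^ p / fact p))"
  have SK: "norm (S N k x) \<le> K" if "k < n" "x \<in> {0..1}" for N k x
  proof -
    have "norm (S N k x) \<le> (\<Sum>p<N. G * (B ^ p / fact p))"
      unfolding S_def using bound'[OF that] by (intro sum_norm_le)
    also have "\<dots> \<le> K" unfolding K_def by (rule sume(2))
    finally show ?thesis .
  qed
  have Sc: "continuous_on {0..1} (S N k)" if "k < n" for N k
    unfolding S_def using Uc that by (intro continuous_on_sum) auto
  have SS: "S (Suc N) k x = g' k x + prim (\<lambda>t. \<Sum>l<n. A k l t * S N l t) x" if "k < n" for N k x
  proof -
    have "prim (\<lambda>t. \<Sum>l<n. A k l t * S N l t) x = (\<Sum>p<N. U (Suc p) k x)"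
    proof (induction N)
      case (Suc N)
      have "prim (\<lambda>t. \<Sum>l<n. A k l t * S (Suc N) l t) x =
        prim (\<lambda>t. (\<Sum>l<n. A k l t * S N l t) + (\<Sum>l<n. A k l t * U N l t)) x"
        by (simp add: S_def distrib_left sum.distrib)
      also have "\<dots> = prim (\<lambda>t. \<Sum>l<n. A k l t * S N l t) x + U (Suc N) k x"
        unfolding US using that Sc Uc by (intro prim_add AU)
      finally show ?case using Suc by simp
    qed (simp add: S_def prim_def)
    then show ?thesis
      unfolding S_def[of "Suc N"] by (subst sum.lessThan_Suc_shift) (simp add: U0)
  qed
  \<comment> \<open>The limit is only known to be measurable and bounded here. That suffices for
    dominated convergence in the integral equation, and the equation then yields absolute
    continuity.\<close>
  have um: "u k \<in> borel_measurable unit_measure" if "k < n" for k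
    by (rule borel_measurable_LIMSEQ_metric[where f = "\<lambda>N. S N k"])
      (use that Su Sc continuous_imp_measurable_unit in auto)
  have uK: "norm (u k x) \<le> K" if "k < n" "x \<in> {0..1}" for k x
    using LIMSEQ_le_const2[OF tendsto_norm[OF Su[OF that]]] SK[OF that] by blast
  have Lu: "L1 (\<lambda>t. \<Sum>l<n. A k l t * u l t)" if "k < n" for k
  proof (rule Bochner_Integration.integrable_sum)
    fix l assume "l \<in> {..<n}"
    then have "L1 (\<lambda>t. u l t * A k l t)"
      using um uK A that by (intro bounded_mult_L1[where B = K] AE_I2) auto
    then show "L1 (\<lambda>t. A k l t * u l t)" by (simp add: mult.commute)
  qed
  have eq: "u k x = g' k x + prim (\<lambda>t. \<Sum>l<n. A k l t * u l t) x" if k: "k < n" and x: "x \<in> {0..1}" for k x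
  proof -
    have "(\<lambda>N. prim (\<lambda>t. \<Sum>l<n. A k l t * S N l t) x) \<longlonglongrightarrow> prim (\<lambda>t. \<Sum>l<n. A k l t * u l t) x"
      unfolding prim_def
    proof (rule integral_dominated_convergence[where w = "\<lambda>t. (\<Sum>l<n. norm (A k l t)) * K"])
      show "(\<lambda>t. indicator {..x} t * (\<Sum>l<n. A k l t * u l t)) \<in> borel_measurable unit_measure"
        using indicator_mult_L1(1)[OF Lu[OF k]] by auto
      show "(\<lambda>t. indicator {..x} t * (\<Sum>l<n. A k l t * S N l t)) \<in> borel_measurable unit_measure" for N
        using indicator_mult_L1(1)[OF AU[OF k Sc]] by auto
      show "integrable unit_measure (\<lambda>t. (\<Sum>l<n. norm (A k l t)) * K)"
        using A k by (intro integrable_mult_left Bochner_Integration.integrable_sum integrable_norm) auto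
      show "AE t in unit_measure. (\<lambda>N. indicator {..x} t * (\<Sum>l<n. A k l t * S N l t))
          \<longlonglongrightarrow> indicator {..x} t * (\<Sum>l<n. A k l t * u l t)"
        using Su by (intro AE_I2 tendsto_mult tendsto_const tendsto_sum) auto
      show "AE t in unit_measure. norm (indicator {..x} t * (\<Sum>l<n. A k l t * S N l t)) \<le> (\<Sum>l<n. norm (A k l t)) * K" for N
      proof (rule AE_I2)
        fix t assume t: "t \<in> space unit_measure"
        have "norm (indicator {..x} t * (\<Sum>l<n. A k l t * S N l t)) \<le> norm (\<Sum>l<n. A k l t * S N l t)"
          by (auto split: split_indicator)
        also have "\<dots> \<le> (\<Sum>l<n. norm (A k l t) * K)"
          using SK t by (intro sum_norm_le) (auto simp: norm_mult intro!: mult_left_mono)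
        finally show "norm (indicator {..x} t * (\<Sum>l<n. A k l t * S N l t)) \<le> (\<Sum>l<n. norm (A k l t)) * K"
          by (simp add: sum_distrib_right)
      qed
    qed
    then have "(\<lambda>N. S (Suc N) k x) \<longlonglongrightarrow> g' k x + prim (\<lambda>t. \<Sum>l<n. A k l t * u l t) x"
      unfolding SS[OF k] by (intro tendsto_add tendsto_const)
    moreover have "(\<lambda>N. S (Suc N) k x) \<longlonglongrightarrow> u k x"
      using Su[OF k x] by (rule LIMSEQ_Suc)
    ultimately show ?thesis using LIMSEQ_unique by blast
  qed
  show ?thesis
  proof (rule that)
    fix k assume k: "k < n"
    show u0: "u k 0 = c k" using eq[OF k, of 0] by (simp add: g'_def)
    show "ac_deriv (u k) (\<lambda>x. (\<Sum>l<n. A k l x * u l x) + g k x)"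
    proof (rule ac_derivI)
      show "L1 (\<lambda>x. (\<Sum>l<n. A k l x * u l x) + g k x)" using Lu[OF k] g[OF k] by auto
      fix x :: real assume "x \<in> {0..1}"
      then show "u k x = u k 0 + prim (\<lambda>x. (\<Sum>l<n. A k l x * u l x) + g k x) x"
        using eq[OF k, of x] by (simp add: u0 prim_add[OF Lu[OF k] g[OF k]] g'_def)
    qed
  qed
qed

text \<open>The substitution x \<mapsto> 1 - x turns the condition at 1 into an initial condition
  and changes the sign of the derivative.\<close>

lemma adjoint_system_solution:
  fixes n :: nat
  assumes A: "\<And>k l. k < n \<Longrightarrow> l < n \<Longrightarrow> L1 (A k l)" and E: "\<And>l. l < n \<Longrightarrow> L1 (E l)"
  obtains P where
    "\<And>l. l < n \<Longrightarrow> ac_deriv (P l) (\<lambda>x. - (\<Sum>k<n. P k x * A k l x) - E l x)"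
    "\<And>l. l < n \<Longrightarrow> P l 1 = 0"
proof -
  have "L1 (\<lambda>x. A k l (1 - x))" "L1 (\<lambda>x. E l (1 - x))" if "k < n" "l < n" for k l
    using integral_unit_reflect(1) A[OF that] E[OF that(2)] by auto
  then obtain R where R: "\<And>l. l < n \<Longrightarrow> ac_deriv (R l) (\<lambda>x. (\<Sum>k<n. A k l (1 - x) * R k x) + E l (1 - x))"
    "\<And>l. l < n \<Longrightarrow> R l 0 = 0"
    using linear_system_solution[of n "\<lambda>l k x. A k l (1 - x)" "\<lambda>l x. E l (1 - x)" "\<lambda>_. 0"]
    by blast
  show ?thesis
  proof (rule that[of "\<lambda>l x. R l (1 - x)"])
    fix l assume l: "l < n"
    show "ac_deriv (\<lambda>x. R l (1 - x)) (\<lambda>x. - (\<Sum>k<n. R k (1 - x) * A k l x) - E l x)"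
      using ac_deriv_reflect[OF R(1)[OF l]] by (simp add: mult.commute)
    show "R l (1 - 1) = 0" using R(2)[OF l] by simp
  qed
qed

text \<open>For the solution \<open>P\<close> of the adjoint system with \<open>P 1 = 0\<close> one has \<open>(P \<sqdot> Y)' = - E \<sqdot> Y + P\<^sub>n\<^sub>-\<^sub>1 f\<close>.
  As \<open>f\<close> and \<open>Y 0\<close> are arbitrary, \<open>P\<^sub>n\<^sub>-\<^sub>1 = 0\<close> and \<open>P 0 = 0\<close>.\<close>

lemma adjoint_of_annihilator:
  fixes n :: nat
  assumes n: "n > 0" and A: "\<And>k l. k < n \<Longrightarrow> l < n \<Longrightarrow> L1 (A k l)" and E: "\<And>l. l < n \<Longrightarrow> L1 (E l)"
    and ann: "\<And>Y f. L1 f \<Longrightarrow> (\<And>k. k < n \<Longrightarrow>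
        ac_deriv (Y k) (\<lambda>x. (\<Sum>l<n. A k l x * Y l x) + (if k = n - 1 then f x else 0)))
      \<Longrightarrow> (\<integral>x. (\<Sum>l<n. E l x * Y l x) \<partial>unit_measure) = 0"
  obtains P where
    "\<And>l. l < n \<Longrightarrow> ac_deriv (P l) (\<lambda>x. - (\<Sum>k<n. P k x * A k l x) - E l x)"
    "\<And>l. l < n \<Longrightarrow> P l 0 = 0" "\<And>l. l < n \<Longrightarrow> P l 1 = 0"
    "\<And>x. x \<in> {0..1} \<Longrightarrow> P (n - 1) x = 0"
proof -
  obtain P where P: "\<And>l. l < n \<Longrightarrow> ac_deriv (P l) (\<lambda>x. - (\<Sum>k<n. P k x * A k l x) - E l x)"
    "\<And>l. l < n \<Longrightarrow> P l 1 = 0"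
    using adjoint_system_solution[of n A E] A E by blast
  \<comment> \<open>The integral of (P . Y)' over [0,1]; only the boundary term at 0 survives, since
    P vanishes at 1.\<close>
  have key: "(\<integral>x. P (n - 1) x * f x \<partial>unit_measure) = - (\<Sum>l<n. P l 0 * c l)" if f: "L1 f" for f c
  proof -
    let ?f = "\<lambda>k x. if k = n - 1 then f x else 0"
    have "L1 (?f k)" for k using f by (cases "k = n - 1") auto
    then obtain Y where Y: "\<And>k. k < n \<Longrightarrow> ac_deriv (Y k) (\<lambda>x. (\<Sum>l<n. A k l x * Y l x) + ?f k x)"
      "\<And>k. k < n \<Longrightarrow> Y k 0 = c k"
      using linear_system_solution[of n A ?f c] A by blast
    have Yc: "continuous_on {0..1} (Y k)" if "k < n" for k
      using Y(1)[OF that] by (rule ac_deriv_continuous)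
    have Pc: "continuous_on {0..1} (P k)" if "k < n" for k
      using P(1)[OF that] by (rule ac_deriv_continuous)
    have W: "ac_deriv (\<lambda>x. \<Sum>l<n. P l x * Y l x) (\<lambda>x. \<Sum>l<n. (- (\<Sum>k<n. P k x * A k l x) - E l x) * Y l x
        + P l x * ((\<Sum>k<n. A l k x * Y k x) + ?f l x))"
      by (rule ac_deriv_sum, rule ac_deriv_mult) (use P(1) Y(1) in auto)
    have eq: "(\<Sum>l<n. (- (\<Sum>k<n. P k x * A k l x) - E l x) * Y l x + P l x * ((\<Sum>k<n. A l k x * Y k x) + ?f l x))
        = - (\<Sum>l<n. E l x * Y l x) + P (n - 1) x * f x" for x
    proof -
      have "(\<Sum>l<n. \<Sum>k<n. P k x * A k l x * Y l x) = (\<Sum>l<n. \<Sum>k<n. P l x * (A l k x * Y k x))"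
        by (subst sum.swap) (simp add: mult.assoc)
      moreover have "(\<Sum>l<n. P l x * ?f l x) = P (n - 1) x * f x"
        using n by (subst sum.remove[of _ "n - 1"]) (auto intro!: sum.neutral)
      ultimately show ?thesis
        by (simp add: sum.distrib sum_subtractf left_diff_distrib distrib_left sum_distrib_left sum_distrib_right sum_negf)
    qed
    have "L1 (\<lambda>x. E l x * Y l x)" if "l < n" for l
      by (rule L1_mult_continuous[OF E[OF that] Yc[OF that]])
    then have L: "L1 (\<lambda>x. \<Sum>l<n. E l x * Y l x)" "L1 (\<lambda>x. P (n - 1) x * f x)"
      using continuous_mult_L1[OF Pc[of "n - 1"] f] n by auto
    have "(\<integral>x. - (\<Sum>l<n. E l x * Y l x) + P (n - 1) x * f x \<partial>unit_measure) = - (\<Sum>l<n. P l 0 * c l)"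
      using ac_deriv_integral[OF W] P(2) Y(2) unfolding eq by simp
    moreover have "(\<integral>x. (\<Sum>l<n. E l x * Y l x) \<partial>unit_measure) = 0"
      using Y(1) by (intro ann[OF f])
    ultimately show ?thesis
      using L by simp
  qed
  have "P l 0 = 0" if l: "l < n" for l
  proof -
    have "(\<Sum>k<n. P k 0 * (if k = l then 1 else 0)) = P l 0"
      using l by (subst sum.remove[of _ l]) (auto intro!: sum.neutral)
    then show ?thesis using key[of "\<lambda>x. 0" "\<lambda>k. if k = l then 1 else 0"] by simp
  qed
  moreover have "P (n - 1) x = 0" if "x \<in> {0..1}" for x
  proof (rule continuous_AE_0_imp_0[OF _ _ that])
    show c: "continuous_on {0..1} (P (n - 1))"
      using P(1)[of "n - 1"] n by (intro ac_deriv_continuous) auto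
    show "AE x in unit_measure. P (n - 1) x = 0"
    proof (rule AE_0_if_orthogonal_to_test[OF continuous_imp_L1[OF c]])
      fix z assume "z \<in> test_functions"
      then show "(\<integral>x. P (n - 1) x * z x \<partial>unit_measure) = 0"
        using key[of z "\<lambda>_. 0"] by (simp add: continuous_imp_L1 test_continuous)
    qed
  qed
  ultimately show ?thesis using that P by blast
qed

subsection \<open>The matrices \<open>\<chi>\<close>\<close>

lemma sum_shift_interval:
  fixes f :: "nat \<Rightarrow> 'a::comm_monoid_add"
  assumes "k + i \<le> m"
  shows "(\<Sum>r\<le>m. if k \<le> r \<and> r - k \<le> i then f (r - k) else 0) = (\<Sum>p\<le>i. f p)"
proof -
  have "(\<Sum>r\<le>m. if k \<le> r \<and> r - k \<le> i then f (r - k) else 0) = (\<Sum>r\<in>{k..k + i}. f (r - k))"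
    using assms by (intro sum.mono_neutral_cong_right) auto
  also have "\<dots> = (\<Sum>p\<le>i. f p)"
    by (rule sum.reindex_bij_witness[of _ "\<lambda>p. k + p" "\<lambda>r. r - k"]) auto
  finally show ?thesis .
qed

lemma sum_chi_even:
  assumes "k + i \<le> m"
  shows "(\<Sum>r\<le>m. \<Sum>j\<le>m. chi (2 * k) i r j * (a r * b j)) = leibniz i (\<lambda>p. a (k + p)) (\<lambda>p. b (k + p))"
proof -
  have "(\<Sum>j\<le>m. chi (2 * k) i r j * (a r * b j)) =
      (if k \<le> r \<and> r - k \<le> i then of_nat (i choose (r - k)) * a (k + (r - k)) * b (k + (i - (r - k))) else 0)" for r
  proof (cases "k \<le> r \<and> r - k \<le> i")
    case True
    have "(\<Sum>j\<le>m. chi (2 * k) i r j * (a r * b j)) =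
        (\<Sum>j\<le>m. if j = i - (r - k) + k then of_nat (i choose (r - k)) * (a r * b j) else 0)"
      using True by (intro sum.cong) (auto simp: chi_def)
    also have "\<dots> = of_nat (i choose (r - k)) * (a r * b (i - (r - k) + k))"
    proof -
      have "i - (r - k) + k \<le> m" using assms True by linarith
      then show ?thesis by (simp only: sum.delta finite_atMost atMost_iff if_True)
    qed
    finally show ?thesis using True by (simp add: add.commute)
  qed (auto simp: chi_def intro!: sum.neutral)
  then show ?thesis
    using sum_shift_interval[OF assms, of "\<lambda>p. of_nat (i choose p) * a (k + p) * b (k + (i - p))"]
    by (simp add: leibniz_def)
qed

text \<open>By Pascal's rule the entry of \<open>chi\<close> is C(i,p) - C(i,p-1). These are the
  Leibniz coefficients of the i-th derivative of a b' minus those of a' b, which explains the odd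
  case of \<open>chi\<close>.\<close>

lemma sum_chi_odd:
  assumes "k + Suc i \<le> m"
  shows "(\<Sum>r\<le>m. \<Sum>j\<le>m. chi (Suc (2 * k)) i r j * (a r * b j)) =
     leibniz i (\<lambda>p. a (k + p)) (\<lambda>p. b (Suc (k + p))) - leibniz i (\<lambda>p. a (Suc (k + p))) (\<lambda>p. b (k + p))"
proof -
  let ?c = "\<lambda>p. of_nat (Suc i choose p) - 2 * (if p = 0 then 0 else of_nat (i choose (p - 1))) :: complex"
  have "(\<Sum>j\<le>m. chi (Suc (2 * k)) i r j * (a r * b j)) =
      (if k \<le> r \<and> r - k \<le> Suc i then ?c (r - k) * a (k + (r - k)) * b (k + (Suc i - (r - k))) else 0)" for r
  proof (cases "k \<le> r \<and> r - k \<le> Suc i")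
    case True
    have "(\<Sum>j\<le>m. chi (Suc (2 * k)) i r j * (a r * b j)) =
        (\<Sum>j\<le>m. if j = Suc i - (r - k) + k then ?c (r - k) * (a r * b j) else 0)"
      using True by (intro sum.cong) (auto simp: chi_def)
    also have "\<dots> = ?c (r - k) * (a r * b (Suc i - (r - k) + k))"
    proof -
      have "Suc i - (r - k) + k \<le> m" using assms True by linarith
      then show ?thesis by (simp only: sum.delta finite_atMost atMost_iff if_True)
    qed
    finally show ?thesis using True by (simp add: add.commute)
  qed (auto simp: chi_def intro!: sum.neutral)
  then have "(\<Sum>r\<le>m. \<Sum>j\<le>m. chi (Suc (2 * k)) i r j * (a r * b j)) =
      (\<Sum>p\<le>Suc i. ?c p * a (k + p) * b (k + (Suc i - p)))"
    using sum_shift_interval[OF assms, of "\<lambda>p. ?c p * a (k + p) * b (k + (Suc i - p))"] by simp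
  also have "\<dots> = (\<Sum>p\<le>Suc i. (of_nat (i choose p) - (if p = 0 then 0 else of_nat (i choose (p - 1)))) * a (k + p) * b (k + (Suc i - p)))"
  proof -
    have "?c p = of_nat (i choose p) - (if p = 0 then 0 else of_nat (i choose (p - 1)))" for p
      by (cases p) auto
    then show ?thesis by (simp only:)
  qed
  also have "\<dots>
    = (\<Sum>p\<le>Suc i. of_nat (i choose p) * a (k + p) * b (k + (Suc i - p)))
      - (\<Sum>p\<le>Suc i. (if p = 0 then 0 else of_nat (i choose (p - 1))) * a (k + p) * b (k + (Suc i - p)))"
    by (simp only: left_diff_distrib sum_subtractf)
  also have "(\<Sum>p\<le>Suc i. of_nat (i choose p) * a (k + p) * b (k + (Suc i - p))) =
      leibniz i (\<lambda>p. a (k + p)) (\<lambda>p. b (Suc (k + p)))"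
    by (simp add: leibniz_def binomial_eq_0 Suc_diff_le)
  also have "(\<Sum>p\<le>Suc i. (if p = 0 then 0 else of_nat (i choose (p - 1))) * a (k + p) * b (k + (Suc i - p))) =
      leibniz i (\<lambda>p. a (Suc (k + p))) (\<lambda>p. b (k + p))"
    by (subst sum.atMost_Suc_shift) (simp add: leibniz_def)
  finally show ?thesis .
qed

text \<open>The formal i-th derivative of a b or of a b' - a' b, with a and b started at order k.
  The derivatives are free sequences, so weak derivatives of y can be inserted for a.\<close>

definition pairing :: "nat \<Rightarrow> nat \<Rightarrow> (nat \<Rightarrow> complex) \<Rightarrow> (nat \<Rightarrow> complex) \<Rightarrow> complex" where
  "pairing \<nu> i a b = (let k = \<nu> div 2 in
     if even \<nu> then leibniz i (\<lambda>p. a (k + p)) (\<lambda>p. b (k + p))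
     else leibniz i (\<lambda>p. a (k + p)) (\<lambda>p. b (Suc (k + p))) - leibniz i (\<lambda>p. a (Suc (k + p))) (\<lambda>p. b (k + p)))"

lemma sing_order_le:
  "\<nu> < 2 * m \<Longrightarrow> i \<le> sing_order m \<nu> \<Longrightarrow> i + \<nu> div 2 + \<nu> mod 2 \<le> m"
proof -
  assume "\<nu> < 2 * m" "i \<le> sing_order m \<nu>"
  moreover have "\<nu> div 2 + \<nu> mod 2 \<le> m" using \<open>\<nu> < 2 * m\<close> by presburger
  ultimately show ?thesis by (simp add: sing_order_def)
qed

lemma sum_chi:
  assumes "\<nu> < 2 * m" "i \<le> sing_order m \<nu>"
  shows "(\<Sum>r\<le>m. \<Sum>j\<le>m. chi \<nu> i r j * (a r * b j)) = pairing \<nu> i a b"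
proof (cases "even \<nu>")
  case True
  then have "\<nu> = 2 * (\<nu> div 2)" by simp
  moreover have "\<nu> div 2 + i \<le> m" using sing_order_le[OF assms] by simp
  ultimately show ?thesis
    using sum_chi_even[of "\<nu> div 2" i m a b] True by (simp add: pairing_def Let_def)
next
  case False
  then have "\<nu> = Suc (2 * (\<nu> div 2))" by presburger
  moreover have "\<nu> div 2 + Suc i \<le> m" using sing_order_le[OF assms] False by (simp add: odd_iff_mod_2_eq_one)
  ultimately show ?thesis
    using sum_chi_odd[of "\<nu> div 2" i m a b] False by (simp add: pairing_def Let_def)
qed

text \<open>Each matrix lives on the single antidiagonal r + j = \<nu> + i. Hence an expansion in
  these matrices decouples into one problem per antidiagonal.\<close>

lemma chi_off_antidiagonal:
  assumes "r + j \<noteq> \<nu> + i"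
  shows "chi \<nu> i r j = 0"
proof (cases "even \<nu>")
  case True
  then obtain k where k: "\<nu> = 2 * k" by blast
  have "\<not> (k \<le> r \<and> r - k \<le> i \<and> j = i - (r - k) + k)" using assms k by linarith
  then show ?thesis by (simp add: chi_def Let_def k)
next
  case False
  then obtain k where k: "\<nu> = 2 * k + 1" by (rule oddE)
  have "\<not> (k \<le> r \<and> r - k \<le> i + 1 \<and> j = i + 1 - (r - k) + k)" using assms k by linarith
  moreover have "\<nu> div 2 = k" using k by simp
  ultimately show ?thesis using False by (simp only: chi_def Let_def if_False)
qed

lemma chi_last_entry:
  assumes "\<nu> < 2 * m" "i \<le> sing_order m \<nu>"
  shows "chi \<nu> i m m = 0"
  using sing_order_le[OF assms] assms(1) mult_div_mod_eq[of 2 \<nu>] by (intro chi_off_antidiagonal) linarith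

text \<open>Only the top index reaches the last row and column. This matches the two regularity
  demands: L2 for the border of Q and for the top coefficients, L1 for the rest.\<close>

lemma chi_border:
  assumes "\<nu> < 2 * m" "i < sing_order m \<nu>"
  shows "chi \<nu> i r m = 0" "chi \<nu> i m j = 0"
proof -
  have le: "Suc i + \<nu> div 2 + \<nu> mod 2 \<le> m" using sing_order_le[OF assms(1), of "Suc i"] assms(2) by simp
  have "chi \<nu> i r m = 0 \<and> chi \<nu> i m j = 0"
  proof (cases "even \<nu>")
    case True
    then obtain k where k: "\<nu> = 2 * k" by blast
    have "\<not> (k \<le> r \<and> r - k \<le> i \<and> m = i - (r - k) + k)" "\<not> (k \<le> m \<and> m - k \<le> i \<and> j = i - (m - k) + k)"
      using le k by (simp, linarith)+
    then show ?thesis by (simp add: chi_def Let_def k)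
  next
    case False
    then obtain k where k: "\<nu> = 2 * k + 1" by (rule oddE)
    have kd: "\<nu> div 2 = k" "\<nu> mod 2 = 1" using k by simp_all
    have "\<not> (k \<le> r \<and> r - k \<le> i + 1 \<and> m = i + 1 - (r - k) + k)"
      "\<not> (k \<le> m \<and> m - k \<le> i + 1 \<and> j = i + 1 - (m - k) + k)"
      using le unfolding kd by linarith+
    then show ?thesis
      using False kd(1) by (simp only: chi_def Let_def if_False simp_thms)
  qed
  then show "chi \<nu> i r m = 0" "chi \<nu> i m j = 0" by simp_all
qed

lemma chi_below:
  assumes "r < \<nu> div 2 \<or> j < \<nu> div 2"
  shows "chi \<nu> i r j = 0"
proof -
  have "\<not> (\<nu> div 2 \<le> r \<and> P \<and> j = n + \<nu> div 2)" for P n using assms by linarith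
  then show ?thesis by (simp only: chi_def Let_def if_False split: if_split) simp
qed

lemma chi_corner:
  "chi (2 * k) i k (k + i) = 1" "chi (2 * k) i (k + i) k = 1"
  "chi (Suc (2 * k)) i k (Suc (k + i)) = 1" "chi (Suc (2 * k)) i (Suc (k + i)) k = - 1"
  by (auto simp: chi_def Let_def)

text \<open>On the antidiagonal \<open>r + j = s\<close> the matrices \<open>\<chi>\<^sub>\<nu>\<^sub>,\<^sub>s\<^sub>-\<^sub>\<nu>\<close> with \<open>\<nu> div 2 = k\<close> live on \<open>k \<le> r \<le> s - k\<close> and are
  independent in the two corners, which are peeled off one pair after the other.\<close>

lemma chi_basis_antidiagonal:
  fixes d :: "nat \<Rightarrow> real \<Rightarrow> complex"
  assumes add: "\<And>f g. V f \<Longrightarrow> V g \<Longrightarrow> V (\<lambda>x. f x + g x)" and scale: "\<And>c f. V f \<Longrightarrow> V (\<lambda>x. c * f x)"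
    and "2 * k \<le> s" "\<And>r. r \<in> {k..s - k} \<Longrightarrow> V (d r)"
  shows "\<exists>u. (\<forall>\<nu>\<in>{2 * k..s}. V (u \<nu>)) \<and>
     (\<forall>r\<in>{k..s - k}. \<forall>x. d r x = (\<Sum>\<nu>=2 * k..s. u \<nu> x * chi \<nu> (s - \<nu>) r (s - r))) \<and>
     (2 * k < s \<longrightarrow> u (2 * k) = (\<lambda>x. (d k x + d (s - k) x) / 2) \<and> u (Suc (2 * k)) = (\<lambda>x. (d k x - d (s - k) x) / 2))"
  using assms(3,4)
proof (induction "s - 2 * k" arbitrary: k d rule: less_induct)
  case less
  show ?case
  proof (cases "s = 2 * k")
    case True
    then show ?thesis
      using less.prems(2)[of k] chi_corner(1)[of k 0] by (intro exI[of _ "\<lambda>_. d k"]) auto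
  next
    case False
    then have s: "2 * k < s" using less.prems(1) by simp
    \<comment> \<open>The two corners carry the block with rows (1, 1) and (1, -1); its inverse is
      half the sum and half the difference.\<close>
    define u0 where "u0 x = (d k x + d (s - k) x) / 2" for x
    define u1 where "u1 x = (d k x - d (s - k) x) / 2" for x
    have Vd: "V (d k)" "V (d (s - k))" using less.prems(2) s by auto
    have V0: "V u0" "V u1"
    proof -
      have "u0 = (\<lambda>x. (1/2) * (d k x + d (s - k) x))" "u1 = (\<lambda>x. (1/2) * (d k x + (- 1) * d (s - k) x))"
        by (auto simp: u0_def u1_def field_simps)
      then show "V u0" "V u1" using add scale Vd by metis+
    qed
    define d' where "d' r x = d r x - (u0 x * chi (2 * k) (s - 2 * k) r (s - r)
        + u1 x * chi (Suc (2 * k)) (s - Suc (2 * k)) r (s - r))" for r x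
    have Vd': "V (d' r)" if "r \<in> {k..s - k}" for r
    proof -
      have "d' r = (\<lambda>x. d r x + ((- chi (2 * k) (s - 2 * k) r (s - r)) * u0 x
        + (- chi (Suc (2 * k)) (s - Suc (2 * k)) r (s - r)) * u1 x))"
        by (auto simp: d'_def algebra_simps)
      then show ?thesis
        by (simp only:) (intro add scale V0 less.prems(2)[OF that])
    qed
    have "\<exists>u. (\<forall>\<nu>\<in>{2 * Suc k..s}. V (u \<nu>)) \<and>
       (\<forall>r\<in>{Suc k..s - Suc k}. \<forall>x. d' r x = (\<Sum>\<nu>=2 * Suc k..s. u \<nu> x * chi \<nu> (s - \<nu>) r (s - r)))"
    proof (cases "2 * Suc k \<le> s")
      case True
      have "V (d' r)" if "r \<in> {Suc k..s - Suc k}" for r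
        using that by (intro Vd') auto
      then show ?thesis
        using less.hyps[of "Suc k" d'] True by fastforce
    next
      case False
      then show ?thesis using s by (intro exI[of _ "\<lambda>_. u0"]) auto
    qed
    then obtain u where u: "\<And>\<nu>. \<nu> \<in> {2 * Suc k..s} \<Longrightarrow> V (u \<nu>)"
       "\<And>r x. r \<in> {Suc k..s - Suc k} \<Longrightarrow> d' r x = (\<Sum>\<nu>=2 * Suc k..s. u \<nu> x * chi \<nu> (s - \<nu>) r (s - r))"
      by blast
    define w where "w \<nu> = (if \<nu> = 2 * k then u0 else if \<nu> = Suc (2 * k) then u1 else u \<nu>)" for \<nu>
    have split: "{2 * k..s} = insert (2 * k) (insert (Suc (2 * k)) {2 * Suc k..s})"
      using s by auto
    have sum: "(\<Sum>\<nu>=2 * k..s. w \<nu> x * chi \<nu> (s - \<nu>) r (s - r)) =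
       u0 x * chi (2 * k) (s - 2 * k) r (s - r) + u1 x * chi (Suc (2 * k)) (s - Suc (2 * k)) r (s - r)
       + (\<Sum>\<nu>=2 * Suc k..s. u \<nu> x * chi \<nu> (s - \<nu>) r (s - r))" for r x
    proof -
      have "(\<Sum>\<nu>=2 * Suc k..s. w \<nu> x * chi \<nu> (s - \<nu>) r (s - r)) = (\<Sum>\<nu>=2 * Suc k..s. u \<nu> x * chi \<nu> (s - \<nu>) r (s - r))"
        by (intro sum.cong) (auto simp: w_def)
      then show ?thesis unfolding split by (simp add: w_def)
    qed
    have "d r x = (\<Sum>\<nu>=2 * k..s. w \<nu> x * chi \<nu> (s - \<nu>) r (s - r))" if r: "r \<in> {k..s - k}" for r x
    proof -
      consider "r = k" | "r = s - k" "r \<noteq> k" | "r \<in> {Suc k..s - Suc k}" using r by force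
      then show ?thesis
      proof cases
        case 1
        have "(\<Sum>\<nu>=2 * Suc k..s. u \<nu> x * chi \<nu> (s - \<nu>) k (s - k)) = 0"
          by (intro sum.neutral) (auto intro!: chi_below)
        moreover have "chi (2 * k) (s - 2 * k) k (s - k) = 1" "chi (Suc (2 * k)) (s - Suc (2 * k)) k (s - k) = 1"
        proof -
          have e: "k + (s - 2 * k) = s - k" "Suc (k + (s - Suc (2 * k))) = s - k" using s by auto
          show "chi (2 * k) (s - 2 * k) k (s - k) = 1" "chi (Suc (2 * k)) (s - Suc (2 * k)) k (s - k) = 1"
            using chi_corner(1)[of k "s - 2 * k"] chi_corner(3)[of k "s - Suc (2 * k)"] unfolding e .
        qed
        ultimately show ?thesis unfolding sum 1 by (simp add: u0_def u1_def field_simps)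
      next
        case 2
        have *: "s - (s - k) = k" using s by simp
        have "(\<Sum>\<nu>=2 * Suc k..s. u \<nu> x * chi \<nu> (s - \<nu>) (s - k) k) = 0"
          by (intro sum.neutral) (auto intro!: chi_below)
        moreover have "chi (2 * k) (s - 2 * k) (s - k) k = 1" "chi (Suc (2 * k)) (s - Suc (2 * k)) (s - k) k = - 1"
        proof -
          have e: "k + (s - 2 * k) = s - k" "Suc (k + (s - Suc (2 * k))) = s - k" using s by auto
          show "chi (2 * k) (s - 2 * k) (s - k) k = 1" "chi (Suc (2 * k)) (s - Suc (2 * k)) (s - k) k = - 1"
            using chi_corner(2)[of k "s - 2 * k"] chi_corner(4)[of k "s - Suc (2 * k)"] unfolding e .
        qed
        ultimately show ?thesis unfolding sum unfolding 2(1) * by (simp add: u0_def u1_def field_simps)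
      next
        case 3
        from u(2)[OF this, of x] show ?thesis unfolding sum by (simp add: d'_def algebra_simps)
      qed
    qed
    moreover have "\<forall>\<nu>\<in>{2 * k..s}. V (w \<nu>)"
      using V0 u(1) unfolding split w_def by auto
    ultimately show ?thesis
      by (intro exI[of _ w]) (auto simp: w_def u0_def u1_def)
  qed
qed

lemma chi_basis:
  fixes d :: "nat \<Rightarrow> nat \<Rightarrow> real \<Rightarrow> complex"
  assumes d: "\<And>r j. r \<le> m \<Longrightarrow> j \<le> m \<Longrightarrow> r + j < 2 * m \<Longrightarrow> L1 (d r j)"
    and d2: "\<And>k. k < m \<Longrightarrow> d k m \<in> Lp 2 \<and> d m k \<in> Lp 2" and dmm: "\<And>x. d m m x = 0"
  obtains t where "\<And>\<nu> i. \<nu> < 2 * m \<Longrightarrow> i \<le> sing_order m \<nu> \<Longrightarrow> L1 (t \<nu> i)"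
    "\<And>\<nu>. \<nu> < 2 * m \<Longrightarrow> t \<nu> (sing_order m \<nu>) \<in> Lp 2"
    "\<And>r j x. r \<le> m \<Longrightarrow> j \<le> m \<Longrightarrow> d r j x = (\<Sum>\<nu><2 * m. \<Sum>i\<le>sing_order m \<nu>. t \<nu> i x * chi \<nu> i r j)"
proof -
  \<comment> \<open>Truncated subtraction makes s - m the first row that the antidiagonal r + j = s
    meets in the matrix: 0 for s \<le> m, and s - m otherwise.\<close>
  define Q where "Q s u \<longleftrightarrow> (\<forall>\<nu>\<in>{2 * (s - m)..s}. L1 (u \<nu>)) \<and>
     (\<forall>r\<in>{s - m..s - (s - m)}. \<forall>x. d r (s - r) x = (\<Sum>\<nu>=2 * (s - m)..s. u \<nu> x * chi \<nu> (s - \<nu>) r (s - r))) \<and>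
     (2 * (s - m) < s \<longrightarrow> u (2 * (s - m)) = (\<lambda>x. (d (s - m) (s - (s - m)) x + d (s - (s - m)) (s - (s - (s - m))) x) / 2)
        \<and> u (Suc (2 * (s - m))) = (\<lambda>x. (d (s - m) (s - (s - m)) x - d (s - (s - m)) (s - (s - (s - m))) x) / 2))"
    for s and u :: "nat \<Rightarrow> real \<Rightarrow> complex"
  have "\<exists>u. s < 2 * m \<longrightarrow> Q s u" for s
  proof (cases "s < 2 * m")
    case True
    have "\<exists>u. Q s u"
      unfolding Q_def
      by (rule chi_basis_antidiagonal[where V = L1 and d = "\<lambda>r. d r (s - r)"]) (use True d in auto)
    then show ?thesis by blast
  qed simp
  then obtain us where "\<And>s. s < 2 * m \<Longrightarrow> Q s (us s)" by metis
  then have us: "\<And>s \<nu>. s < 2 * m \<Longrightarrow> \<nu> \<in> {2 * (s - m)..s} \<Longrightarrow> L1 (us s \<nu>)"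
    "\<And>s r x. s < 2 * m \<Longrightarrow> r \<in> {s - m..s - (s - m)} \<Longrightarrow>
       d r (s - r) x = (\<Sum>\<nu>=2 * (s - m)..s. us s \<nu> x * chi \<nu> (s - \<nu>) r (s - r))"
    "\<And>s. s < 2 * m \<Longrightarrow> 2 * (s - m) < s \<Longrightarrow> us s (2 * (s - m)) = (\<lambda>x. (d (s - m) (s - (s - m)) x + d (s - (s - m)) (s - (s - (s - m))) x) / 2)"
    "\<And>s. s < 2 * m \<Longrightarrow> 2 * (s - m) < s \<Longrightarrow> us s (Suc (2 * (s - m))) = (\<lambda>x. (d (s - m) (s - (s - m)) x - d (s - (s - m)) (s - (s - (s - m))) x) / 2)"
    unfolding Q_def by blast+
  define t where "t \<nu> i = us (\<nu> + i) \<nu>" for \<nu> i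
  \<comment> \<open>The admissible pairs with \<nu> + i = s are exactly those whose \<nu> occurs in
    the expansion of antidiagonal s.\<close>
  have range: "\<nu> < 2 * m \<and> \<nu> \<le> s \<and> s - \<nu> \<le> sing_order m \<nu> \<longleftrightarrow> \<nu> \<in> {2 * (s - m)..s}" if "s < 2 * m" for \<nu> s
  proof -
    obtain k e where ke: "\<nu> = 2 * k + e" "e \<le> 1" "\<nu> div 2 = k" "\<nu> mod 2 = e"
      by (rule that[of "\<nu> div 2" "\<nu> mod 2"]) (simp, presburger, simp, simp)
    have "\<nu> < 2 * m \<Longrightarrow> k + e \<le> m" using ke by linarith
    then show ?thesis
      using \<open>s < 2 * m\<close> ke(1,2) unfolding sing_order_def ke(3,4) atLeastAtMost_iff by linarith
  qed
  show ?thesis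
  proof (rule that)
    fix \<nu> i assume \<nu>: "\<nu> < 2 * m" "i \<le> sing_order m \<nu>"
    have s: "\<nu> + i < 2 * m"
      using sing_order_le[OF \<nu>] \<nu>(1) mult_div_mod_eq[of 2 \<nu>] by linarith
    show "L1 (t \<nu> i)"
      unfolding t_def by (rule us(1)[OF s]) (use range[OF s, of \<nu>] \<nu> in simp)
  next
    fix \<nu> assume \<nu>: "\<nu> < 2 * m"
    define k where "k = \<nu> div 2"
    have k: "k < m" "\<nu> + sing_order m \<nu> = m + k" using \<nu> unfolding k_def sing_order_def by presburger+
    \<comment> \<open>For the top index \<nu> + i = m + k, and the corners of this antidiagonal are
      the border entries (k, m) and (m, k). The corner formulas for the coefficients therefore
      preserve square integrability.\<close>
    have L2: "d k m \<in> Lp 2" "d m k \<in> Lp 2" using d2[OF k(1)] by auto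
    consider "\<nu> = 2 * k" | "\<nu> = Suc (2 * k)"
      unfolding k_def by (cases "even \<nu>") (auto elim!: evenE oddE)
    then show "t \<nu> (sing_order m \<nu>) \<in> Lp 2"
    proof cases
      case 1
      have "t \<nu> (sing_order m \<nu>) = (\<lambda>x. (1/2) * (d k m x + d m k x))"
        using us(3)[of "m + k"] k(1) unfolding t_def k(2) by (simp add: fun_eq_iff 1)
      then show ?thesis by (simp only: Lp2_cmult[OF Lp2_add[OF L2]])
    next
      case 2
      have "t \<nu> (sing_order m \<nu>) = (\<lambda>x. (1/2) * (d k m x - d m k x))"
        using us(4)[of "m + k"] k(1) unfolding t_def k(2) by (simp add: fun_eq_iff 2)
      then show ?thesis by (simp only: Lp2_cmult[OF Lp2_diff[OF L2]])
    qed
  next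
    fix r j x assume rj: "r \<le> m" "j \<le> m"
    show "d r j x = (\<Sum>\<nu><2 * m. \<Sum>i\<le>sing_order m \<nu>. t \<nu> i x * chi \<nu> i r j)"
    proof (cases "r + j < 2 * m")
      case True
      define s where "s = r + j"
      have s: "s < 2 * m" "j = s - r" "r \<in> {s - m..s - (s - m)}" using True rj by (auto simp: s_def)
      have inner: "(\<Sum>i\<le>sing_order m \<nu>. t \<nu> i x * chi \<nu> i r j) =
          (if \<nu> \<le> s \<and> s - \<nu> \<le> sing_order m \<nu> then us s \<nu> x * chi \<nu> (s - \<nu>) r (s - r) else 0)" for \<nu>
      proof -
        have "(\<Sum>i\<le>sing_order m \<nu>. t \<nu> i x * chi \<nu> i r j) =
          (\<Sum>i\<le>sing_order m \<nu>. if \<nu> \<le> s \<and> i = s - \<nu> then us s \<nu> x * chi \<nu> (s - \<nu>) r (s - r) else 0)"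
        proof (rule sum.cong[OF refl])
          fix i
          show "t \<nu> i x * chi \<nu> i r j = (if \<nu> \<le> s \<and> i = s - \<nu> then us s \<nu> x * chi \<nu> (s - \<nu>) r (s - r) else 0)"
          proof (cases "r + j = \<nu> + i")
            case True
            then have "\<nu> \<le> s" "i = s - \<nu>" "\<nu> + i = s" by (auto simp: s_def)
            then show ?thesis by (simp add: t_def s(2))
          next
            case False
            then have "\<not> (\<nu> \<le> s \<and> i = s - \<nu>)" unfolding s_def by linarith
            then show ?thesis by (simp only: chi_off_antidiagonal[OF False] if_False mult_zero_right)
          qed
        qed
        also have "\<dots> = (if \<nu> \<le> s \<and> s - \<nu> \<le> sing_order m \<nu> then us s \<nu> x * chi \<nu> (s - \<nu>) r (s - r) else 0)"
          by (cases "\<nu> \<le> s") (simp_all add: sum.delta)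
        finally show ?thesis .
      qed
      have "(\<Sum>\<nu><2 * m. \<Sum>i\<le>sing_order m \<nu>. t \<nu> i x * chi \<nu> i r j) =
         (\<Sum>\<nu>\<in>{2 * (s - m)..s}. us s \<nu> x * chi \<nu> (s - \<nu>) r (s - r))"
      proof -
        have "{\<nu> \<in> {..<2 * m}. \<nu> \<le> s \<and> s - \<nu> \<le> sing_order m \<nu>} = {2 * (s - m)..s}"
          using range[OF s(1)] by blast
        then show ?thesis
          unfolding inner by (subst sum.inter_filter[symmetric]) simp_all
      qed
      then show ?thesis using us(2)[OF s(1,3), of x] s(2) by simp
    next
      case False
      then have rj': "r = m" "j = m" using rj by auto
      have "(\<Sum>\<nu><2 * m. \<Sum>i\<le>sing_order m \<nu>. t \<nu> i x * chi \<nu> i m m) = 0"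
        by (intro sum.neutral ballI) (simp add: chi_last_entry)
      then show ?thesis by (simp add: rj' dmm)
    qed
  qed
qed

subsection \<open>The weak form of the quasi-derivative\<close>

text \<open>The class of Q that corresponds to \<open>matrix_class\<close> under
  \<open>S_map\<close>. The corner entry vanishes at every point, so identities involving it need no
  exceptional set.\<close>

definition regular_Q :: "nat \<Rightarrow> (nat \<Rightarrow> nat \<Rightarrow> real \<Rightarrow> complex) \<Rightarrow> bool" where
  "regular_Q m Q \<longleftrightarrow> (\<forall>r<m. \<forall>j<m. L1 (Q r j)) \<and> (\<forall>r<m. Q r m \<in> Lp 2 \<and> Q m r \<in> Lp 2) \<and> (\<forall>x. Q m m x = 0)"

lemma regular_Q_L1:
  assumes "regular_Q m Q" "r \<le> m" "j \<le> m"
  shows "L1 (Q r j)"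
proof -
  have "Q m m = (\<lambda>x. 0)" using assms(1) by (auto simp: regular_Q_def)
  moreover have "L1 (\<lambda>x. 0)" by (rule L1_const)
  ultimately show ?thesis
    using assms Lp2_imp_L1 unfolding regular_Q_def by (metis le_neq_implies_less)
qed

lemma regular_Q_last_row:
  assumes "regular_Q m Q" "j \<le> m"
  shows "Q m j \<in> Lp 2"
proof -
  have "Q m m = (\<lambda>x. 0)" using assms(1) by (auto simp: regular_Q_def)
  then show ?thesis
    using assms Lp2_const[of 0] unfolding regular_Q_def by (metis le_neq_implies_less)
qed

lemma S_map_entries:
  "j \<in> {1..m} \<Longrightarrow> S_map m Q m j = (\<lambda>x. (-1) ^ (m + 1) * Q (j - 1) m x)"
  "k \<in> {m + 1..2 * m} \<Longrightarrow> S_map m Q k (m + 1) = (\<lambda>x. (-1) ^ (k + 1) * Q m (2 * m - k) x)"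
  "k \<in> {m + 1..2 * m} \<Longrightarrow> j \<in> {1..m} \<Longrightarrow> S_map m Q k j =
     (\<lambda>x. (-1) ^ (k + 1) * Q (j - 1) (2 * m - k) x + (-1) ^ (m + k) * Q (j - 1) m x * Q m (2 * m - k) x)"
  "k < m \<or> j > m + 1 \<or> (k, j) = (m, m + 1) \<Longrightarrow> S_map m Q k j = (\<lambda>x. 0)"
  by (auto simp: S_map_def fun_eq_iff)

lemma S_map_regularity:
  assumes "regular_Q m Q"
  shows "j \<in> {1..m} \<Longrightarrow> S_map m Q m j \<in> Lp 2"
    "k \<in> {m + 1..2 * m} \<Longrightarrow> S_map m Q k (m + 1) \<in> Lp 2"
    "k \<in> {m + 1..2 * m} \<Longrightarrow> j \<in> {1..m} \<Longrightarrow> L1 (S_map m Q k j)"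
proof -
  have b: "Q r m \<in> Lp 2" "Q m r \<in> Lp 2" if "r < m" for r
    using assms that by (auto simp: regular_Q_def)
  show "S_map m Q m j \<in> Lp 2" if "j \<in> {1..m}"
    unfolding S_map_entries(1)[OF that] by (rule Lp2_cmult, rule b) (use that in auto)
  show "S_map m Q k (m + 1) \<in> Lp 2" if "k \<in> {m + 1..2 * m}"
    unfolding S_map_entries(2)[OF that] by (rule Lp2_cmult, rule b) (use that in auto)
  show "L1 (S_map m Q k j)" if "k \<in> {m + 1..2 * m}" "j \<in> {1..m}"
  proof -
    have "L1 (\<lambda>x. Q (j - 1) m x * Q m (2 * m - k) x)"
      by (rule Lp2_mult; rule b) (use that in auto)
    then have "L1 (\<lambda>x. (-1) ^ (m + k) * (Q (j - 1) m x * Q m (2 * m - k) x))"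
      by (rule integrable_mult_right)
    moreover have "L1 (\<lambda>x. (-1) ^ (k + 1) * Q (j - 1) (2 * m - k) x)"
      by (rule integrable_mult_right, rule regular_Q_L1[OF assms]) (use that in auto)
    ultimately show ?thesis
      unfolding S_map_entries(3)[OF that] mult.assoc by (intro Bochner_Integration.integrable_add)
  qed
qed

lemma S_map_L1:
  assumes "regular_Q m Q"
  shows "L1 (S_map m Q k j)"
proof -
  have "S_map m Q k j = (\<lambda>x. 0)" if "\<not> (k = m \<and> j \<in> {1..m})"
    "\<not> (k \<in> {m + 1..2 * m} \<and> j = m + 1)" "\<not> (k \<in> {m + 1..2 * m} \<and> j \<in> {1..m})"
    unfolding S_map_def using that by (simp only: if_False)
  then consider "k = m" "j \<in> {1..m}" | "k \<in> {m + 1..2 * m}" "j = m + 1" | "k \<in> {m + 1..2 * m}" "j \<in> {1..m}"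
    | "S_map m Q k j = (\<lambda>x. 0)"
    by blast
  then show ?thesis
    by cases (use S_map_regularity[OF assms] Lp2_imp_L1 L1_const in metis)+
qed

lemma matrix_class_if_S_map:
  assumes "regular_Q m Q" "matrix_ae_eq m F (S_map m Q)"
  shows "F \<in> matrix_class m"
proof -
  have ae: "AE x in unit_measure. S_map m Q k j x = F k j x" if "k \<in> {1..2 * m}" "j \<in> {1..2 * m}" for k j
    using assms(2) that AE_eq_sym unfolding matrix_ae_eq_def by blast
  have "F k j \<in> Lp 1" "F m j \<in> Lp 2" "F k (m + 1) \<in> Lp 2" if "k \<in> {m + 1..2 * m}" "j \<in> {1..m}" for k j
  proof -
    show "F k j \<in> Lp 1"
      unfolding Lp1_iff by (rule L1_AE_cong[OF S_map_regularity(3)[OF assms(1) that] ae]) (use that in auto)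
    show "F m j \<in> Lp 2"
      by (rule Lp2_AE_cong[OF S_map_regularity(1)[OF assms(1) that(2)] ae]) (use that in auto)
    show "F k (m + 1) \<in> Lp 2"
      by (rule Lp2_AE_cong[OF S_map_regularity(2)[OF assms(1) that(1)] ae]) (use that in auto)
  qed
  moreover have "AE x in unit_measure. F k j x = 0"
    if "k \<in> {1..2 * m}" "j \<in> {1..2 * m}" "k < m \<or> j > m + 1 \<or> (k, j) = (m, m + 1)" for k j
    using ae[OF that(1,2)] unfolding S_map_entries(4)[OF that(3)] by (rule AE_eq_sym)
  ultimately show ?thesis
    unfolding matrix_class_def by blast
qed

text \<open>Row m and column m + 1 of F determine the border of Q. The quadratic term in the
  remaining entries is built from the border alone, so it can be subtracted to obtain the inner
  entries.\<close>

lemma S_map_surjective: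
  assumes F: "F \<in> matrix_class m"
  obtains Q where "regular_Q m Q" "matrix_ae_eq m F (S_map m Q)"
proof -
  define Q where "Q r j = (if r = m then (if j = m then (\<lambda>x. 0) else (\<lambda>x. (-1) ^ (2 * m - j + 1) * F (2 * m - j) (m + 1) x))
      else if j = m then (\<lambda>x. (-1) ^ (m + 1) * F m (r + 1) x)
      else (\<lambda>x. (-1) ^ (2 * m - j + 1) * (F (2 * m - j) (r + 1) x - (-1) ^ (m + (2 * m - j)) *
        (((-1) ^ (m + 1) * F m (r + 1) x) * ((-1) ^ (2 * m - j + 1) * F (2 * m - j) (m + 1) x)))))" for r j
  have F': "\<And>k j. k \<in> {m + 1..2 * m} \<Longrightarrow> j \<in> {1..m} \<Longrightarrow> F k j \<in> Lp 1 \<and> F m j \<in> Lp 2 \<and> F k (m + 1) \<in> Lp 2"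
    "\<And>k j. k \<in> {1..2 * m} \<Longrightarrow> j \<in> {1..2 * m} \<Longrightarrow> k < m \<or> j > m + 1 \<or> (k, j) = (m, m + 1) \<Longrightarrow> AE x in unit_measure. F k j x = 0"
    using F unfolding matrix_class_def by blast+
  have L2: "F (2 * m - j) (m + 1) \<in> Lp 2" "F m (j + 1) \<in> Lp 2" if "j < m" for j
    using F'(1)[of "2 * m - j" 1] F'(1)[of "2 * m" "j + 1"] that by auto
  have "L1 (Q r j)" if "r < m" "j < m" for r j
  proof -
    have "L1 (F (2 * m - j) (r + 1))" using F'(1)[of "2 * m - j" "r + 1"] that Lp1_iff by auto
    moreover have "L1 (\<lambda>x. ((-1) ^ (m + 1) * F m (r + 1) x) * ((-1) ^ (2 * m - j + 1) * F (2 * m - j) (m + 1) x))"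
      by (intro Lp2_mult Lp2_cmult L2 that)
    ultimately have "L1 (\<lambda>x. (-1) ^ (2 * m - j + 1) * (F (2 * m - j) (r + 1) x - (-1) ^ (m + (2 * m - j)) *
        (((-1) ^ (m + 1) * F m (r + 1) x) * ((-1) ^ (2 * m - j + 1) * F (2 * m - j) (m + 1) x))))"
      by (intro integrable_mult_right Bochner_Integration.integrable_diff)
    moreover have "Q r j = (\<lambda>x. (-1) ^ (2 * m - j + 1) * (F (2 * m - j) (r + 1) x - (-1) ^ (m + (2 * m - j)) *
        (((-1) ^ (m + 1) * F m (r + 1) x) * ((-1) ^ (2 * m - j + 1) * F (2 * m - j) (m + 1) x))))"
      using that by (simp add: Q_def)
    ultimately show ?thesis by (simp only:)
  qed
  moreover have "Q r m \<in> Lp 2 \<and> Q m r \<in> Lp 2" if "r < m" for r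
    using Lp2_cmult[OF L2(2)[OF that], of "(-1) ^ (m + 1)"] Lp2_cmult[OF L2(1)[OF that], of "(-1) ^ (2 * m - r + 1)"] that
    by (simp add: Q_def)
  ultimately have "regular_Q m Q"
    unfolding regular_Q_def by (simp add: Q_def)
  moreover have "matrix_ae_eq m F (S_map m Q)"
    unfolding matrix_ae_eq_def
  proof (intro ballI)
    fix k j assume kj: "k \<in> {1..2 * m}" "j \<in> {1..2 * m}"
    have sq: "(-1) ^ n * ((-1) ^ n * z) = z" for n and z :: complex
      by (simp flip: mult.assoc power_add)
    consider "k < m \<or> j > m + 1 \<or> (k, j) = (m, m + 1)" | "k = m" "j \<in> {1..m}"
      | "k \<in> {m + 1..2 * m}" "j = m + 1" | "k \<in> {m + 1..2 * m}" "j \<in> {1..m}"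
      using kj by force
    then show "AE x in unit_measure. F k j x = S_map m Q k j x"
    proof cases
      case 1
      show ?thesis using F'(2)[OF kj 1] unfolding S_map_entries(4)[OF 1] .
    next
      case 2
      have "Q (j - 1) m = (\<lambda>x. (-1) ^ (m + 1) * F m j x)" using 2 by (auto simp: Q_def)
      then show ?thesis unfolding 2(1) S_map_entries(1)[OF 2(2)] by (simp only: sq) simp
    next
      case 3
      have "Q m (2 * m - k) = (\<lambda>x. (-1) ^ (k + 1) * F k (m + 1) x)" using 3 by (auto simp: Q_def)
      then show ?thesis unfolding 3(2) S_map_entries(2)[OF 3(1)] by (simp only: sq) simp
    next
      case 4
      have "Q (j - 1) (2 * m - k) = (\<lambda>x. (-1) ^ (k + 1) * (F k j x - (-1) ^ (m + k) * (Q (j - 1) m x * Q m (2 * m - k) x)))"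
        using 4 by (auto simp: Q_def)
      then show ?thesis unfolding S_map_entries(3)[OF 4] by (simp only: sq mult.assoc) simp
    qed
  qed
  ultimately show ?thesis using that by blast
qed

definition Q_form :: "nat \<Rightarrow> (nat \<Rightarrow> nat \<Rightarrow> real \<Rightarrow> complex) \<Rightarrow> (nat \<Rightarrow> real \<Rightarrow> complex) \<Rightarrow> (real \<Rightarrow> complex) \<Rightarrow> real \<Rightarrow> complex" where
  "Q_form m Q v z x = (\<Sum>r\<le>m. \<Sum>j\<le>m. Q r j x * (v r x * nderiv j z x))"

text \<open>W_2^m in terms of representatives: v r stands for the r-th derivative of y, and only the
  last one is not continuous but square integrable.\<close>

definition form_domain :: "nat \<Rightarrow> (nat \<Rightarrow> real \<Rightarrow> complex) \<Rightarrow> bool" where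
  "form_domain m v \<longleftrightarrow> ac_chain m v \<and> v m \<in> Lp 2"

lemma form_domain_Lp2:
  assumes "form_domain m v" "r \<le> m"
  shows "v r \<in> Lp 2"
proof (cases "r = m")
  case False
  then show ?thesis
    using assms ac_chain_continuous[of m v r] continuous_imp_Lp2 by (auto simp: form_domain_def)
qed (use assms in \<open>simp add: form_domain_def\<close>)

lemma Q_form_term_L1:
  assumes "regular_Q m Q" "form_domain m v" "z \<in> test_functions" "r \<le> m" "j \<le> m"
  shows "L1 (\<lambda>x. Q r j x * (v r x * nderiv j z x))"
proof -
  have "L1 (\<lambda>x. Q r j x * v r x)"
  proof (cases "r = m")
    case True
    then show ?thesis
      using Lp2_mult[OF regular_Q_last_row[OF assms(1,5)] form_domain_Lp2[OF assms(2,4)]] by simp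
  next
    case False
    then show ?thesis
      using assms by (intro L1_mult_continuous regular_Q_L1 ac_chain_continuous) (auto simp: form_domain_def)
  qed
  from L1_mult_test[OF this test_nderiv[OF assms(3), of j]] show ?thesis
    by (simp only: mult.assoc)
qed

lemma Q_form_L1:
  assumes "regular_Q m Q" "form_domain m v" "z \<in> test_functions"
  shows "L1 (Q_form m Q v z)"
  unfolding Q_form_def[abs_def]
  by (intro Bochner_Integration.integrable_sum Q_form_term_L1[OF assms]) auto

lemma ac_chain_unique_AE:
  assumes "ac_chain i v" "ac_chain i w" "AE x in unit_measure. v 0 x = w 0 x" "l \<le> i"
  shows "AE x in unit_measure. v l x = w l x"
  using ac_chain_weak_deriv(1)[OF assms(1,4), of "v 0"] ac_chain_weak_deriv(1)[OF assms(2,4,3)]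
  by (auto elim: AE_mp)

text \<open>One step of the recursion, moved from chosen weak derivatives and from F, which is known
  up to null sets, to absolutely continuous Y and the exact \<open>S_map\<close>.\<close>

lemma quasi_deriv_step:
  assumes F: "matrix_ae_eq m F (S_map m Q)" and k: "k < 2 * m" and Y: "ac_deriv (Y k) D"
    and y: "\<And>j. j \<le> k \<Longrightarrow> AE x in unit_measure. quasi_deriv F y j x = Y j x"
  shows "AE x in unit_measure. quasi_deriv F y (Suc k) x = D x - (\<Sum>j\<le>k. S_map m Q (Suc k) (Suc j) x * Y j x)"
proof -
  have "ac_chain 1 (\<lambda>l. if l = 0 then Y k else D)"
    using Y by (auto simp: ac_chain_def ac_deriv_L1)
  from ac_chain_weak_deriv(1)[OF this order_refl, of "quasi_deriv F y k"] y[OF order_refl]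
  have 1: "AE x in unit_measure. weak_deriv 1 (quasi_deriv F y k) x = D x" by simp
  have 2: "AE x in unit_measure. \<forall>j\<in>{..k}. F (Suc k) (Suc j) x * quasi_deriv F y j x = S_map m Q (Suc k) (Suc j) x * Y j x"
  proof (rule AE_finite_allI)
    fix j assume j: "j \<in> {..k}"
    have "AE x in unit_measure. F (Suc k) (Suc j) x = S_map m Q (Suc k) (Suc j) x"
      using F k j unfolding matrix_ae_eq_def by auto
    moreover have "AE x in unit_measure. quasi_deriv F y j x = Y j x" using y j by auto
    ultimately show "AE x in unit_measure. F (Suc k) (Suc j) x * quasi_deriv F y j x = S_map m Q (Suc k) (Suc j) x * Y j x"
      by eventually_elim simp
  qed simp
  have reidx: "(\<Sum>j=1..Suc k. f j) = (\<Sum>j\<le>k. f (Suc j))" for f :: "nat \<Rightarrow> complex"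
    by (rule sum.reindex_bij_witness[of _ Suc "\<lambda>j. j - 1"]) auto
  show ?thesis
    using 1 2
  proof eventually_elim
    case (elim x)
    have "(\<Sum>j=1..Suc k. F (Suc k) j x * quasi_deriv F y (j - 1) x) = (\<Sum>j\<le>k. S_map m Q (Suc k) (Suc j) x * Y j x)"
      unfolding reidx using elim(2) by (intro sum.cong) auto
    then show ?case using elim(1) by simp
  qed
qed

lemma quasi_deriv_form:
  assumes m: "m \<ge> 1" and Q: "regular_Q m Q" and F: "matrix_ae_eq m F (S_map m Q)" and y: "y \<in> quasi_domain m F"
  obtains v where "form_domain m v" "AE x in unit_measure. y x = v 0 x"
    "\<And>z. z \<in> test_functions \<Longrightarrow> regular_dist (quasi_deriv F y (2 * m)) z =
       (-1) ^ m * (\<integral>x. v m x * nderiv m z x \<partial>unit_measure) + (\<integral>x. Q_form m Q v z x \<partial>unit_measure)"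
proof -
  let ?S = "S_map m Q"
  have "\<exists>h g. ac_deriv h g \<and> (AE x in unit_measure. quasi_deriv F y k x = h x)" if "k < 2 * m" for k
    using y that sobolev_1_1E[of "quasi_deriv F y k"] unfolding quasi_domain_def by blast
  then obtain Y D where YD: "\<And>k. k < 2 * m \<Longrightarrow> ac_deriv (Y k) (D k)"
    "\<And>k. k < 2 * m \<Longrightarrow> AE x in unit_measure. quasi_deriv F y k x = Y k x"
    by metis
  \<comment> \<open>The last quasi-derivative has no absolutely continuous representative in
    general, so it must enter the common recursion as it is.\<close>
  define N where "N k = (if k = 2 * m then quasi_deriv F y (2 * m) else Y k)" for k
  have Yc: "continuous_on {0..1} (Y k)" if "k < 2 * m" for k
    using YD(1)[OF that] by (rule ac_deriv_continuous)
  have step: "AE x in unit_measure. N (Suc k) x = D k x - (\<Sum>j\<le>k. ?S (Suc k) (Suc j) x * Y j x)" if k: "k < 2 * m" for k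
  proof -
    have 3: "AE x in unit_measure. N (Suc k) x = quasi_deriv F y (Suc k) x"
    proof (cases "Suc k = 2 * m")
      case False
      then have "Suc k < 2 * m" using k by simp
      from AE_eq_sym[OF YD(2)[OF this]] False show ?thesis by (simp add: N_def)
    qed (simp add: N_def)
    have "AE x in unit_measure. quasi_deriv F y (Suc k) x = D k x - (\<Sum>j\<le>k. ?S (Suc k) (Suc j) x * Y j x)"
      by (rule quasi_deriv_step[where Y = Y, OF F k YD(1)[OF k] YD(2)]) (use k in simp)
    with 3 show ?thesis by eventually_elim simp
  qed
  \<comment> \<open>The m-th entry is the derivative of Y (m - 1), not Y m: the m-th
    quasi-derivative differs from the m-th derivative by row m of F.\<close>
  define v where "v r = (if r < m then Y r else D (m - 1))" for r
  have low: "AE x in unit_measure. D k x = Y (Suc k) x" if "Suc k < m" for k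
  proof -
    have "k < 2 * m" "N (Suc k) = Y (Suc k)" using that by (auto simp: N_def)
    moreover have "(\<Sum>j\<le>k. ?S (Suc k) (Suc j) x * Y j x) = 0" for x
      using that by (intro sum.neutral) (simp add: S_map_entries(4))
    ultimately have "AE x in unit_measure. Y (Suc k) x = D k x" using step[of k] by simp
    then show ?thesis by (rule AE_eq_sym)
  qed
  have vY: "v r = Y r" if "r < m" for r using that by (simp add: v_def)
  have chain: "ac_chain m v"
    unfolding ac_chain_def
  proof (intro conjI allI impI)
    fix r assume r: "r < m"
    show "ac_deriv (v r) (v (Suc r))"
    proof (cases "Suc r = m")
      case True
      then show ?thesis using YD(1)[of r] r by (auto simp: v_def)
    next
      case False
      then have "Suc r < m" using r by simp
      then show ?thesis
        using ac_deriv_cong_AE[OF YD(1)[of r] low[of r]] by (simp add: v_def)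
    qed
  next
    show "L1 (v m)" using ac_deriv_L1[OF YD(1)[of "m - 1"]] m by (simp add: v_def)
  qed
  have Ym: "AE x in unit_measure. v m x = Y m x + (-1) ^ (m + 1) * (\<Sum>r<m. Q r m x * v r x)"
  proof -
    have km: "Suc (m - 1) = m" "N m = Y m" "m - 1 < 2 * m" using m by (auto simp: N_def)
    have "(\<Sum>j\<le>m - 1. ?S m (Suc j) x * Y j x) = (-1) ^ (m + 1) * (\<Sum>r<m. Q r m x * v r x)" for x
    proof -
      have "{..m - 1} = {..<m}" using m by auto
      then show ?thesis
        unfolding sum_distrib_left by (intro sum.cong) (auto simp: S_map_entries(1) vY)
    qed
    with step[OF km(3)] have "AE x in unit_measure. Y m x = D (m - 1) x - (-1) ^ (m + 1) * (\<Sum>r<m. Q r m x * v r x)"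
      unfolding km(1,2) by simp
    then show ?thesis by eventually_elim (simp add: v_def)
  qed
  have "(\<lambda>x. Y m x + (-1) ^ (m + 1) * (\<Sum>r<m. Q r m x * v r x)) \<in> Lp 2"
  proof -
    have "(\<lambda>x. v r x * Q r m x) \<in> Lp 2" if "r < m" for r
      using that Q ac_chain_continuous[OF chain that] by (intro Lp2_continuous_mult) (auto simp: regular_Q_def)
    then have "(\<lambda>x. \<Sum>r<m. Q r m x * v r x) \<in> Lp 2" by (intro Lp2_sum) (auto simp: mult.commute)
    moreover have "Y m \<in> Lp 2" using m by (intro continuous_imp_Lp2 Yc) auto
    ultimately show ?thesis by (intro Lp2_add Lp2_cmult)
  qed
  then have "v m \<in> Lp 2" using AE_eq_sym[OF Ym] by (rule Lp2_AE_cong)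
  with chain have dom: "form_domain m v" by (simp add: form_domain_def)
  have y0: "AE x in unit_measure. y x = v 0 x"
    using YD(2)[of 0] m by (simp add: v_def)
  \<comment> \<open>The index i counts rows from the bottom: row 2m - i of \<open>S_map\<close>
    carries column i of Q.\<close>
  have row: "AE x in unit_measure. N (2 * m - i) x = D (2 * m - i - 1) x + (-1) ^ i * (\<Sum>r\<le>m. Q r i x * v r x)"
    if i: "i < m" for i
  proof -
    define k where "k = 2 * m - i - 1"
    have k: "Suc k = 2 * m - i" "k < 2 * m" "m \<le> k" "Suc k \<in> {m + 1..2 * m}" "2 * m - Suc k = i"
      using i by (auto simp: k_def)
    have sgn: "(-1) ^ (Suc k + 1) = - ((-1) ^ i :: complex)" "(-1) ^ (m + Suc k) = (-1) ^ m * ((-1) ^ i :: complex)"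
    proof -
      have "even (Suc k + i)" unfolding k(1) using i by simp
      then have "even (Suc k) \<longleftrightarrow> even i" by simp
      then show "(-1) ^ (Suc k + 1) = - ((-1) ^ i :: complex)" "(-1) ^ (m + Suc k) = (-1) ^ m * ((-1) ^ i :: complex)"
        by (auto simp: minus_one_power_iff)
    qed
    have g: "(\<Sum>j\<le>k. ?S (Suc k) (Suc j) x * Y j x) =
        (\<Sum>r<m. (- ((-1) ^ i) * Q r i x + (-1) ^ m * (-1) ^ i * Q r m x * Q m i x) * v r x) + - ((-1) ^ i) * Q m i x * Y m x" for x
    proof -
      have "(\<Sum>j\<le>k. ?S (Suc k) (Suc j) x * Y j x) = (\<Sum>j\<in>{..<m} \<union> {m}. ?S (Suc k) (Suc j) x * Y j x)"
        using k(3) by (intro sum.mono_neutral_right) (auto simp: S_map_entries(4))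
      also have "\<dots> = (\<Sum>j<m. ?S (Suc k) (Suc j) x * Y j x) + ?S (Suc k) (Suc m) x * Y m x"
        by (subst sum.union_disjoint) auto
      also have "?S (Suc k) (Suc m) x = - ((-1) ^ i) * Q m i x"
        using S_map_entries(2)[OF k(4), of Q] unfolding k(5) sgn by simp
      also have "(\<Sum>j<m. ?S (Suc k) (Suc j) x * Y j x) =
          (\<Sum>r<m. (- ((-1) ^ i) * Q r i x + (-1) ^ m * (-1) ^ i * Q r m x * Q m i x) * v r x)"
      proof (rule sum.cong[OF refl])
        fix j assume "j \<in> {..<m}"
        then have j: "Suc j \<in> {1..m}" "j < m" by auto
        show "?S (Suc k) (Suc j) x * Y j x = (- ((-1) ^ i) * Q j i x + (-1) ^ m * (-1) ^ i * Q j m x * Q m i x) * v j x"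
          using S_map_entries(3)[OF k(4) j(1), of Q] unfolding k(5) sgn vY[OF j(2)] by simp
      qed
      finally show ?thesis .
    qed
    show ?thesis
      using step[OF k(2)] Ym
    proof eventually_elim
      case (elim x)
      define s where "s = ((-1) ^ i :: complex)"
      define e where "e = ((-1) ^ m :: complex)"
      have ee: "e * e = 1" by (simp add: e_def flip: power_add)
      have split: "(\<Sum>r\<le>m. Q r i x * v r x) = (\<Sum>r<m. Q r i x * v r x) + Q m i x * v m x"
        by (simp add: lessThan_Suc_atMost[symmetric])
      have "(\<Sum>r<m. (- s * Q r i x + e * s * Q r m x * Q m i x) * v r x) =
          - s * (\<Sum>r<m. Q r i x * v r x) + e * s * Q m i x * (\<Sum>r<m. Q r m x * v r x)"
        by (simp add: distrib_right distrib_left right_diff_distrib sum.distrib sum_subtractf sum_distrib_left sum_negf mult_ac)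
      then have "N (Suc k) x = D k x + s * (\<Sum>r<m. Q r i x * v r x) - e * s * Q m i x * (\<Sum>r<m. Q r m x * v r x) + s * Q m i x * Y m x"
        using elim(1) unfolding g s_def[symmetric] e_def[symmetric] by simp
      \<comment> \<open>Replacing the m-th quasi-derivative by the m-th derivative produces exactly
        the negative of the quadratic term. This cancellation is the reason for that term in
        \<open>S_map\<close>.\<close>
      also have "Y m x = v m x + e * (\<Sum>r<m. Q r m x * v r x)"
        using elim(2) by (simp add: e_def)
      finally have "N (Suc k) x = D k x + s * (\<Sum>r\<le>m. Q r i x * v r x)"
        unfolding split by (simp add: algebra_simps)
      then show ?case unfolding s_def k(1) unfolding k_def .
    qed
  qed
  have formula: "regular_dist (quasi_deriv F y (2 * m)) z =
       (-1) ^ m * (\<integral>x. v m x * nderiv m z x \<partial>unit_measure) + (\<integral>x. Q_form m Q v z x \<partial>unit_measure)"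
    if z: "z \<in> test_functions" for z
  proof -
    define q where "q i x = (\<Sum>r\<le>m. Q r i x * v r x)" for i x
    have Lq0: "L1 (\<lambda>x. Q r i x * v r x)" if "r \<le> m" "i \<le> m" for r i
    proof (cases "r = m")
      case True
      then show ?thesis
        using Lp2_mult[OF regular_Q_last_row[OF Q that(2)] form_domain_Lp2[OF dom that(1)]] by simp
    next
      case False
      then have "r < m" using that by simp
      then show ?thesis by (rule L1_mult_continuous[OF regular_Q_L1[OF Q that] ac_chain_continuous[OF chain]])
    qed
    then have Lq: "L1 (q i)" if "i \<le> m" for i
      unfolding q_def using that by (intro Bochner_Integration.integrable_sum) auto
    \<comment> \<open>Each integration by parts moves one derivative to z and releases the
      contribution of one column of Q.\<close>
    have ind: "(\<integral>x. N (2 * m) x * z x \<partial>unit_measure) = (-1) ^ e * (\<integral>x. N (2 * m - e) x * nderiv e z x \<partial>unit_measure)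
        + (\<Sum>i<e. \<integral>x. q i x * nderiv i z x \<partial>unit_measure)" if "e \<le> m" for e
      using that
    proof (induction e)
      case (Suc e)
      have e: "e < m" using Suc.prems by simp
      define k where "k = 2 * m - Suc e"
      have k: "2 * m - e - 1 = k" "k < 2 * m" "2 * m - Suc e = k" "N k = Y k" using e by (auto simp: k_def N_def)
      have ze: "nderiv e z \<in> test_functions" using z by (rule test_nderiv)
      have Lk: "L1 (D k)" using YD(1)[OF k(2)] by (rule ac_deriv_L1)
      have "(\<integral>x. N (2 * m - e) x * nderiv e z x \<partial>unit_measure) =
          (\<integral>x. D k x * nderiv e z x + (-1) ^ e * (q e x * nderiv e z x) \<partial>unit_measure)"
      proof (rule integral_cong_L1_AE[symmetric])
        show "L1 (\<lambda>x. D k x * nderiv e z x + (-1) ^ e * (q e x * nderiv e z x))"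
          using L1_mult_test[OF Lk ze] L1_mult_test[OF Lq ze] e by simp
        show "AE x in unit_measure. D k x * nderiv e z x + (-1) ^ e * (q e x * nderiv e z x) = N (2 * m - e) x * nderiv e z x"
          using row[OF e, unfolded k(1)] by eventually_elim (simp add: q_def distrib_right mult.assoc)
      qed
      also have "\<dots> = (\<integral>x. D k x * nderiv e z x \<partial>unit_measure) + (-1) ^ e * (\<integral>x. q e x * nderiv e z x \<partial>unit_measure)"
        using L1_mult_test[OF Lk ze] L1_mult_test[OF Lq ze] e by simp
      also have "(\<integral>x. D k x * nderiv e z x \<partial>unit_measure) = - (\<integral>x. Y k x * nderiv (Suc e) z x \<partial>unit_measure)"
        using integral_mult_test_by_parts[OF YD(1)[OF k(2)] ze] by (simp add: nderiv_nderiv)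
      finally have eq: "(\<integral>x. N (2 * m - e) x * nderiv e z x \<partial>unit_measure) =
        - (\<integral>x. Y k x * nderiv (Suc e) z x \<partial>unit_measure) + (-1) ^ e * (\<integral>x. q e x * nderiv e z x \<partial>unit_measure)" .
      have sq: "(-1) ^ e * ((-1) ^ e * w) = w" for w :: complex
        by (simp flip: mult.assoc power_add)
      show ?case
        using Suc.IH e unfolding eq k(3,4) by (simp add: distrib_left right_diff_distrib sq)
    qed simp
    have Nm: "N (2 * m - m) = Y m" using m by (simp add: N_def)
    have zm: "nderiv m z \<in> test_functions" using z by (rule test_nderiv)
    have Lv: "L1 (\<lambda>x. v m x * nderiv m z x)"
      by (rule L1_mult_test[OF ac_chain_L1[OF chain order_refl] zm])
    have Lqm: "L1 (\<lambda>x. q m x * nderiv m z x)" by (rule L1_mult_test[OF Lq zm]) simp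
    have "(\<integral>x. Y m x * nderiv m z x \<partial>unit_measure) = (\<integral>x. v m x * nderiv m z x + (-1) ^ m * (q m x * nderiv m z x) \<partial>unit_measure)"
    proof (rule integral_cong_L1_AE[symmetric])
      show "L1 (\<lambda>x. v m x * nderiv m z x + (-1) ^ m * (q m x * nderiv m z x))"
        using Lv Lqm by simp
      show "AE x in unit_measure. v m x * nderiv m z x + (-1) ^ m * (q m x * nderiv m z x) = Y m x * nderiv m z x"
        using Ym
      proof eventually_elim
        case (elim x)
        have "Q m m x = 0" using Q by (simp add: regular_Q_def)
        then have "q m x = (\<Sum>r<m. Q r m x * v r x)" by (simp add: q_def lessThan_Suc_atMost[symmetric])
        then show ?case unfolding elim by (simp add: algebra_simps)
      qed
    qed
    also have "\<dots> = (\<integral>x. v m x * nderiv m z x \<partial>unit_measure) + (-1) ^ m * (\<integral>x. q m x * nderiv m z x \<partial>unit_measure)"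
      using Lv Lqm by simp
    finally have eqm: "(\<integral>x. Y m x * nderiv m z x \<partial>unit_measure) = \<dots>" .
    have sq: "(-1) ^ m * ((-1) ^ m * w) = w" for w :: complex
      by (simp flip: mult.assoc power_add)
    have "(\<integral>x. N (2 * m) x * z x \<partial>unit_measure) = (-1) ^ m * (\<integral>x. v m x * nderiv m z x \<partial>unit_measure)
        + (\<Sum>i\<le>m. \<integral>x. q i x * nderiv i z x \<partial>unit_measure)"
      using ind[OF order_refl] unfolding Nm eqm
      by (simp add: distrib_left sq lessThan_Suc_atMost[symmetric])
    also have "(\<Sum>i\<le>m. \<integral>x. q i x * nderiv i z x \<partial>unit_measure) = (\<integral>x. (\<Sum>i\<le>m. q i x * nderiv i z x) \<partial>unit_measure)"
      by (rule Bochner_Integration.integral_sum[symmetric]) (use L1_mult_test[OF Lq test_nderiv[OF z]] in auto)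
    also have "(\<lambda>x. \<Sum>i\<le>m. q i x * nderiv i z x) = Q_form m Q v z"
      unfolding Q_form_def[abs_def] q_def sum_distrib_right by (subst sum.swap) (simp add: mult.assoc)
    finally show ?thesis
      using z by (simp add: regular_dist_test N_def)
  qed
  show ?thesis using that[OF dom y0 formula] .
qed

subsection \<open>The weak form of the differential expression\<close>

lemma sum_even_odd:
  fixes f :: "nat \<Rightarrow> 'a::comm_monoid_add"
  shows "(\<Sum>\<nu><2 * m. f \<nu>) = (\<Sum>k<m. f (2 * k) + f (2 * k + 1))"
  by (induction m) (simp_all add: add.assoc)

lemma leibniz_Lp2:
  assumes "\<And>p. p \<le> i \<Longrightarrow> a p \<in> Lp 2" "\<And>p. continuous_on {0..1} (b p)"
  shows "(\<lambda>x. leibniz i (\<lambda>p. a p x) (\<lambda>p. b p x)) \<in> Lp 2"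
proof -
  have "(\<lambda>x. of_nat (i choose p) * a p x * b (i - p) x) \<in> Lp 2" if "p \<le> i" for p
    using Lp2_continuous_mult[OF assms(2) Lp2_cmult[OF assms(1)[OF that], of "of_nat (i choose p)"], of "i - p"]
    by (simp only: mult.commute)
  then show ?thesis unfolding leibniz_def by (intro Lp2_sum) simp
qed

text \<open>The pairing is to play the role of a nonsmooth test function: being a chain, L2 at the
  top and zero at both ends is what \<open>functional_vanishes_on_ac_chain\<close> asks of it. The
  zeros come from z.\<close>

lemma pairing_chain:
  assumes v: "form_domain m v" and z: "z \<in> test_functions" and \<nu>: "\<nu> < 2 * m"
  shows "ac_chain (sing_order m \<nu>) (\<lambda>l x. pairing \<nu> l (\<lambda>r. v r x) (\<lambda>j. nderiv j z x))"
    "i \<le> sing_order m \<nu> \<Longrightarrow> (\<lambda>x. pairing \<nu> i (\<lambda>r. v r x) (\<lambda>j. nderiv j z x)) \<in> Lp 2"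
    "x \<in> {0, 1} \<Longrightarrow> pairing \<nu> i (\<lambda>r. v r x) (\<lambda>j. nderiv j z x) = 0"
proof -
  let ?k = "\<nu> div 2"
  have c: "ac_chain m v" using v by (simp add: form_domain_def)
  have sz: "smooth z" using z by (rule test_smooth)
  have zc: "continuous_on {0..1} (nderiv j z)" for j
    using sz by (intro smooth_continuous smooth_nderiv)
  have le: "l + ?k + \<nu> mod 2 \<le> m" if "l \<le> sing_order m \<nu>" for l
    using sing_order_le[OF \<nu> that] .
  show "ac_chain (sing_order m \<nu>) (\<lambda>l x. pairing \<nu> l (\<lambda>r. v r x) (\<lambda>j. nderiv j z x))"
  proof (cases "even \<nu>")
    case True
    have "ac_chain (sing_order m \<nu>) (\<lambda>p. v (?k + p))"
      by (rule ac_chain_shift[OF c]) (use le[OF order_refl] in simp)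
    from ac_chain_leibniz_smooth[OF this sz, of ?k] show ?thesis
      using True by (simp add: pairing_def Let_def)
  next
    case False
    have "ac_chain (sing_order m \<nu>) (\<lambda>p. v (?k + p))" "ac_chain (sing_order m \<nu>) (\<lambda>p. v (Suc ?k + p))"
      by (rule ac_chain_shift[OF c]; use le[OF order_refl] False in \<open>simp add: odd_iff_mod_2_eq_one\<close>)+
    from ac_chain_diff[OF ac_chain_leibniz_smooth[OF this(1) sz, of "Suc ?k"] ac_chain_leibniz_smooth[OF this(2) sz, of ?k]]
    show ?thesis using False by (simp add: pairing_def Let_def)
  qed
  show "(\<lambda>x. pairing \<nu> i (\<lambda>r. v r x) (\<lambda>j. nderiv j z x)) \<in> Lp 2" if i: "i \<le> sing_order m \<nu>"
  proof (cases "even \<nu>")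
    case True
    have "(\<lambda>x. leibniz i (\<lambda>p. v (?k + p) x) (\<lambda>p. nderiv (?k + p) z x)) \<in> Lp 2"
      by (rule leibniz_Lp2[OF form_domain_Lp2[OF v] zc]) (use le[OF i] in simp)
    then show ?thesis using True by (simp add: pairing_def Let_def)
  next
    case False
    have "(\<lambda>x. leibniz i (\<lambda>p. v (?k + p) x) (\<lambda>p. nderiv (Suc (?k + p)) z x)) \<in> Lp 2"
      by (rule leibniz_Lp2[OF form_domain_Lp2[OF v] zc]) (use le[OF i] in simp)
    moreover have "(\<lambda>x. leibniz i (\<lambda>p. v (Suc (?k + p)) x) (\<lambda>p. nderiv (?k + p) z x)) \<in> Lp 2"
      by (rule leibniz_Lp2[OF form_domain_Lp2[OF v] zc]) (use le[OF i] False in \<open>simp add: odd_iff_mod_2_eq_one\<close>)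
    ultimately have "(\<lambda>x. leibniz i (\<lambda>p. v (?k + p) x) (\<lambda>p. nderiv (Suc (?k + p)) z x)
        - leibniz i (\<lambda>p. v (Suc (?k + p)) x) (\<lambda>p. nderiv (?k + p) z x)) \<in> Lp 2"
      by (rule Lp2_diff)
    then show ?thesis using False by (simp add: pairing_def Let_def)
  qed
  show "pairing \<nu> i (\<lambda>r. v r x) (\<lambda>j. nderiv j z x) = 0" if "x \<in> {0, 1}"
  proof -
    have "nderiv j z x = 0" for j
      using test_vanish[OF test_nderiv[OF z]] that by auto
    then show ?thesis by (simp add: pairing_def leibniz_def Let_def)
  qed
qed

lemma coefficient_pairing_L1:
  assumes v: "form_domain m v" and z: "z \<in> test_functions" and \<nu>: "\<nu> < 2 * m" and i: "i \<le> sing_order m \<nu>"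
    and t: "L1 t" "i = sing_order m \<nu> \<Longrightarrow> t \<in> Lp 2"
  shows "L1 (\<lambda>x. t x * pairing \<nu> i (\<lambda>r. v r x) (\<lambda>j. nderiv j z x))"
proof (cases "i = sing_order m \<nu>")
  case True
  show ?thesis by (rule Lp2_mult[OF t(2)[OF True] pairing_chain(2)[OF v z \<nu> i]])
next
  case False
  then have "i < sing_order m \<nu>" using i by simp
  from L1_mult_continuous[OF t(1) ac_chain_continuous[OF pairing_chain(1)[OF v z \<nu>] this]] show ?thesis .
qed

text \<open>This is literally the choice made inside \<^const>\<open>dist_prod\<close>.\<close>

definition primitive :: "nat \<Rightarrow> functional \<Rightarrow> real \<Rightarrow> complex" where
  "primitive i T = (SOME \<sigma>. \<sigma> \<in> Lp 2 \<and> T = (dist_deriv ^^ i) (regular_dist \<sigma>))"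

lemma primitive:
  assumes "T \<in> neg_sobolev i"
  shows "primitive i T \<in> Lp 2" "T = (dist_deriv ^^ i) (regular_dist (primitive i T))"
proof -
  have "\<exists>\<sigma>. \<sigma> \<in> Lp 2 \<and> T = (dist_deriv ^^ i) (regular_dist \<sigma>)"
    using assms by (auto simp: neg_sobolev_def)
  from someI_ex[OF this] show "primitive i T \<in> Lp 2" "T = (dist_deriv ^^ i) (regular_dist (primitive i T))"
    unfolding primitive_def by blast+
qed

lemma dist_prod_leibniz:
  assumes T: "T \<in> neg_sobolev i" and v: "ac_chain m v" "k + i \<le> m" and z: "z \<in> test_functions"
    and g: "AE x in unit_measure. g x = v k x"
  shows "dist_prod i T g z =
    (-1) ^ i * (\<integral>x. primitive i T x * leibniz i (\<lambda>p. v (k + p) x) (\<lambda>p. nderiv p z x) \<partial>unit_measure)"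
proof -
  have c: "ac_chain i (\<lambda>l x. leibniz l (\<lambda>p. v (k + p) x) (\<lambda>p. nderiv p z x))"
    using ac_chain_leibniz_smooth[OF ac_chain_shift[OF v] test_smooth[OF z], of 0] by simp
  have "AE x in unit_measure. g x * z x = leibniz 0 (\<lambda>p. v (k + p) x) (\<lambda>p. nderiv p z x)"
    using g by eventually_elim simp
  note w = ac_chain_weak_deriv[OF c order_refl this]
  have "(\<integral>x. primitive i T x * weak_deriv i (\<lambda>t. g t * z t) x \<partial>unit_measure) =
     (\<integral>x. primitive i T x * leibniz i (\<lambda>p. v (k + p) x) (\<lambda>p. nderiv p z x) \<partial>unit_measure)"
  proof (rule integral_cong_AE)
    have m: "primitive i T \<in> borel_measurable unit_measure"
      using primitive(1)[OF T] by (rule Lp2_measurable)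
    show "(\<lambda>x. primitive i T x * weak_deriv i (\<lambda>t. g t * z t) x) \<in> borel_measurable unit_measure"
      using m w(2) by auto
    show "(\<lambda>x. primitive i T x * leibniz i (\<lambda>p. v (k + p) x) (\<lambda>p. nderiv p z x)) \<in> borel_measurable unit_measure"
      using m ac_chain_L1[OF c order_refl] by auto
    show "AE x in unit_measure. primitive i T x * weak_deriv i (\<lambda>t. g t * z t) x =
        primitive i T x * leibniz i (\<lambda>p. v (k + p) x) (\<lambda>p. nderiv p z x)"
      using w(1) by eventually_elim simp
  qed
  then show ?thesis
    using z by (simp add: dist_prod_def primitive_def Let_def)
qed

lemma diff_expr_form:
  assumes \<T>: "\<T> \<in> coeff_space m" and v: "form_domain m v" and y: "AE x in unit_measure. y x = v 0 x"
    and z: "z \<in> test_functions"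
  shows "diff_expr m \<T> y z = (-1) ^ m * (\<integral>x. v m x * nderiv m z x \<partial>unit_measure)
    + (\<Sum>\<nu><2 * m. \<integral>x. (-1) ^ sing_order m \<nu> * primitive (sing_order m \<nu>) (\<T> \<nu>) x *
        pairing \<nu> (sing_order m \<nu>) (\<lambda>r. v r x) (\<lambda>j. nderiv j z x) \<partial>unit_measure)"
proof -
  have c: "ac_chain m v" using v by (simp add: form_domain_def)
  have T: "\<T> \<nu> \<in> neg_sobolev (sing_order m \<nu>)" if "\<nu> < 2 * m" for \<nu>
    using \<T> that by (simp add: coeff_space_def)
  have w: "AE x in unit_measure. weak_deriv k y x = v k x" if "k \<le> m" for k
    by (rule ac_chain_weak_deriv(1)[OF c that y])
  have sq: "(-1) ^ n * ((-1) ^ n * w) = w" for n and w :: complex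
    by (simp flip: mult.assoc power_add)
  let ?s = "sing_order m"
  let ?P = "\<lambda>\<nu>. primitive (?s \<nu>) (\<T> \<nu>)"
  define G where "G \<nu> = (\<integral>x. (-1) ^ ?s \<nu> * ?P \<nu> x * pairing \<nu> (?s \<nu>) (\<lambda>r. v r x) (\<lambda>j. nderiv j z x) \<partial>unit_measure)" for \<nu>
  have L: "regular_dist y = regular_dist (v 0)"
    by (rule regular_dist_cong_AE[OF L1_AE_cong[OF ac_chain_L1[OF c] AE_eq_sym[OF y]] y]) simp
  \<comment> \<open>The function y has only m derivatives at its disposal; the remaining m go to
    z.\<close>
  have "(dist_deriv ^^ (2 * m)) (regular_dist y) = (dist_deriv ^^ m) (regular_dist (v m))"
    unfolding L mult_2 funpow_add comp_apply ac_chain_dist_deriv[OF c order_refl] ..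
  then have t0: "(dist_deriv ^^ (2 * m)) (regular_dist y) z = (-1) ^ m * (\<integral>x. v m x * nderiv m z x \<partial>unit_measure)"
    by (simp add: dist_deriv_pow_test[OF z] regular_dist_test test_nderiv z)
  have prod: "dist_prod (?s \<nu>) (\<T> \<nu>) (weak_deriv l y) (nderiv k z) =
      (-1) ^ ?s \<nu> * (\<integral>x. ?P \<nu> x * leibniz (?s \<nu>) (\<lambda>p. v (l + p) x) (\<lambda>p. nderiv (k + p) z x) \<partial>unit_measure)"
    if "\<nu> < 2 * m" "l + ?s \<nu> \<le> m" for \<nu> l k
    using dist_prod_leibniz[OF T[OF that(1)] c that(2) test_nderiv[OF z] w[of l], of k] that(2)
    by (simp add: nderiv_nderiv add.commute)
  have even: "(-1) ^ k * (dist_deriv ^^ k) (dist_prod (?s (2 * k)) (\<T> (2 * k)) (weak_deriv k y)) z = G (2 * k)"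
    if k: "k < m" for k
  proof -
    have "k + ?s (2 * k) \<le> m" using k by (simp add: sing_order_def)
    from prod[OF _ this, of k] k show ?thesis
      unfolding G_def dist_deriv_pow_test[OF z] sq by (simp add: pairing_def Let_def mult.assoc)
  qed
  have odd: "(-1) ^ (k + 1) * ((dist_deriv ^^ (k + 1))
             (dist_prod (?s (2 * k + 1)) (\<T> (2 * k + 1)) (weak_deriv k y)) z
           + (dist_deriv ^^ k)
             (dist_prod (?s (2 * k + 1)) (\<T> (2 * k + 1)) (weak_deriv (k + 1) y)) z) = G (2 * k + 1)"
    if k: "k < m" for k
  proof -
    let ?n = "2 * k + 1"
    have n: "?n < 2 * m" "k + ?s ?n \<le> m" "(k + 1) + ?s ?n \<le> m" using k by (auto simp: sing_order_def)
    let ?a = "\<lambda>x. leibniz (?s ?n) (\<lambda>p. v (k + p) x) (\<lambda>p. nderiv (k + 1 + p) z x)"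
    let ?b = "\<lambda>x. leibniz (?s ?n) (\<lambda>p. v (k + 1 + p) x) (\<lambda>p. nderiv (k + p) z x)"
    have zc: "continuous_on {0..1} (nderiv j z)" for j
      using z by (intro smooth_continuous smooth_nderiv test_smooth)
    have "?a \<in> Lp 2" "?b \<in> Lp 2"
      by (rule leibniz_Lp2[OF form_domain_Lp2[OF v] zc]; use n in simp)+
    then have Lab: "L1 (\<lambda>x. ?P ?n x * ?a x)" "L1 (\<lambda>x. ?P ?n x * ?b x)"
      using Lp2_mult[OF primitive(1)[OF T[OF n(1)]]] by blast+
    \<comment> \<open>The two halves of an odd term carry k + 1 and k outer derivatives, hence
      opposite signs. This produces the antisymmetric difference in \<open>pairing\<close>.\<close>
    have sgn: "(-1) ^ (k + 1) * ((-1) ^ (k + 1) * a + (-1) ^ k * b) = a - b" for a b :: complex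
    proof -
      have "(-1) ^ (k + 1) * ((-1) ^ (k + 1) * a + (-1) ^ k * b) = (-1) ^ k * ((-1) ^ k * a) - (-1) ^ k * ((-1) ^ k * b)"
        by (simp add: algebra_simps)
      then show ?thesis unfolding sq .
    qed
    have "G ?n = (\<integral>x. (-1) ^ ?s ?n * (?P ?n x * ?a x - ?P ?n x * ?b x) \<partial>unit_measure)"
      unfolding G_def by (intro Bochner_Integration.integral_cong refl) (simp add: pairing_def Let_def algebra_simps)
    also have "\<dots> = (-1) ^ ?s ?n * (\<integral>x. ?P ?n x * ?a x \<partial>unit_measure) - (-1) ^ ?s ?n * (\<integral>x. ?P ?n x * ?b x \<partial>unit_measure)"
      using Lab by (simp add: right_diff_distrib)
    finally show ?thesis
      unfolding dist_deriv_pow_test[OF z] sgn prod[OF n(1,2)] prod[OF n(1,3)] by simp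
  qed
  have "diff_expr m \<T> y z = (-1) ^ m * (\<integral>x. v m x * nderiv m z x \<partial>unit_measure) + (\<Sum>k<m. G (2 * k)) + (\<Sum>k<m. G (2 * k + 1))"
    unfolding diff_expr_def t0 using even odd by simp
  also have "\<dots> = (-1) ^ m * (\<integral>x. v m x * nderiv m z x \<partial>unit_measure) + (\<Sum>\<nu><2 * m. G \<nu>)"
    by (simp add: sum_even_odd sum.distrib add.assoc)
  finally show ?thesis unfolding G_def .
qed

lemma Q_form_chi:
  assumes "\<And>r j. r \<le> m \<Longrightarrow> j \<le> m \<Longrightarrow> Q r j x = (\<Sum>\<nu><2 * m. \<Sum>i\<le>sing_order m \<nu>. t \<nu> i x * chi \<nu> i r j)"
  shows "Q_form m Q v z x = (\<Sum>\<nu><2 * m. \<Sum>i\<le>sing_order m \<nu>. t \<nu> i x * pairing \<nu> i (\<lambda>r. v r x) (\<lambda>j. nderiv j z x))"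
proof -
  let ?I = "SIGMA \<nu>:{..<2 * m}. {..sing_order m \<nu>}"
  have "Q_form m Q v z x = (\<Sum>r\<le>m. \<Sum>j\<le>m. \<Sum>p\<in>?I. t (fst p) (snd p) x * (chi (fst p) (snd p) r j * (v r x * nderiv j z x)))"
    unfolding Q_form_def using assms
    by (intro sum.cong refl) (simp add: sum.Sigma sum_distrib_right case_prod_beta mult.assoc)
  also have "\<dots> = (\<Sum>r\<le>m. \<Sum>p\<in>?I. \<Sum>j\<le>m. t (fst p) (snd p) x * (chi (fst p) (snd p) r j * (v r x * nderiv j z x)))"
    by (intro sum.cong refl sum.swap)
  also have "\<dots> = (\<Sum>p\<in>?I. \<Sum>r\<le>m. \<Sum>j\<le>m. t (fst p) (snd p) x * (chi (fst p) (snd p) r j * (v r x * nderiv j z x)))"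
    by (rule sum.swap)
  also have "\<dots> = (\<Sum>p\<in>?I. t (fst p) (snd p) x * pairing (fst p) (snd p) (\<lambda>r. v r x) (\<lambda>j. nderiv j z x))"
    by (intro sum.cong refl) (auto simp: sum_distrib_left[symmetric] sum_chi)
  also have "\<dots> = (\<Sum>\<nu><2 * m. \<Sum>i\<le>sing_order m \<nu>. t \<nu> i x * pairing \<nu> i (\<lambda>r. v r x) (\<lambda>j. nderiv j z x))"
    by (simp add: sum.Sigma case_prod_beta)
  finally show ?thesis .
qed

subsection \<open>Density of the domain\<close>

text \<open>The adjoint solution P of the annihilator turns out to satisfy P l' = - P (l-1) - e l
  for l < m, with P (m-1) = - e m and no trace of F. Then the sum of e r w^(r) is minus the
  derivative of the sum of P r w^(r) over r < m, for any smooth w, and P vanishes at both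
  ends.\<close>

lemma annihilator_vanishes_on_smooth:
  assumes m: "m \<ge> 1" and Q: "regular_Q m Q" and F: "matrix_ae_eq m F (S_map m Q)"
    and e: "\<And>r. r \<le> m \<Longrightarrow> L1 (e r)" "e m \<in> Lp 2"
    and ann: "\<And>y v. y \<in> quasi_domain m F \<Longrightarrow> form_domain m v \<Longrightarrow> AE x in unit_measure. y x = v 0 x \<Longrightarrow>
      (\<integral>x. (\<Sum>r\<le>m. e r x * v r x) \<partial>unit_measure) = 0"
    and w: "smooth w"
  shows "(\<integral>x. (\<Sum>r\<le>m. e r x * nderiv r w x) \<partial>unit_measure) = 0"
proof -
  let ?S = "S_map m Q"
  let ?n = "2 * m"
  \<comment> \<open>The system for the quasi-derivatives, counted from 0: the derivative of Y k
    involves row k + 1 of F, whose column l + 1 multiplies Y l.\<close>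
  define A where "A k l x = (if l = Suc k then 1 else 0) + (if l \<le> k then ?S (Suc k) (Suc l) x else 0)" for k l x
  \<comment> \<open>The annihilator rewritten for quasi-derivatives: y^(m) equals the m-th
    quasi-derivative plus row m of F applied to the lower ones.\<close>
  define E where "E l x = (if l < m then e l x + ?S m (Suc l) x * e m x else if l = m then e m x else 0)" for l x
  have LA: "L1 (A k l)" for k l
  proof -
    have "L1 (\<lambda>x. if l \<le> k then ?S (Suc k) (Suc l) x else 0)"
      by (cases "l \<le> k") (simp_all add: S_map_L1[OF Q])
    then show ?thesis
      unfolding A_def by (intro Bochner_Integration.integrable_add L1_const)
  qed
  have LE: "L1 (E l)" for l
  proof -
    consider "l < m" | "l = m" | "l > m" by linarith
    then show ?thesis
    proof cases
      case 1
      have "L1 (\<lambda>x. ?S m (Suc l) x * e m x)"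
        by (rule Lp2_mult[OF S_map_regularity(1)[OF Q] e(2)]) (use 1 in auto)
      moreover have "L1 (e l)" using e(1)[of l] 1 by simp
      ultimately have "L1 (\<lambda>x. e l x + ?S m (Suc l) x * e m x)" by (rule Bochner_Integration.integrable_add[rotated])
      then show ?thesis unfolding E_def using 1 by simp
    next
      case 2
      then show ?thesis unfolding E_def using e(1)[of m] by simp
    next
      case 3
      then show ?thesis unfolding E_def by simp
    qed
  qed
  have split_m: "(\<Sum>l<?n. E l x * Y l) = (\<Sum>r<m. e r x * Y r) + e m x * (Y m + (\<Sum>l<m. ?S m (Suc l) x * Y l))" for x and Y :: "nat \<Rightarrow> complex"
  proof -
    have "(\<Sum>l<?n. E l x * Y l) = (\<Sum>l\<le>m. E l x * Y l)"
      using m by (intro sum.mono_neutral_right) (auto simp: E_def)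
    also have "\<dots> = (\<Sum>l<m. (e l x + ?S m (Suc l) x * e m x) * Y l) + e m x * Y m"
      by (simp add: E_def lessThan_Suc_atMost[symmetric])
    finally show ?thesis
      by (simp add: distrib_right distrib_left sum.distrib sum_distrib_left mult_ac)
  qed
  have annY: "(\<integral>x. (\<Sum>l<?n. E l x * Y l x) \<partial>unit_measure) = 0"
    if f: "L1 f" and Y: "\<And>k. k < ?n \<Longrightarrow> ac_deriv (Y k) (\<lambda>x. (\<Sum>l<?n. A k l x * Y l x) + (if k = ?n - 1 then f x else 0))" for Y f
  proof -
    have Yd: "(\<Sum>l<?n. A k l x * Y l x) = (if Suc k < ?n then Y (Suc k) x else 0) + (\<Sum>l\<le>k. ?S (Suc k) (Suc l) x * Y l x)"
      if k: "k < ?n" for k x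
    proof -
      have "(\<Sum>l<?n. A k l x * Y l x) = (\<Sum>l<?n. if l = Suc k then Y l x else 0) + (\<Sum>l<?n. if l \<le> k then ?S (Suc k) (Suc l) x * Y l x else 0)"
        unfolding sum.distrib[symmetric] by (intro sum.cong refl) (auto simp: A_def)
      also have "(\<Sum>l<?n. if l = Suc k then Y l x else 0) = (if Suc k < ?n then Y (Suc k) x else 0)"
        by (simp add: sum.delta)
      also have "(\<Sum>l<?n. if l \<le> k then ?S (Suc k) (Suc l) x * Y l x else 0) = (\<Sum>l\<le>k. ?S (Suc k) (Suc l) x * Y l x)"
        using k by (intro sum.mono_neutral_cong_right) auto
      finally show ?thesis .
    qed
    define y where "y = Y 0"
    \<comment> \<open>Solutions of the system provide elements of the domain: the components are the
      quasi-derivatives of Y 0.\<close>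
    have qd: "AE x in unit_measure. quasi_deriv F y k x = Y k x" if "k < ?n" for k
      using that
    proof (induction k rule: less_induct)
      case (less k)
      show ?case
      proof (cases k)
        case 0
        then show ?thesis by (simp add: y_def)
      next
        case (Suc j)
        have j: "j < ?n" "Suc j < ?n" "j \<noteq> ?n - 1" using Suc less.prems by auto
        let ?D = "\<lambda>x. Y (Suc j) x + (\<Sum>l\<le>j. ?S (Suc j) (Suc l) x * Y l x)"
        have dj: "ac_deriv (Y j) ?D"
          using Y[OF j(1)] j by (simp add: Yd)
        have "AE x in unit_measure. quasi_deriv F y (Suc j) x = ?D x - (\<Sum>l\<le>j. ?S (Suc j) (Suc l) x * Y l x)"
          by (rule quasi_deriv_step[where Y = Y, OF F j(1) dj]) (use less.IH Suc j in simp)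
        then show ?thesis unfolding Suc by simp
      qed
    qed
    have yd: "y \<in> quasi_domain m F"
      unfolding quasi_domain_def using Y qd by (blast intro: sobolev_1_1I)
    define u where "u r x = (if r < m then Y r x else Y m x + (\<Sum>l<m. ?S m (Suc l) x * Y l x))" for r x
    have chain: "ac_chain m u"
      unfolding ac_chain_def
    proof (intro conjI allI impI)
      fix r assume r: "r < m"
      have r': "r < ?n" "Suc r < ?n" "r \<noteq> ?n - 1" using r m by auto
      have "u r = Y r" using r by (simp add: u_def fun_eq_iff)
      moreover have "u (Suc r) = (\<lambda>x. Y (Suc r) x + (\<Sum>l\<le>r. ?S (Suc r) (Suc l) x * Y l x))"
      proof (cases "Suc r = m")
        case True
        then have "{..<m} = {..r}" by auto
        then show ?thesis using True by (simp add: u_def fun_eq_iff)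
      next
        case False
        then have "Suc r < m" using r by simp
        then show ?thesis by (simp add: u_def fun_eq_iff S_map_entries(4))
      qed
      ultimately show "ac_deriv (u r) (u (Suc r))"
        using Y[OF r'(1)] r' by (simp add: Yd)
    next
      have "L1 (\<lambda>x. ?S m (Suc l) x * Y l x)" if "l < m" for l
        by (rule L1_mult_continuous[OF S_map_L1[OF Q] ac_deriv_continuous[OF Y]]) (use that in auto)
      moreover have "L1 (Y m)" using Y[of m] m by (intro ac_deriv_imp_L1[OF Y]) simp
      ultimately have "L1 (\<lambda>x. Y m x + (\<Sum>l<m. ?S m (Suc l) x * Y l x))"
        by (intro Bochner_Integration.integrable_add Bochner_Integration.integrable_sum) simp_all
      then show "L1 (u m)" by (simp add: u_def[abs_def])
    qed
    have "u m \<in> Lp 2"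
    proof -
      have "(\<lambda>x. ?S m (Suc l) x * Y l x) \<in> Lp 2" if "l < m" for l
        using Lp2_continuous_mult[OF ac_deriv_continuous[OF Y[of l]] S_map_regularity(1)[OF Q, of "Suc l"]] that
        by (simp add: mult.commute)
      then have "(\<lambda>x. \<Sum>l<m. ?S m (Suc l) x * Y l x) \<in> Lp 2" by (intro Lp2_sum) simp
      moreover have "Y m \<in> Lp 2" using m by (intro continuous_imp_Lp2 ac_deriv_continuous[OF Y]) simp
      ultimately have "(\<lambda>x. Y m x + (\<Sum>l<m. ?S m (Suc l) x * Y l x)) \<in> Lp 2" by (intro Lp2_add)
      then show ?thesis by (simp add: u_def[abs_def])
    qed
    with chain have "form_domain m u" by (simp add: form_domain_def)
    moreover have "AE x in unit_measure. y x = u 0 x" using m by (simp add: y_def u_def)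
    ultimately have "(\<integral>x. (\<Sum>r\<le>m. e r x * u r x) \<partial>unit_measure) = 0" using ann[OF yd] by blast
    moreover have "(\<Sum>r\<le>m. e r x * u r x) = (\<Sum>l<?n. E l x * Y l x)" for x
      unfolding split_m by (simp add: u_def lessThan_Suc_atMost[symmetric])
    ultimately show ?thesis by simp
  qed
  have "?n > 0" using m by simp
  then obtain P where P: "\<And>l. l < ?n \<Longrightarrow> ac_deriv (P l) (\<lambda>x. - (\<Sum>k<?n. P k x * A k l x) - E l x)"
    "\<And>l. l < ?n \<Longrightarrow> P l 0 = 0" "\<And>l. l < ?n \<Longrightarrow> P l 1 = 0"
    "\<And>x. x \<in> {0..1} \<Longrightarrow> P (?n - 1) x = 0"
    using adjoint_of_annihilator[of ?n A E] LA LE annY by blast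
  have PA: "(\<Sum>k<?n. P k x * A k l x) = (if l = 0 then 0 else P (l - 1) x) + (\<Sum>k\<in>{l..<?n}. P k x * ?S (Suc k) (Suc l) x)"
    if l: "l < ?n" for l x
  proof -
    have "(\<Sum>k<?n. P k x * A k l x) = (\<Sum>k<?n. if Suc k = l then P k x else 0) + (\<Sum>k<?n. if l \<le> k then P k x * ?S (Suc k) (Suc l) x else 0)"
      unfolding sum.distrib[symmetric] by (intro sum.cong refl) (auto simp: A_def)
    also have "(\<Sum>k<?n. if Suc k = l then P k x else 0) = (if l = 0 then 0 else P (l - 1) x)"
    proof (cases l)
      case (Suc j)
      have "(\<Sum>k<?n. if Suc k = l then P k x else 0) = (\<Sum>k<?n. if k = j then P k x else 0)"
        by (intro sum.cong refl) (simp add: Suc)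
      then show ?thesis using Suc l by (simp add: sum.delta)
    qed simp
    also have "(\<Sum>k<?n. if l \<le> k then P k x * ?S (Suc k) (Suc l) x else 0) = (\<Sum>k\<in>{l..<?n}. P k x * ?S (Suc k) (Suc l) x)"
      by (intro sum.mono_neutral_cong_right) auto
    finally show ?thesis .
  qed
  have zero_deriv: "AE x in unit_measure. g x = 0" if "ac_deriv p g" "\<And>x. x \<in> {0..1} \<Longrightarrow> p x = 0" for p g
  proof (rule AE_0_if_orthogonal_to_test[OF ac_deriv_L1[OF that(1)]])
    fix z assume z: "z \<in> test_functions"
    have "(\<integral>x. p x * nderiv 1 z x \<partial>unit_measure) = (\<integral>x. 0 \<partial>unit_measure)"
      using that(2) by (intro Bochner_Integration.integral_cong) auto
    then show "(\<integral>x. g x * z x \<partial>unit_measure) = 0"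
      using integral_mult_test_by_parts[OF that(1) z] by simp
  qed
  \<comment> \<open>Downward from P (2m-1) = 0: if all components above l vanish, the adjoint
    equation of component l + 1 > m, where E is zero, reduces to P l = 0.\<close>
  have high: "P l x = 0" if "m \<le> l" "l < ?n" "x \<in> {0..1}" for l x
    using that
  proof (induction "?n - l" arbitrary: l x rule: less_induct)
    case less
    show ?case
    proof (cases "l = ?n - 1")
      case True
      then show ?thesis using P(4) less.prems by simp
    next
      case False
      have l: "Suc l < ?n" "m < Suc l" using False less.prems by auto
      have P0: "P k x = 0" if "Suc l \<le> k" "k < ?n" "x \<in> {0..1}" for k x
        using that less.prems by (intro less.hyps) auto
      have ae: "AE x in unit_measure. - (\<Sum>k<?n. P k x * A k (Suc l) x) - E (Suc l) x = 0"
        by (rule zero_deriv[OF P(1)[OF l(1)]]) (use P0 l in auto)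
      have eq: "- (\<Sum>k<?n. P k x * A k (Suc l) x) - E (Suc l) x = - P l x" if "x \<in> {0..1}" for x
      proof -
        have "(\<Sum>k\<in>{Suc l..<?n}. P k x * ?S (Suc k) (Suc (Suc l)) x) = 0"
          using P0 that by (intro sum.neutral) auto
        then show ?thesis using l by (simp add: PA E_def)
      qed
      have "AE x in unit_measure. P l x = 0"
        using ae AE_space
      proof eventually_elim
        case (elim x)
        then show ?case using eq[of x] by simp
      qed
      then show ?thesis
        using less.prems by (intro continuous_AE_0_imp_0[OF ac_deriv_continuous[OF P(1)]]) auto
    qed
  qed
  have mn: "m < ?n" "m - 1 < ?n" using m by auto
  \<comment> \<open>The same reduction at component m, where E contributes e m.\<close>
  have top: "AE x in unit_measure. P (m - 1) x = - e m x"
  proof -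
    have ae: "AE x in unit_measure. - (\<Sum>k<?n. P k x * A k m x) - E m x = 0"
      by (rule zero_deriv[OF P(1)[OF mn(1)]]) (use high mn in auto)
    have eq: "- (\<Sum>k<?n. P k x * A k m x) - E m x = - P (m - 1) x - e m x" if "x \<in> {0..1}" for x
    proof -
      have "(\<Sum>k\<in>{m..<?n}. P k x * ?S (Suc k) (Suc m) x) = 0"
        using high that by (intro sum.neutral) auto
      then show ?thesis using m by (simp add: PA E_def)
    qed
    show ?thesis
      using ae AE_space
    proof eventually_elim
      case (elim x)
      then have "- P (m - 1) x - e m x = 0" using eq[of x] by simp
      then have "- (- P (m - 1) x) = - e m x" by simp
      then show ?case by (simp only: minus_minus)
    qed
  qed
  \<comment> \<open>Of the rows of F only row m still meets a nonzero component, namely P (m-1) = -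
    e m. Its contribution cancels the correction that row m brought into E.\<close>
  have low: "ac_deriv (P l) (\<lambda>x. - (if l = 0 then 0 else P (l - 1) x) - e l x)" if l: "l < m" for l
  proof (rule ac_deriv_cong_AE[OF P(1)])
    show ln: "l < ?n" using l by simp
    show "AE x in unit_measure. - (\<Sum>k<?n. P k x * A k l x) - E l x = - (if l = 0 then 0 else P (l - 1) x) - e l x"
      using top AE_space
    proof eventually_elim
      case (elim x)
      have "(\<Sum>k\<in>{l..<?n}. P k x * ?S (Suc k) (Suc l) x) = (\<Sum>k\<in>{m - 1}. P k x * ?S (Suc k) (Suc l) x)"
      proof (rule sum.mono_neutral_right)
        show "\<forall>k\<in>{l..<?n} - {m - 1}. P k x * ?S (Suc k) (Suc l) x = 0"
        proof
          fix k assume k: "k \<in> {l..<?n} - {m - 1}"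
          show "P k x * ?S (Suc k) (Suc l) x = 0"
          proof (cases "m \<le> k")
            case True
            then show ?thesis using high[of k x] k elim by simp
          next
            case False
            then have "Suc k < m" using k by auto
            then show ?thesis by (simp add: S_map_entries(4))
          qed
        qed
      qed (use l m in auto)
      also have "\<dots> = - e m x * ?S m (Suc l) x" using elim m by simp
      finally show ?case using l by (simp add: PA[OF ln] E_def)
    qed
  qed
  have wd: "ac_deriv (nderiv r w) (nderiv (Suc r) w)" for r
    using w by (rule smooth_ac_deriv)
  have wc: "continuous_on {0..1} (nderiv r w)" for r
    using w by (intro smooth_continuous smooth_nderiv)
  have Pc: "continuous_on {0..1} (P l)" if "l < ?n" for l
    using P(1)[OF that] by (rule ac_deriv_continuous)
  have LeW: "L1 (\<lambda>x. e r x * nderiv r w x)" if "r \<le> m" for r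
    by (rule L1_mult_continuous[OF e(1)[OF that] wc])
  have LPW: "L1 (\<lambda>x. P r x * nderiv s w x)" if "r < ?n" for r s
    using Pc[OF that] wc[of s] by (intro continuous_imp_L1 continuous_on_mult)
  define I where "I r = (\<integral>x. P r x * nderiv (Suc r) w x \<partial>unit_measure)" for r
  \<comment> \<open>Boundary terms vanish because P is zero at both ends. Summed over r < m these
    differences telescope to I (m - 1), which the term of order m cancels.\<close>
  have er: "(\<integral>x. e r x * nderiv r w x \<partial>unit_measure) = I r - (if r = 0 then 0 else I (r - 1))" if r: "r < m" for r
  proof -
    have rn: "r < ?n" "r - 1 < ?n" using r by auto
    let ?q = "\<lambda>x. if r = 0 then 0 else P (r - 1) x * nderiv r w x"
    have Lq: "L1 ?q" using LPW[OF rn(2), of r] by (cases "r = 0") auto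
    have eq: "(\<integral>x. (- (if r = 0 then 0 else P (r - 1) x) - e r x) * nderiv r w x \<partial>unit_measure)
       = (\<integral>x. - ?q x - e r x * nderiv r w x \<partial>unit_measure)"
      by (intro Bochner_Integration.integral_cong refl) (simp add: left_diff_distrib)
    have "(\<integral>x. - ?q x - e r x * nderiv r w x \<partial>unit_measure) + I r = 0"
      using ac_deriv_by_parts[OF low[OF r] wd[of r]] P(2,3)[OF rn(1)] unfolding I_def eq by simp
    moreover have "(\<integral>x. - ?q x - e r x * nderiv r w x \<partial>unit_measure) = - (\<integral>x. ?q x \<partial>unit_measure) - (\<integral>x. e r x * nderiv r w x \<partial>unit_measure)"
      using Lq LeW[of r] r by simp
    moreover have "(\<integral>x. ?q x \<partial>unit_measure) = (if r = 0 then 0 else I (r - 1))"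
      by (cases "r = 0") (auto simp: I_def)
    ultimately show ?thesis by (simp add: algebra_simps)
  qed
  have em: "(\<integral>x. e m x * nderiv m w x \<partial>unit_measure) = - I (m - 1)"
  proof -
    have "(\<integral>x. e m x * nderiv m w x \<partial>unit_measure) = (\<integral>x. - (P (m - 1) x * nderiv m w x) \<partial>unit_measure)"
    proof (rule integral_cong_L1_AE[OF LeW[OF order_refl]])
      show "AE x in unit_measure. e m x * nderiv m w x = - (P (m - 1) x * nderiv m w x)"
        using top by eventually_elim simp
    qed
    then show ?thesis using m by (simp add: I_def)
  qed
  have tel: "(\<Sum>r<k. I r - (if r = 0 then 0 else I (r - 1))) = (if k = 0 then 0 else I (k - 1))" for k
    by (induction k) auto
  have "(\<integral>x. (\<Sum>r\<le>m. e r x * nderiv r w x) \<partial>unit_measure) = (\<Sum>r\<le>m. \<integral>x. e r x * nderiv r w x \<partial>unit_measure)"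
    by (rule Bochner_Integration.integral_sum) (use LeW in auto)
  also have "\<dots> = (\<Sum>r<m. \<integral>x. e r x * nderiv r w x \<partial>unit_measure) + (\<integral>x. e m x * nderiv m w x \<partial>unit_measure)"
    by (simp add: lessThan_Suc_atMost[symmetric])
  also have "\<dots> = 0"
    using er em tel[of m] m by simp
  finally show ?thesis .
qed

subsection \<open>Uniqueness of the coefficients\<close>

lemma has_vector_derivative_exp_line:
  "((\<lambda>x. exp (a * complex_of_real x)) has_vector_derivative a * exp (a * complex_of_real x)) (at x)"
proof -
  have "((\<lambda>z. exp (a * z)) has_field_derivative a * exp (a * complex_of_real x)) (at (complex_of_real x))"
    by (auto intro!: derivative_eq_intros)
  then show ?thesis by (rule has_vector_derivative_real_field)
qed

lemma smooth_exp_line: "smooth (\<lambda>x. exp (a * complex_of_real x))"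
proof (rule smooth_coinduct[where P = "\<lambda>h. \<exists>c. h = (\<lambda>x. c * exp (a * complex_of_real x))"])
  show "\<exists>c. (\<lambda>x. exp (a * complex_of_real x)) = (\<lambda>x. c * exp (a * complex_of_real x))"
    by (rule exI[of _ 1]) simp
  fix f assume "\<exists>c. f = (\<lambda>x. c * exp (a * complex_of_real x))"
  then obtain c where f: "f = (\<lambda>x. c * exp (a * complex_of_real x))" by blast
  let ?g = "\<lambda>x. (c * a) * exp (a * complex_of_real x)"
  have "(f has_vector_derivative ?g x) (at x)" for x
    unfolding f mult.assoc by (intro has_vector_derivative_mult_right has_vector_derivative_exp_line)
  moreover have "\<exists>c. ?g = (\<lambda>x. c * exp (a * complex_of_real x))" by blast
  ultimately show "\<exists>g. (\<exists>c. g = (\<lambda>x. c * exp (a * complex_of_real x))) \<and> (\<forall>x. (f has_vector_derivative g x) (at x))"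
    by blast
qed

lemma nderiv_exp_line: "nderiv r (\<lambda>x. exp (a * complex_of_real x)) = (\<lambda>x. a ^ r * exp (a * complex_of_real x))"
proof (induction r)
  case (Suc r)
  have "((\<lambda>x. a ^ r * exp (a * complex_of_real x)) has_vector_derivative a ^ Suc r * exp (a * complex_of_real x)) (at x)" for x
    using has_vector_derivative_mult_right[OF has_vector_derivative_exp_line, of "a ^ r" a x] by (simp add: mult_ac)
  then show ?case
    unfolding nderiv_Suc Suc by (auto simp: fun_eq_iff intro!: vector_derivative_at)
qed simp

lemma test_linearD:
  "test_linear T \<Longrightarrow> z \<in> test_functions \<Longrightarrow> w \<in> test_functions \<Longrightarrow>
    T (\<lambda>x. a * z x + b * w x) = a * T z + b * T w"
  by (simp add: test_linear_def)

lemma test_linear_sumD: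
  assumes "test_linear W" "\<And>p. f p \<in> test_functions"
  shows "W (\<lambda>x. \<Sum>p\<le>(n::nat). c p * f p x) = (\<Sum>p\<le>n. c p * W (f p))"
proof (induction n)
  case 0
  have "W (\<lambda>x. c 0 * f 0 x + 0 * f 0 x) = c 0 * W (f 0) + 0 * W (f 0)"
    by (rule test_linearD[OF assms(1) assms(2) assms(2)])
  then show ?case by simp
next
  case (Suc n)
  let ?g = "\<lambda>x. \<Sum>p\<le>n. c p * f p x"
  have "?g \<in> test_functions" by (intro test_sum test_cmult assms(2))
  then have "W (\<lambda>x. 1 * ?g x + c (Suc n) * f (Suc n) x) = 1 * W ?g + c (Suc n) * W (f (Suc n))"
    by (rule test_linearD[OF assms(1) _ assms(2)])
  then show ?case using Suc by simp
qed

definition core :: "nat \<Rightarrow> (real \<Rightarrow> complex) \<Rightarrow> (real \<Rightarrow> complex) \<Rightarrow> real \<Rightarrow> complex" where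
  "core \<nu> w z = (let k = \<nu> div 2 in
     if even \<nu> then (\<lambda>x. nderiv k w x * nderiv k z x)
     else (\<lambda>x. nderiv k w x * nderiv (Suc k) z x - nderiv (Suc k) w x * nderiv k z x))"

lemma nderiv_diff:
  assumes "smooth f" "smooth g"
  shows "nderiv k (\<lambda>x. f x - g x) = (\<lambda>x. nderiv k f x - nderiv k g x)"
  using nderiv_add[OF assms(1) smooth_cmult[OF assms(2), of "- 1"], of k] nderiv_cmult[OF assms(2), of k "- 1"]
  by simp

text \<open>For smooth arguments the formal derivative is a genuine one, which turns the defect form
  into the defect functionals evaluated at \<open>core\<close>.\<close>

lemma pairing_nderiv_core:
  assumes "smooth w" "smooth z"
  shows "pairing \<nu> i (\<lambda>r. nderiv r w x) (\<lambda>j. nderiv j z x) = nderiv i (core \<nu> w z) x"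
proof -
  have s: "smooth (nderiv k w)" "smooth (nderiv k z)" for k
    using assms by (auto intro: smooth_nderiv)
  show ?thesis
    unfolding pairing_def core_def Let_def
    by (simp add: nderiv_diff nderiv_mult s smooth_mult nderiv_nderiv add.commute)
qed

lemma nderiv_exp_line_mult:
  assumes "smooth f"
  shows "nderiv k (\<lambda>x. exp (- a * complex_of_real x) * f x) x =
    exp (- a * complex_of_real x) * (\<Sum>p\<le>k. (of_nat (k choose p) * (- a) ^ p) * nderiv (k - p) f x)"
  unfolding nderiv_mult[OF smooth_exp_line assms] nderiv_exp_line leibniz_def sum_distrib_left
  by (intro sum.cong refl) (simp only: mult_ac)

lemma exp_line_cancel: "exp (a * complex_of_real x) * (exp (- a * complex_of_real x) * c) = c"
  by (simp flip: exp_add mult.assoc)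

text \<open>The polynomial in a that arises from \<open>core\<close> with exp (a x) and exp (- a x)
  f, where b q stands for W applied to the q-th derivative of f. The exponentials cancel, leaving
  only powers of a.\<close>

definition symbol :: "nat \<Rightarrow> (nat \<Rightarrow> complex) \<Rightarrow> complex poly" where
  "symbol \<nu> b = (let k = \<nu> div 2 in
     if even \<nu> then (\<Sum>p\<le>k. monom (of_nat (k choose p) * (-1) ^ p * b (k - p)) (k + p))
     else (\<Sum>p\<le>Suc k. monom (of_nat (Suc k choose p) * (-1) ^ p * b (Suc k - p)) (k + p))
        - (\<Sum>p\<le>k. monom (of_nat (k choose p) * (-1) ^ p * b (k - p)) (Suc (k + p))))"

lemma poly_symbol:
  assumes W: "test_linear W" and f: "f \<in> test_functions"
  shows "poly (symbol \<nu> (\<lambda>q. W (nderiv q f))) a =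
    W (core \<nu> (\<lambda>x. exp (a * complex_of_real x)) (\<lambda>x. exp (- a * complex_of_real x) * f x))"
proof -
  let ?k = "\<nu> div 2"
  let ?w = "\<lambda>x. exp (a * complex_of_real x)"
  let ?z = "\<lambda>x. exp (- a * complex_of_real x) * f x"
  let ?h = "\<lambda>k n x. \<Sum>p\<le>k. (of_nat (k choose p) * (-1) ^ p * a ^ (n + p)) * nderiv (k - p) f x"
  have h: "nderiv n ?w x * nderiv k ?z x = ?h k n x" for n k x
    unfolding nderiv_exp_line nderiv_exp_line_mult[OF test_smooth[OF f]] mult.assoc exp_line_cancel sum_distrib_left
    by (intro sum.cong refl) (simp add: power_add power_minus[of a] mult_ac)
  have ht: "(\<lambda>x. ?h k n x) \<in> test_functions" for k n
    by (intro test_sum test_cmult test_nderiv f)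
  have Wh: "W (\<lambda>x. ?h k n x) = (\<Sum>p\<le>k. of_nat (k choose p) * (-1) ^ p * a ^ (n + p) * W (nderiv (k - p) f))" for k n
    by (rule test_linear_sumD[OF W test_nderiv[OF f]])
  show ?thesis
  proof (cases "even \<nu>")
    case True
    have "core \<nu> ?w ?z = (\<lambda>x. ?h ?k ?k x)"
      unfolding core_def Let_def using True by (simp only: if_True h)
    then have "W (core \<nu> ?w ?z) = (\<Sum>p\<le>?k. of_nat (?k choose p) * (-1) ^ p * a ^ (?k + p) * W (nderiv (?k - p) f))"
      by (simp only: Wh)
    also have "\<dots> = poly (symbol \<nu> (\<lambda>q. W (nderiv q f))) a"
      unfolding symbol_def Let_def using True
      by (simp add: poly_sum poly_monom mult_ac)
    finally show ?thesis ..
  next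
    case False
    have c: "core \<nu> ?w ?z = (\<lambda>x. 1 * ?h (Suc ?k) ?k x + (- 1) * ?h ?k (Suc ?k) x)"
      unfolding core_def Let_def using False by (simp only: if_False h) simp
    have "W (core \<nu> ?w ?z) = 1 * W (\<lambda>x. ?h (Suc ?k) ?k x) + (- 1) * W (\<lambda>x. ?h ?k (Suc ?k) x)"
      unfolding c by (rule test_linearD[OF W ht ht])
    also have "\<dots> = (\<Sum>p\<le>Suc ?k. of_nat (Suc ?k choose p) * (-1) ^ p * a ^ (?k + p) * W (nderiv (Suc ?k - p) f))
       - (\<Sum>p\<le>?k. of_nat (?k choose p) * (-1) ^ p * a ^ (Suc ?k + p) * W (nderiv (?k - p) f))"
      unfolding Wh by simp
    also have "\<dots> = poly (symbol \<nu> (\<lambda>q. W (nderiv q f))) a"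
      unfolding symbol_def Let_def using False
      by (simp only: if_False poly_diff poly_sum poly_monom add_Suc) (simp only: mult_ac)
    finally show ?thesis ..
  qed
qed

lemma symbol_0: "(\<And>q. b q = 0) \<Longrightarrow> symbol \<nu> b = 0"
  by (simp add: symbol_def Let_def)

lemma coeff_symbol_above: "\<nu> < n \<Longrightarrow> coeff (symbol \<nu> b) n = 0"
proof -
  assume n: "\<nu> < n"
  have ev: "coeff (\<Sum>p\<le>K. monom (g p) (h p)) n = 0" if "\<And>p. p \<le> K \<Longrightarrow> h p < n" for K g and h :: "nat \<Rightarrow> nat"
    unfolding coeff_sum using that by (intro sum.neutral ballI) (force simp: coeff_monom)
  show ?thesis
  proof (cases "even \<nu>")
    case True
    then have "\<nu> = 2 * (\<nu> div 2)" by simp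
    then have "\<nu> div 2 + p < n" if "p \<le> \<nu> div 2" for p using n that by linarith
    then show ?thesis using True by (simp add: symbol_def Let_def ev)
  next
    case False
    then have "\<nu> = Suc (2 * (\<nu> div 2))" by simp
    then have "p \<le> Suc (\<nu> div 2) \<Longrightarrow> \<nu> div 2 + p < n" "p \<le> \<nu> div 2 \<Longrightarrow> Suc (\<nu> div 2 + p) < n" for p using n by linarith+
    then show ?thesis using False unfolding symbol_def Let_def by (simp only: if_False coeff_diff ev) simp
  qed
qed

text \<open>In the even case the constant is (-1)^k. In the odd case the two leading terms do not
  cancel: the sign of the extra derivative and the minus sign of the difference agree, which gives
  -2 (-1)^k.\<close>

lemma coeff_symbol_top: "\<exists>c. c \<noteq> 0 \<and> (\<forall>b. coeff (symbol \<nu> b) \<nu> = c * b 0)"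
proof -
  have top: "coeff (\<Sum>p\<le>K. monom (g p) (l + p)) (l + K) = g K" for K l and g :: "nat \<Rightarrow> complex"
  proof -
    have "coeff (\<Sum>p\<le>K. monom (g p) (l + p)) (l + K) = (\<Sum>p\<le>K. if p = K then g p else 0)"
      unfolding coeff_sum by (intro sum.cong refl) (auto simp: coeff_monom)
    then show ?thesis by (simp add: sum.delta)
  qed
  show ?thesis
  proof (cases "even \<nu>")
    case True
    then obtain k where k: "\<nu> = 2 * k" by blast
    have "coeff (symbol \<nu> b) \<nu> = (-1) ^ k * b 0" for b
      using top[of "\<lambda>p. of_nat (k choose p) * (-1) ^ p * b (k - p)" k k]
      by (simp add: symbol_def Let_def k mult_2)
    then show ?thesis by (intro exI[of _ "(-1) ^ k"]) simp
  next
    case False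
    then obtain k where k: "\<nu> = 2 * k + 1" by (rule oddE)
    have kd: "\<nu> div 2 = k" "\<nu> = k + Suc k" "\<nu> = Suc k + k" using k by simp_all
    have "coeff (symbol \<nu> b) \<nu> = - 2 * (-1) ^ k * b 0" for b
    proof -
      have "coeff (\<Sum>p\<le>Suc k. monom (of_nat (Suc k choose p) * (-1) ^ p * b (Suc k - p)) (k + p)) \<nu> = - ((-1) ^ k) * b 0"
        unfolding kd(2) top by simp
      moreover have "coeff (\<Sum>p\<le>k. monom (of_nat (k choose p) * (-1) ^ p * b (k - p)) (Suc k + p)) \<nu> = (-1) ^ k * b 0"
        unfolding kd(3) top by simp
      ultimately show ?thesis
        unfolding symbol_def Let_def kd(1) using False by (simp only: if_False coeff_diff add_Suc) simp
    qed
    then show ?thesis by (intro exI[of _ "- 2 * (-1) ^ k"]) simp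
  qed
qed

text \<open>Testing with \<open>w = exp (a x)\<close> and \<open>z = exp (- a x) f\<close> yields a polynomial in \<open>a\<close>; the top order
  contributes the coefficient of \<open>a\<^sup>\<nu>\<close>.\<close>

lemma coefficients_vanish:
  assumes lin: "\<And>\<nu>. \<nu> < n \<Longrightarrow> test_linear (W \<nu>)"
    and eq: "\<And>w z. smooth w \<Longrightarrow> z \<in> test_functions \<Longrightarrow> (\<Sum>\<nu><n. W \<nu> (core \<nu> w z)) = 0"
    and "\<nu> < n" "f \<in> test_functions"
  shows "W \<nu> f = 0"
  using assms(3,4)
\<comment> \<open>Highest order first: W of larger index already vanishes, also on derivatives of f,
  and smaller indices have symbols of degree below \<nu>.\<close>
proof (induction "n - \<nu>" arbitrary: \<nu> f rule: less_induct)
  case less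
  define P where "P = (\<Sum>\<mu><n. symbol \<mu> (\<lambda>q. W \<mu> (nderiv q f)))"
  have "poly P a = 0" for a
  proof -
    have "poly P a = (\<Sum>\<mu><n. W \<mu> (core \<mu> (\<lambda>x. exp (a * complex_of_real x)) (\<lambda>x. exp (- a * complex_of_real x) * f x)))"
      unfolding P_def poly_sum by (intro sum.cong refl poly_symbol lin less.prems) simp
    also have "\<dots> = 0"
      by (intro eq smooth_exp_line test_mult_smooth less.prems)
    finally show ?thesis .
  qed
  then have "P = 0" using poly_all_0_iff_0 by blast
  then have "0 = (\<Sum>\<mu><n. coeff (symbol \<mu> (\<lambda>q. W \<mu> (nderiv q f))) \<nu>)"
    unfolding P_def by (metis coeff_0 coeff_sum)
  also have "\<dots> = (\<Sum>\<mu>\<in>{\<nu>}. coeff (symbol \<mu> (\<lambda>q. W \<mu> (nderiv q f))) \<nu>)"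
  proof (rule sum.mono_neutral_right)
    show "\<forall>\<mu>\<in>{..<n} - {\<nu>}. coeff (symbol \<mu> (\<lambda>q. W \<mu> (nderiv q f))) \<nu> = 0"
    proof
      fix \<mu> assume \<mu>: "\<mu> \<in> {..<n} - {\<nu>}"
      show "coeff (symbol \<mu> (\<lambda>q. W \<mu> (nderiv q f))) \<nu> = 0"
      proof (cases "\<mu> < \<nu>")
        case True
        then show ?thesis by (rule coeff_symbol_above)
      next
        case False
        then have "W \<mu> (nderiv q f) = 0" for q
          using \<mu> less.prems by (intro less.hyps test_nderiv) auto
        then show ?thesis by (simp add: symbol_0)
      qed
    qed
  qed (use less.prems in auto)
  finally have "coeff (symbol \<nu> (\<lambda>q. W \<nu> (nderiv q f))) \<nu> = 0" by simp
  then show ?case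
    using coeff_symbol_top[of \<nu>] by (metis mult_eq_0_iff nderiv_0)
qed

subsection \<open>The association condition\<close>

text \<open>Chains with almost everywhere equal first entries agree almost everywhere throughout, so
  the formula is independent of the chain supplied with y.\<close>

lemma quasi_deriv_form_all:
  assumes "m \<ge> 1" and Q: "regular_Q m Q" and "matrix_ae_eq m F (S_map m Q)" "y \<in> quasi_domain m F"
    and v: "form_domain m v" "AE x in unit_measure. y x = v 0 x" and z: "z \<in> test_functions"
  shows "regular_dist (quasi_deriv F y (2 * m)) z =
       (-1) ^ m * (\<integral>x. v m x * nderiv m z x \<partial>unit_measure) + (\<integral>x. Q_form m Q v z x \<partial>unit_measure)"
proof -
  obtain u where u: "form_domain m u" "AE x in unit_measure. y x = u 0 x"
    "regular_dist (quasi_deriv F y (2 * m)) z =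
       (-1) ^ m * (\<integral>x. u m x * nderiv m z x \<partial>unit_measure) + (\<integral>x. Q_form m Q u z x \<partial>unit_measure)"
    using quasi_deriv_form[OF assms(1-4)] z by blast
  have "AE x in unit_measure. u 0 x = v 0 x"
    using u(2) v(2) by eventually_elim simp
  then have "AE x in unit_measure. u r x = v r x" if "r \<in> {..m}" for r
    using ac_chain_unique_AE[of m u v r] u(1) v(1) that by (simp add: form_domain_def)
  then have "AE x in unit_measure. \<forall>r\<in>{..m}. u r x = v r x"
    by (rule AE_finite_allI[OF finite_atMost])
  then have ae: "AE x in unit_measure. u m x * nderiv m z x = v m x * nderiv m z x"
    "AE x in unit_measure. Q_form m Q u z x = Q_form m Q v z x"
    by (eventually_elim, simp add: Q_form_def)+
  have "L1 (\<lambda>x. u m x * nderiv m z x)"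
    using u(1) by (intro L1_mult_test test_nderiv z) (auto simp: form_domain_def ac_chain_def)
  from integral_cong_L1_AE[OF this ae(1)] integral_cong_L1_AE[OF Q_form_L1[OF Q u(1) z] ae(2)] u(3)
  show ?thesis by simp
qed

lemma integral_Q_form_chi:
  assumes v: "form_domain m v" and z: "z \<in> test_functions"
    and t: "\<And>\<nu> i. \<nu> < 2 * m \<Longrightarrow> i \<le> sing_order m \<nu> \<Longrightarrow> L1 (t \<nu> i)"
      "\<And>\<nu>. \<nu> < 2 * m \<Longrightarrow> t \<nu> (sing_order m \<nu>) \<in> Lp 2"
    and Q: "\<And>r j x. r \<le> m \<Longrightarrow> j \<le> m \<Longrightarrow> Q r j x = (\<Sum>\<nu><2 * m. \<Sum>i\<le>sing_order m \<nu>. t \<nu> i x * chi \<nu> i r j)"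
  shows "(\<integral>x. Q_form m Q v z x \<partial>unit_measure) =
    (\<Sum>\<nu><2 * m. \<Sum>i\<le>sing_order m \<nu>. \<integral>x. t \<nu> i x * pairing \<nu> i (\<lambda>r. v r x) (\<lambda>j. nderiv j z x) \<partial>unit_measure)"
proof -
  have L: "L1 (\<lambda>x. t \<nu> i x * pairing \<nu> i (\<lambda>r. v r x) (\<lambda>j. nderiv j z x))" if "\<nu> < 2 * m" "i \<le> sing_order m \<nu>" for \<nu> i
    by (rule coefficient_pairing_L1[OF v z that t(1)[OF that]]) (use t(2)[OF that(1)] in auto)
  have "(\<integral>x. Q_form m Q v z x \<partial>unit_measure) =
    (\<integral>x. (\<Sum>\<nu><2 * m. \<Sum>i\<le>sing_order m \<nu>. t \<nu> i x * pairing \<nu> i (\<lambda>r. v r x) (\<lambda>j. nderiv j z x)) \<partial>unit_measure)"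
    by (simp only: Q_form_chi[of m Q _ t, OF Q])
  also have "\<dots> = (\<Sum>\<nu><2 * m. \<integral>x. (\<Sum>i\<le>sing_order m \<nu>. t \<nu> i x * pairing \<nu> i (\<lambda>r. v r x) (\<lambda>j. nderiv j z x)) \<partial>unit_measure)"
    by (rule Bochner_Integration.integral_sum, rule Bochner_Integration.integrable_sum, rule L) auto
  also have "\<dots> = (\<Sum>\<nu><2 * m. \<Sum>i\<le>sing_order m \<nu>. \<integral>x. t \<nu> i x * pairing \<nu> i (\<lambda>r. v r x) (\<lambda>j. nderiv j z x) \<partial>unit_measure)"
    by (intro sum.cong refl Bochner_Integration.integral_sum L) auto
  finally show ?thesis .
qed

text \<open>The coefficients of the matrix Q minus those of the weak form of the differential
  expression; the latter occur at the top index only.\<close>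

definition defect :: "nat \<Rightarrow> (nat \<Rightarrow> functional) \<Rightarrow> (nat \<Rightarrow> nat \<Rightarrow> real \<Rightarrow> complex) \<Rightarrow> nat \<Rightarrow> nat \<Rightarrow> real \<Rightarrow> complex" where
  "defect m \<T> t \<nu> i x = t \<nu> i x - (if i = sing_order m \<nu> then (-1) ^ i * primitive i (\<T> \<nu>) x else 0)"

text \<open>The common setting of both inclusions: once the coefficients are built from parameters,
  once they are read off from a given F.\<close>

locale chi_expansion =
  fixes m :: nat and \<T> :: "nat \<Rightarrow> functional" and t :: "nat \<Rightarrow> nat \<Rightarrow> real \<Rightarrow> complex"
    and Q :: "nat \<Rightarrow> nat \<Rightarrow> real \<Rightarrow> complex" and F :: matrix_fun
  assumes m: "m \<ge> 1" and \<T>: "\<T> \<in> coeff_space m"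
    and t1: "\<And>\<nu> i. \<nu> < 2 * m \<Longrightarrow> i \<le> sing_order m \<nu> \<Longrightarrow> L1 (t \<nu> i)"
    and t2: "\<And>\<nu>. \<nu> < 2 * m \<Longrightarrow> t \<nu> (sing_order m \<nu>) \<in> Lp 2"
    and Q: "\<And>r j x. r \<le> m \<Longrightarrow> j \<le> m \<Longrightarrow> Q r j x = (\<Sum>\<nu><2 * m. \<Sum>i\<le>sing_order m \<nu>. t \<nu> i x * chi \<nu> i r j)"
    and QF: "regular_Q m Q" "matrix_ae_eq m F (S_map m Q)"
begin

lemma primitive_Lp2: "\<nu> < 2 * m \<Longrightarrow> primitive (sing_order m \<nu>) (\<T> \<nu>) \<in> Lp 2"
  using \<T> primitive(1) by (auto simp: coeff_space_def)

lemma coeff_test: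
  assumes "\<nu> < 2 * m" "z \<in> test_functions"
  shows "\<T> \<nu> z = (-1) ^ sing_order m \<nu> * (\<integral>x. primitive (sing_order m \<nu>) (\<T> \<nu>) x * nderiv (sing_order m \<nu>) z x \<partial>unit_measure)"
proof -
  have "\<T> \<nu> z = (dist_deriv ^^ sing_order m \<nu>) (regular_dist (primitive (sing_order m \<nu>) (\<T> \<nu>))) z"
    using \<T> assms(1) primitive(2)[of "\<T> \<nu>" "sing_order m \<nu>"] by (simp add: coeff_space_def)
  then show ?thesis
    by (simp add: dist_deriv_pow_test assms(2) regular_dist_test test_nderiv)
qed

lemma defect_L1: "\<nu> < 2 * m \<Longrightarrow> i \<le> sing_order m \<nu> \<Longrightarrow> L1 (defect m \<T> t \<nu> i)"
  unfolding defect_def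
  using t1[of \<nu> i] Lp2_imp_L1[OF primitive_Lp2[of \<nu>]] by (cases "i = sing_order m \<nu>") auto

lemma defect_Lp2:
  assumes "\<nu> < 2 * m"
  shows "defect m \<T> t \<nu> (sing_order m \<nu>) \<in> Lp 2"
  using Lp2_diff[OF t2[OF assms] Lp2_cmult[OF primitive_Lp2[OF assms]]] by (simp add: defect_def[abs_def])

lemma integral_defect:
  assumes "\<nu> < 2 * m" "i \<le> sing_order m \<nu>" "L1 (\<lambda>x. t \<nu> i x * h x)"
    "L1 (\<lambda>x. primitive (sing_order m \<nu>) (\<T> \<nu>) x * h x)"
  shows "(\<integral>x. defect m \<T> t \<nu> i x * h x \<partial>unit_measure) = (\<integral>x. t \<nu> i x * h x \<partial>unit_measure)
    - (if i = sing_order m \<nu> then (-1) ^ i * (\<integral>x. primitive (sing_order m \<nu>) (\<T> \<nu>) x * h x \<partial>unit_measure) else 0)"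
proof (cases "i = sing_order m \<nu>")
  case True
  have "(\<integral>x. defect m \<T> t \<nu> i x * h x \<partial>unit_measure) = (\<integral>x. t \<nu> i x * h x
      - (-1) ^ i * (primitive (sing_order m \<nu>) (\<T> \<nu>) x * h x) \<partial>unit_measure)"
    by (intro Bochner_Integration.integral_cong refl) (simp add: defect_def True left_diff_distrib mult.assoc)
  also have "\<dots> = (\<integral>x. t \<nu> i x * h x \<partial>unit_measure) - (\<integral>x. (-1) ^ i * (primitive (sing_order m \<nu>) (\<T> \<nu>) x * h x) \<partial>unit_measure)"
    by (rule Bochner_Integration.integral_diff[OF assms(3) integrable_mult_right[OF assms(4)]])
  finally show ?thesis using True by simp
qed (simp add: defect_def)

text \<open>The distribution generated by the coefficients of index \<nu>, minus the prescribed
  \<tau>. Its vanishing for all \<nu> is the condition equivalent to association.\<close>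

definition defect_functional :: "nat \<Rightarrow> functional" where
  "defect_functional \<nu> z = (\<Sum>i\<le>sing_order m \<nu>. \<integral>x. defect m \<T> t \<nu> i x * nderiv i z x \<partial>unit_measure)"

lemma defect_functional_eq:
  assumes "\<nu> < 2 * m" "z \<in> test_functions"
  shows "defect_functional \<nu> z = (\<Sum>i<sing_order m \<nu>. \<integral>x. t \<nu> i x * nderiv i z x \<partial>unit_measure)
    + (\<integral>x. t \<nu> (sing_order m \<nu>) x * nderiv (sing_order m \<nu>) z x \<partial>unit_measure) - \<T> \<nu> z"
proof -
  have "(\<integral>x. defect m \<T> t \<nu> i x * nderiv i z x \<partial>unit_measure) = (\<integral>x. t \<nu> i x * nderiv i z x \<partial>unit_measure)
    - (if i = sing_order m \<nu> then (-1) ^ i * (\<integral>x. primitive (sing_order m \<nu>) (\<T> \<nu>) x * nderiv i z x \<partial>unit_measure) else 0)"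
    if "i \<le> sing_order m \<nu>" for i
    using assms that by (intro integral_defect L1_mult_test t1 test_nderiv Lp2_imp_L1 primitive_Lp2)
  then have "defect_functional \<nu> z = (\<Sum>i\<le>sing_order m \<nu>. (\<integral>x. t \<nu> i x * nderiv i z x \<partial>unit_measure)
    - (if i = sing_order m \<nu> then (-1) ^ i * (\<integral>x. primitive (sing_order m \<nu>) (\<T> \<nu>) x * nderiv i z x \<partial>unit_measure) else 0))"
    unfolding defect_functional_def by (intro sum.cong) auto
  also have "\<dots> = (\<Sum>i\<le>sing_order m \<nu>. \<integral>x. t \<nu> i x * nderiv i z x \<partial>unit_measure) - \<T> \<nu> z"
    unfolding sum_subtractf coeff_test[OF assms] by (simp add: sum.delta)
  finally show ?thesis by (simp add: lessThan_Suc_atMost[symmetric])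
qed

lemma test_linear_defect: "\<nu> < 2 * m \<Longrightarrow> test_linear (defect_functional \<nu>)"
proof -
  assume \<nu>: "\<nu> < 2 * m"
  have "test_linear (\<lambda>z. \<Sum>i\<le>sing_order m \<nu>. regular_dist (defect m \<T> t \<nu> i) (nderiv i z))"
    by (intro test_linear_sum test_linear_comp_nderiv test_linear_regular defect_L1 \<nu>) simp
  then show ?thesis
    unfolding test_linear_def defect_functional_def by (simp add: regular_dist_test test_nderiv test_add test_cmult)
qed

definition defect_form :: "(nat \<Rightarrow> real \<Rightarrow> complex) \<Rightarrow> (real \<Rightarrow> complex) \<Rightarrow> complex" where
  "defect_form v z = (\<Sum>\<nu><2 * m. \<Sum>i\<le>sing_order m \<nu>.
     \<integral>x. defect m \<T> t \<nu> i x * pairing \<nu> i (\<lambda>r. v r x) (\<lambda>j. nderiv j z x) \<partial>unit_measure)"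

text \<open>Both weak forms begin with the same term in v m and the m-th derivative of z, so their
  difference contains the coefficients alone.\<close>

lemma association_defect:
  assumes y: "y \<in> quasi_domain m F" and v: "form_domain m v" "AE x in unit_measure. y x = v 0 x"
    and z: "z \<in> test_functions"
  shows "regular_dist (quasi_deriv F y (2 * m)) z - diff_expr m \<T> y z = defect_form v z"
proof -
  let ?s = "sing_order m"
  let ?p = "\<lambda>\<nu> i x. pairing \<nu> i (\<lambda>r. v r x) (\<lambda>j. nderiv j z x)"
  have Lp: "L1 (\<lambda>x. primitive (?s \<nu>) (\<T> \<nu>) x * ?p \<nu> (?s \<nu>) x)" if "\<nu> < 2 * m" for \<nu>
    by (rule Lp2_mult[OF primitive_Lp2[OF that] pairing_chain(2)[OF v(1) z that order_refl]])
  have row: "(\<Sum>i\<le>?s \<nu>. \<integral>x. defect m \<T> t \<nu> i x * ?p \<nu> i x \<partial>unit_measure) =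
      (\<Sum>i\<le>?s \<nu>. \<integral>x. t \<nu> i x * ?p \<nu> i x \<partial>unit_measure)
      - (\<integral>x. (-1) ^ ?s \<nu> * primitive (?s \<nu>) (\<T> \<nu>) x * ?p \<nu> (?s \<nu>) x \<partial>unit_measure)" if \<nu>: "\<nu> < 2 * m" for \<nu>
  proof -
    have "(\<integral>x. defect m \<T> t \<nu> i x * ?p \<nu> i x \<partial>unit_measure) = (\<integral>x. t \<nu> i x * ?p \<nu> i x \<partial>unit_measure)
      - (if i = ?s \<nu> then (\<integral>x. (-1) ^ ?s \<nu> * primitive (?s \<nu>) (\<T> \<nu>) x * ?p \<nu> (?s \<nu>) x \<partial>unit_measure) else 0)"
      if i: "i \<le> ?s \<nu>" for i
    proof (cases "i = ?s \<nu>")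
      case True
      have "L1 (\<lambda>x. t \<nu> i x * ?p \<nu> i x)"
        by (rule coefficient_pairing_L1[OF v(1) z \<nu> i t1[OF \<nu> i]]) (use t2[OF \<nu>] in simp)
      from integral_defect[OF \<nu> i this] Lp[OF \<nu>] True show ?thesis by (simp add: mult.assoc)
    qed (simp add: defect_def)
    then have "(\<Sum>i\<le>?s \<nu>. \<integral>x. defect m \<T> t \<nu> i x * ?p \<nu> i x \<partial>unit_measure) =
      (\<Sum>i\<le>?s \<nu>. (\<integral>x. t \<nu> i x * ?p \<nu> i x \<partial>unit_measure)
      - (if i = ?s \<nu> then (\<integral>x. (-1) ^ ?s \<nu> * primitive (?s \<nu>) (\<T> \<nu>) x * ?p \<nu> (?s \<nu>) x \<partial>unit_measure) else 0))"
      by (intro sum.cong) auto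
    then show ?thesis by (simp add: sum_subtractf sum.delta)
  qed
  have "defect_form v z = (\<Sum>\<nu><2 * m. (\<Sum>i\<le>?s \<nu>. \<integral>x. t \<nu> i x * ?p \<nu> i x \<partial>unit_measure)
      - (\<integral>x. (-1) ^ ?s \<nu> * primitive (?s \<nu>) (\<T> \<nu>) x * ?p \<nu> (?s \<nu>) x \<partial>unit_measure))"
    unfolding defect_form_def by (intro sum.cong refl row) simp
  moreover have "(\<integral>x. Q_form m Q v z x \<partial>unit_measure) =
    (\<Sum>\<nu><2 * m. \<Sum>i\<le>?s \<nu>. \<integral>x. t \<nu> i x * ?p \<nu> i x \<partial>unit_measure)"
    by (rule integral_Q_form_chi[OF v(1) z]) (erule (1) t1, erule t2, erule (1) Q)
  ultimately show ?thesis
    unfolding quasi_deriv_form_all[OF m QF y v z] diff_expr_form[OF \<T> v z]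
    by (simp add: sum_subtractf)
qed

text \<open>For nonsmooth v the pairing is no test function, so the hypothesis is first extended by
  \<open>functional_vanishes_on_ac_chain\<close>.\<close>

lemma defect_form_0:
  assumes 0: "\<And>\<nu> z. \<nu> < 2 * m \<Longrightarrow> z \<in> test_functions \<Longrightarrow> defect_functional \<nu> z = 0"
    and v: "form_domain m v" and z: "z \<in> test_functions"
  shows "defect_form v z = 0"
  unfolding defect_form_def
proof (rule sum.neutral, rule ballI)
  fix \<nu> assume "\<nu> \<in> {..<2 * m}"
  then have \<nu>: "\<nu> < 2 * m" by simp
  let ?s = "sing_order m \<nu>"
  have 1: "L1 (defect m \<T> t \<nu> i)" if "i \<le> ?s" for i
    by (rule defect_L1[OF \<nu> that])
  have 2: "(\<Sum>i\<le>?s. \<integral>x. defect m \<T> t \<nu> i x * nderiv i z x \<partial>unit_measure) = 0"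
    if "z \<in> test_functions" for z
    using 0[OF \<nu> that] by (simp add: defect_functional_def)
  have 3: "L1 (\<lambda>x. defect m \<T> t \<nu> ?s x * pairing \<nu> ?s (\<lambda>r. v r x) (\<lambda>j. nderiv j z x))"
    by (rule Lp2_mult[OF defect_Lp2[OF \<nu>] pairing_chain(2)[OF v z \<nu> order_refl]])
  have 4: "pairing \<nu> l (\<lambda>r. v r 0) (\<lambda>j. nderiv j z 0) = 0 \<and> pairing \<nu> l (\<lambda>r. v r 1) (\<lambda>j. nderiv j z 1) = 0" for l
    using pairing_chain(3)[OF v z \<nu>, of 0 l] pairing_chain(3)[OF v z \<nu>, of 1 l] by simp
  show "(\<Sum>i\<le>?s. \<integral>x. defect m \<T> t \<nu> i x * pairing \<nu> i (\<lambda>r. v r x) (\<lambda>j. nderiv j z x) \<partial>unit_measure) = 0"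
    by (rule functional_vanishes_on_ac_chain[where u = "defect m \<T> t \<nu>" and i = ?s
          and h = "\<lambda>l x. pairing \<nu> l (\<lambda>r. v r x) (\<lambda>j. nderiv j z x)"])
      (erule 1, erule 2, rule pairing_chain(1)[OF v z \<nu>], rule 4, rule 3)
qed

text \<open>Association is equality of HOL functions, so the values off the test functions must
  agree as well.\<close>

lemma diff_expr_off_test: "z \<notin> test_functions \<Longrightarrow> diff_expr m \<T> y z = 0"
  unfolding diff_expr_def
  by (simp add: dist_deriv_pow_off_test regular_dist_off_test dist_prod_def Let_def del: funpow.simps)

lemma associated_if_defect_0:
  assumes "\<And>\<nu> z. \<nu> < 2 * m \<Longrightarrow> z \<in> test_functions \<Longrightarrow> defect_functional \<nu> z = 0"
  shows "F \<in> associated_matrices m \<T>"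
proof -
  have "diff_expr m \<T> y = regular_dist (quasi_deriv F y (2 * m))" if y: "y \<in> quasi_domain m F" for y
  proof
    fix z
    show "diff_expr m \<T> y z = regular_dist (quasi_deriv F y (2 * m)) z"
    proof (cases "z \<in> test_functions")
      case True
      obtain v where v: "form_domain m v" "AE x in unit_measure. y x = v 0 x"
        using quasi_deriv_form[OF m QF y] by blast
      show ?thesis
        using association_defect[OF y v True] defect_form_0[OF assms v(1) True] by simp
    next
      case False
      then show ?thesis by (simp add: diff_expr_off_test regular_dist_off_test)
    qed
  qed
  then show ?thesis
    using matrix_class_if_S_map[OF QF] by (simp add: associated_matrices_def)
qed

lemma form_domain_smooth: "smooth w \<Longrightarrow> form_domain m (\<lambda>r. nderiv r w)"
  unfolding form_domain_def ac_chain_def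
  using smooth_ac_deriv[of w] by (auto intro: continuous_imp_L1 continuous_imp_Lp2 smooth_continuous smooth_nderiv)

lemma defect_0_if_associated:
  assumes F: "F \<in> associated_matrices m \<T>" and "\<nu> < 2 * m" "f \<in> test_functions"
  shows "defect_functional \<nu> f = 0"
proof (rule coefficients_vanish[OF test_linear_defect _ assms(2,3)])
  fix w z assume w: "smooth w" and z: "z \<in> test_functions"
  \<comment> \<open>With z fixed, the defect form becomes a functional of v with coefficients e r,
    which association forces to annihilate the domain. The coefficient of order m is square
    integrable by \<open>chi_border\<close>.\<close>
  define d where "d r j x = (\<Sum>\<nu><2 * m. \<Sum>i\<le>sing_order m \<nu>. defect m \<T> t \<nu> i x * chi \<nu> i r j)" for r j x
  define e where "e r x = (\<Sum>j\<le>m. d r j x * nderiv j z x)" for r x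
  have form: "(\<integral>x. (\<Sum>r\<le>m. e r x * v r x) \<partial>unit_measure) = defect_form v z" if "form_domain m v" for v
  proof -
    have "(\<lambda>x. \<Sum>r\<le>m. e r x * v r x) = (\<lambda>x. Q_form m d v z x)"
      unfolding Q_form_def e_def sum_distrib_right by (simp only: mult_ac)
    then have "(\<integral>x. (\<Sum>r\<le>m. e r x * v r x) \<partial>unit_measure) = (\<integral>x. Q_form m d v z x \<partial>unit_measure)"
      by (rule arg_cong)
    also have "\<dots> = defect_form v z"
      unfolding defect_form_def
      by (rule integral_Q_form_chi[OF that z], erule (1) defect_L1, erule defect_Lp2, rule d_def)
    finally show ?thesis .
  qed
  have "(\<integral>x. (\<Sum>r\<le>m. e r x * nderiv r w x) \<partial>unit_measure) = 0"
  proof (rule annihilator_vanishes_on_smooth[OF m QF _ _ _ w])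
    have zc: "continuous_on {0..1} (nderiv j z)" for j
      by (intro test_continuous test_nderiv z)
    show "L1 (e r)" for r
    proof -
      have "L1 (\<lambda>x. defect m \<T> t \<nu> i x * chi \<nu> i r j)" if "\<nu> < 2 * m" "i \<le> sing_order m \<nu>" for \<nu> i j
        using defect_L1[OF that] by (rule integrable_mult_left)
      then have "L1 (d r j)" for j
        unfolding d_def[abs_def] by (intro Bochner_Integration.integrable_sum) auto
      then show ?thesis
        unfolding e_def[abs_def] by (intro Bochner_Integration.integrable_sum L1_mult_continuous zc)
    qed
    show "e m \<in> Lp 2"
    proof -
      have "(\<lambda>x. defect m \<T> t \<nu> i x * chi \<nu> i m j) \<in> Lp 2" if "\<nu> < 2 * m" "i \<le> sing_order m \<nu>" for \<nu> i j
      proof (cases "i = sing_order m \<nu>")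
        case True
        show ?thesis
          using Lp2_cmult[OF defect_Lp2[OF that(1)], of "chi \<nu> i m j"] unfolding True by (simp only: mult.commute)
      next
        case False
        then have "i < sing_order m \<nu>" using that by simp
        then show ?thesis using chi_border(2)[OF that(1)] Lp2_const[of 0] by simp
      qed
      then have "d m j \<in> Lp 2" for j
        unfolding d_def[abs_def] by (intro Lp2_sum) auto
      then have "(\<lambda>x. nderiv j z x * d m j x) \<in> Lp 2" for j
        by (intro Lp2_continuous_mult zc)
      then have "(\<lambda>x. \<Sum>j\<le>m. nderiv j z x * d m j x) \<in> Lp 2" by (intro Lp2_sum)
      then show ?thesis unfolding e_def[abs_def] by (simp only: mult.commute)
    qed
    show "(\<integral>x. (\<Sum>r\<le>m. e r x * v r x) \<partial>unit_measure) = 0"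
      if y: "y \<in> quasi_domain m F" and v: "form_domain m v" "AE x in unit_measure. y x = v 0 x" for y v
    proof -
      have "diff_expr m \<T> y = regular_dist (quasi_deriv F y (2 * m))"
        using F y by (simp add: associated_matrices_def)
      then show ?thesis
        using association_defect[OF y v z] form[OF v(1)] by simp
    qed
  qed
  then have "defect_form (\<lambda>r. nderiv r w) z = 0"
    using form[OF form_domain_smooth[OF w]] by simp
  then show "(\<Sum>\<nu><2 * m. defect_functional \<nu> (core \<nu> w z)) = 0"
    unfolding defect_form_def defect_functional_def
    by (simp add: pairing_nderiv_core w test_smooth[OF z])
qed

end

section \<open>Passing between parameters and matrices\<close>

lemma S_map_cong_AE:
  assumes "\<And>r j. r \<le> m \<Longrightarrow> j \<le> m \<Longrightarrow> AE x in unit_measure. Q r j x = Q' r j x"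
  shows "AE x in unit_measure. S_map m Q k j x = S_map m Q' k j x"
proof -
  have "AE x in unit_measure. \<forall>r\<in>{..m}. \<forall>j\<in>{..m}. Q r j x = Q' r j x"
    using assms by (intro AE_finite_allI) auto
  then show ?thesis
  proof eventually_elim
    case (elim x)
    then show ?case by (auto simp: S_map_def)
  qed
qed

definition Q_coeffs ::
  "(nat \<Rightarrow> functional \<Rightarrow> functional) \<Rightarrow> nat \<Rightarrow> (nat \<Rightarrow> functional) \<Rightarrow>
   (nat \<Rightarrow> nat \<Rightarrow> real \<Rightarrow> complex) \<Rightarrow> (nat \<Rightarrow> nat \<Rightarrow> complex) \<Rightarrow> nat \<Rightarrow> nat \<Rightarrow> real \<Rightarrow> complex" where
  "Q_coeffs A m \<T> t c \<nu> i = (if i < sing_order m \<nu> then t \<nu> i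
     else dist_fun (top_coeff A (sing_order m \<nu>) (\<T> \<nu>) (t \<nu>) (c \<nu>)))"

lemma Q_matrix_coeffs:
  "Q_matrix A m \<T> t c r j x = (\<Sum>\<nu><2 * m. \<Sum>i\<le>sing_order m \<nu>. Q_coeffs A m \<T> t c \<nu> i x * chi \<nu> i r j)"
  unfolding Q_matrix_def Q_coeffs_def by (intro sum.cong refl) simp

lemma regular_Q_if_chi:
  assumes t: "\<And>\<nu> i. \<nu> < 2 * m \<Longrightarrow> i \<le> sing_order m \<nu> \<Longrightarrow> L1 (t \<nu> i)"
    "\<And>\<nu>. \<nu> < 2 * m \<Longrightarrow> t \<nu> (sing_order m \<nu>) \<in> Lp 2"
    and Q: "\<And>r j x. Q r j x = (\<Sum>\<nu><2 * m. \<Sum>i\<le>sing_order m \<nu>. t \<nu> i x * chi \<nu> i r j)"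
  shows "regular_Q m Q"
proof -
  have Qeq: "Q r j = (\<lambda>x. \<Sum>\<nu><2 * m. \<Sum>i\<le>sing_order m \<nu>. t \<nu> i x * chi \<nu> i r j)" for r j
    using Q by blast
  have L2: "Q r j \<in> Lp 2" if border: "r = m \<or> j = m" for r j
    unfolding Qeq
  proof (intro Lp2_sum)
    fix \<nu> i assume "\<nu> \<in> {..<2 * m}" "i \<in> {..sing_order m \<nu>}"
    then have \<nu>: "\<nu> < 2 * m" "i \<le> sing_order m \<nu>" by auto
    show "(\<lambda>x. t \<nu> i x * chi \<nu> i r j) \<in> Lp 2"
    proof (cases "i = sing_order m \<nu>")
      case True
      show ?thesis
        using Lp2_cmult[OF t(2)[OF \<nu>(1)], of "chi \<nu> i r j"] unfolding True by (simp only: mult.commute)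
    next
      case False
      then have "i < sing_order m \<nu>" using \<nu> by simp
      then have "chi \<nu> i r j = 0" using chi_border[OF \<nu>(1)] border by blast
      then show ?thesis using Lp2_const[of 0] by simp
    qed
  qed
  have "L1 (Q r j)" for r j
    unfolding Qeq using t(1) by (intro Bochner_Integration.integrable_sum integrable_mult_left) auto
  moreover have "Q m m x = 0" for x
    unfolding Q by (intro sum.neutral ballI) (simp add: chi_last_entry)
  ultimately show ?thesis
    using L2 unfolding regular_Q_def by blast
qed

theorem corollary2p9:
  fixes m :: nat
    and A :: "nat \<Rightarrow> functional \<Rightarrow> functional"
    and \<T> :: "nat \<Rightarrow> functional"
  assumes "m \<ge> 1"
    and "antiderivative_choice A"
    and "\<T> \<in> coeff_space m"
  shows
    "(\<forall>(t :: nat \<Rightarrow> nat \<Rightarrow> real \<Rightarrow> complex) (c :: nat \<Rightarrow> nat \<Rightarrow> complex).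
        (\<forall>\<nu><2 * m. \<forall>i<sing_order m \<nu>. t \<nu> i \<in> Lp 1) \<longrightarrow>
        (\<forall>\<nu><2 * m. top_coeff A (sing_order m \<nu>) (\<T> \<nu>) (t \<nu>) (c \<nu>) \<in> regular_dist ` Lp 2)) \<and>
     associated_matrices m \<T> =
       {F. \<exists>(t :: nat \<Rightarrow> nat \<Rightarrow> real \<Rightarrow> complex) (c :: nat \<Rightarrow> nat \<Rightarrow> complex).
          (\<forall>\<nu>\<in>{0..2 * m - 2}. \<forall>i<sing_order m \<nu>. t \<nu> i \<in> Lp 1) \<and>
          matrix_ae_eq m F (F_map A m \<T> t c)}"
proof (intro conjI allI impI set_eqI)
  fix t :: "nat \<Rightarrow> nat \<Rightarrow> real \<Rightarrow> complex" and c :: "nat \<Rightarrow> nat \<Rightarrow> complex" and \<nu>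
  assume t: "\<forall>\<nu><2 * m. \<forall>i<sing_order m \<nu>. t \<nu> i \<in> Lp 1" and \<nu>: "\<nu> < 2 * m"
  have "\<T> \<nu> \<in> neg_sobolev (sing_order m \<nu>)" using assms(3) \<nu> by (simp add: coeff_space_def)
  moreover have "L1 (t \<nu> j)" if "j < sing_order m \<nu>" for j using t \<nu> that Lp1_iff by blast
  ultimately obtain s where "s \<in> Lp 2" "top_coeff A (sing_order m \<nu>) (\<T> \<nu>) (t \<nu>) (c \<nu>) = regular_dist s"
    using top_coeff_L2[OF assms(2), of "\<T> \<nu>" "sing_order m \<nu>" "t \<nu>" "c \<nu>"] by blast
  then show "top_coeff A (sing_order m \<nu>) (\<T> \<nu>) (t \<nu>) (c \<nu>) \<in> regular_dist ` Lp 2" by blast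
next
  fix F :: matrix_fun
  have neg: "\<T> \<nu> \<in> neg_sobolev (sing_order m \<nu>)" if "\<nu> < 2 * m" for \<nu>
    using assms(3) that by (simp add: coeff_space_def)
  show "F \<in> associated_matrices m \<T> \<longleftrightarrow> F \<in> {F. \<exists>(t :: nat \<Rightarrow> nat \<Rightarrow> real \<Rightarrow> complex) (c :: nat \<Rightarrow> nat \<Rightarrow> complex).
          (\<forall>\<nu>\<in>{0..2 * m - 2}. \<forall>i<sing_order m \<nu>. t \<nu> i \<in> Lp 1) \<and>
          matrix_ae_eq m F (F_map A m \<T> t c)}"
  proof
    assume "F \<in> {F. \<exists>(t :: nat \<Rightarrow> nat \<Rightarrow> real \<Rightarrow> complex) (c :: nat \<Rightarrow> nat \<Rightarrow> complex).
          (\<forall>\<nu>\<in>{0..2 * m - 2}. \<forall>i<sing_order m \<nu>. t \<nu> i \<in> Lp 1) \<and>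
          matrix_ae_eq m F (F_map A m \<T> t c)}"
    then obtain t c where t: "\<forall>\<nu>\<in>{0..2 * m - 2}. \<forall>i<sing_order m \<nu>. t \<nu> i \<in> Lp 1"
      and F: "matrix_ae_eq m F (F_map A m \<T> t c)" by blast
    have Lt: "L1 (t \<nu> i)" if \<nu>: "\<nu> < 2 * m" and i: "i < sing_order m \<nu>" for \<nu> i
    proof -
      \<comment> \<open>The range of \<nu> stops at 2m - 2, but the remaining index 2m - 1 has order
        0 and hence no parameters below the top.\<close>
      have "\<nu> \<noteq> 2 * m - 1"
      proof
        assume "\<nu> = 2 * m - 1"
        then have "\<nu> = 2 * (m - 1) + 1" using assms(1) by simp
        then have "\<nu> div 2 = m - 1" "\<nu> mod 2 = 1" by simp_all
        then show False using i by (simp add: sing_order_def)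
      qed
      then have "\<nu> \<in> {0..2 * m - 2}" using \<nu> by simp
      then show ?thesis using t i Lp1_iff by blast
    qed
    let ?t = "Q_coeffs A m \<T> t c"
    have top: "?t \<nu> (sing_order m \<nu>) \<in> Lp 2"
      "\<And>z. z \<in> test_functions \<Longrightarrow> \<T> \<nu> z = (\<Sum>j<sing_order m \<nu>. \<integral>x. t \<nu> j x * nderiv j z x \<partial>unit_measure)
       + (\<integral>x. ?t \<nu> (sing_order m \<nu>) x * nderiv (sing_order m \<nu>) z x \<partial>unit_measure)" if \<nu>: "\<nu> < 2 * m" for \<nu>
    proof -
      obtain s where s: "s \<in> Lp 2" "top_coeff A (sing_order m \<nu>) (\<T> \<nu>) (t \<nu>) (c \<nu>) = regular_dist s"
        "\<And>z. z \<in> test_functions \<Longrightarrow> \<T> \<nu> z = (\<Sum>j<sing_order m \<nu>. \<integral>x. t \<nu> j x * nderiv j z x \<partial>unit_measure)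
         + (\<integral>x. s x * nderiv (sing_order m \<nu>) z x \<partial>unit_measure)"
        using top_coeff_L2[OF assms(2) neg[OF \<nu>], of "t \<nu>" "c \<nu>"] Lt[OF \<nu>] by blast
      have L: "L1 s" using s(1) by (rule Lp2_imp_L1)
      have teq: "?t \<nu> (sing_order m \<nu>) = dist_fun (regular_dist s)" by (simp add: Q_coeffs_def s(2))
      have ae: "AE x in unit_measure. s x = ?t \<nu> (sing_order m \<nu>) x"
        unfolding teq by (rule AE_eq_sym[OF dist_fun_regular(2)[OF L]])
      show "?t \<nu> (sing_order m \<nu>) \<in> Lp 2" by (rule Lp2_AE_cong[OF s(1) ae])
      fix z assume z: "z \<in> test_functions"
      have "regular_dist s = regular_dist (?t \<nu> (sing_order m \<nu>))" by (rule regular_dist_cong_AE[OF L ae])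
      from fun_cong[OF this, of "nderiv (sing_order m \<nu>) z"] s(3)[OF z]
      show "\<T> \<nu> z = (\<Sum>j<sing_order m \<nu>. \<integral>x. t \<nu> j x * nderiv j z x \<partial>unit_measure)
         + (\<integral>x. ?t \<nu> (sing_order m \<nu>) x * nderiv (sing_order m \<nu>) z x \<partial>unit_measure)"
        by (simp add: regular_dist_test test_nderiv z)
    qed
    have L: "L1 (?t \<nu> i)" if "\<nu> < 2 * m" "i \<le> sing_order m \<nu>" for \<nu> i
    proof (cases "i < sing_order m \<nu>")
      case True
      then show ?thesis using Lt[OF that(1)] by (simp add: Q_coeffs_def)
    next
      case False
      then show ?thesis using Lp2_imp_L1[OF top(1)[OF that(1)]] that(2) by simp
    qed
    have "regular_Q m (Q_matrix A m \<T> t c)"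
      by (rule regular_Q_if_chi) (erule (1) L, erule top(1), rule Q_matrix_coeffs)
    \<comment> \<open>Here the representation of \<tau> built into \<open>top_coeff\<close> says
      that the defects vanish.\<close>
    then interpret chi_expansion m \<T> ?t "Q_matrix A m \<T> t c" F
      using assms(1,3) F[unfolded F_map_def]
      by unfold_locales (assumption | rule Q_matrix_coeffs | erule (1) L | erule top(1))+
    have "defect_functional \<nu> z = 0" if "\<nu> < 2 * m" "z \<in> test_functions" for \<nu> z
    proof -
      have "(\<Sum>i<sing_order m \<nu>. \<integral>x. ?t \<nu> i x * nderiv i z x \<partial>unit_measure) = (\<Sum>i<sing_order m \<nu>. \<integral>x. t \<nu> i x * nderiv i z x \<partial>unit_measure)"
        by (intro sum.cong refl) (simp add: Q_coeffs_def)
      then show ?thesis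
        using defect_functional_eq[OF that] top(2)[OF that] by simp
    qed
    then show "F \<in> associated_matrices m \<T>"
      by (rule associated_if_defect_0)
  next
    assume F: "F \<in> associated_matrices m \<T>"
    then obtain Q where QF: "regular_Q m Q" "matrix_ae_eq m F (S_map m Q)"
      using S_map_surjective[of F m] by (auto simp: associated_matrices_def)
    have Q2: "Q k m \<in> Lp 2 \<and> Q m k \<in> Lp 2" if "k < m" for k using QF(1) that by (simp add: regular_Q_def)
    have Q0: "Q m m x = 0" for x using QF(1) by (simp add: regular_Q_def)
    obtain t where t: "\<And>\<nu> i. \<nu> < 2 * m \<Longrightarrow> i \<le> sing_order m \<nu> \<Longrightarrow> L1 (t \<nu> i)"
      "\<And>\<nu>. \<nu> < 2 * m \<Longrightarrow> t \<nu> (sing_order m \<nu>) \<in> Lp 2"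
      "\<And>r j x. r \<le> m \<Longrightarrow> j \<le> m \<Longrightarrow> Q r j x = (\<Sum>\<nu><2 * m. \<Sum>i\<le>sing_order m \<nu>. t \<nu> i x * chi \<nu> i r j)"
      using chi_basis[of m Q, OF regular_Q_L1[OF QF(1)] Q2 Q0] by blast
    interpret chi_expansion m \<T> t Q F
      using assms(1,3) QF by unfold_locales (assumption | erule (1) t(1) | erule t(2) | erule (1) t(3))+
    \<comment> \<open>Conversely, vanishing defects are the representation from which the constants
      are recovered.\<close>
    have "\<exists>c. top_coeff A (sing_order m \<nu>) (\<T> \<nu>) (t \<nu>) c = regular_dist (t \<nu> (sing_order m \<nu>))" if \<nu>: "\<nu> < 2 * m" for \<nu>
    proof -
      have eq: "\<T> \<nu> z = (\<Sum>j<sing_order m \<nu>. \<integral>x. t \<nu> j x * nderiv j z x \<partial>unit_measure)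
        + (\<integral>x. t \<nu> (sing_order m \<nu>) x * nderiv (sing_order m \<nu>) z x \<partial>unit_measure)" if "z \<in> test_functions" for z
        using defect_functional_eq[OF \<nu> that] defect_0_if_associated[OF F \<nu> that] by simp
      have "L1 (t \<nu> j)" if "j < sing_order m \<nu>" for j using t(1)[OF \<nu>] that by simp
      from top_coeff_surjective[OF assms(2) neg[OF \<nu>] this t(2)[OF \<nu>] eq] show ?thesis by blast
    qed
    then obtain c where c: "\<And>\<nu>. \<nu> < 2 * m \<Longrightarrow> top_coeff A (sing_order m \<nu>) (\<T> \<nu>) (t \<nu>) (c \<nu>) = regular_dist (t \<nu> (sing_order m \<nu>))"
      by metis
    \<comment> \<open>Equality holds only almost everywhere, because the top coefficients pass
      through the choice in \<open>dist_fun\<close>.\<close>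
    have "AE x in unit_measure. Q r j x = Q_matrix A m \<T> t c r j x" if "r \<le> m" "j \<le> m" for r j
    proof -
      have "AE x in unit_measure. \<forall>\<nu>\<in>{..<2 * m}. dist_fun (top_coeff A (sing_order m \<nu>) (\<T> \<nu>) (t \<nu>) (c \<nu>)) x = t \<nu> (sing_order m \<nu>) x"
        using t(1) by (intro AE_finite_allI) (auto simp: c intro!: dist_fun_regular(2))
      then show ?thesis
      proof eventually_elim
        case (elim x)
        have "t \<nu> i x = Q_coeffs A m \<T> t c \<nu> i x" if "\<nu> < 2 * m" "i \<le> sing_order m \<nu>" for \<nu> i
          using elim that by (cases "i < sing_order m \<nu>") (auto simp: Q_coeffs_def)
        then show ?case
          unfolding t(3)[OF that] Q_matrix_coeffs by (intro sum.cong refl) simp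
      qed
    qed
    then have ae: "AE x in unit_measure. S_map m Q k j x = S_map m (Q_matrix A m \<T> t c) k j x" for k j
      by (rule S_map_cong_AE)
    have "matrix_ae_eq m F (F_map A m \<T> t c)"
      unfolding matrix_ae_eq_def F_map_def
    proof (intro ballI)
      fix k j assume "k \<in> {1..2 * m}" "j \<in> {1..2 * m}"
      then have "AE x in unit_measure. F k j x = S_map m Q k j x"
        using QF(2) by (simp add: matrix_ae_eq_def)
      then show "AE x in unit_measure. F k j x = S_map m (Q_matrix A m \<T> t c) k j x"
        using ae[of k j] by eventually_elim simp
    qed
    moreover have "\<forall>\<nu>\<in>{0..2 * m - 2}. \<forall>i<sing_order m \<nu>. t \<nu> i \<in> Lp 1"
      using t(1) assms(1) Lp1_iff by auto
    ultimately show "F \<in> {F. \<exists>(t :: nat \<Rightarrow> nat \<Rightarrow> real \<Rightarrow> complex) (c :: nat \<Rightarrow> nat \<Rightarrow> complex).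
          (\<forall>\<nu>\<in>{0..2 * m - 2}. \<forall>i<sing_order m \<nu>. t \<nu> i \<in> Lp 1) \<and>
          matrix_ae_eq m F (F_map A m \<T> t c)}" by blast
  qed
qed

end
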